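(* Let $u$ be a positive even integer. There are constants $c_{k,\ell}>0$, one for each pair of positive integers $k>\ell$, depending only on $k$ and $\ell$, such that the following holds. For every integer $N\geq 3$ and every set $A$ of $N$ positive integers there is an odd integer $v$ with $1\le v<u$ such that for every positive integer $\ell$ for which $k:=\frac{(u+v)\ell}{u-v}$ is an integer, \[ \mathscr{M}_{(k,\ell)}(A)\geq \frac{N}{k+\ell}+c_{k,\ell}\,\frac{\log N}{\log\log N}. \]
   Context: For positive integers $k>\ell$, a set $S$ of positive integers is $(k,\ell)$-sum-free if for all (not necessarily distinct) $x_1,\dots,x_k,y_1,\dots,y_\ell\in S$ one has $x_1+\dots+x_k\neq y_1+\dots+y_\ell$. For a finite set $A$ of positive integers, $\mathscr{M}_{(k,\ell)}(A)$ is the maximum size of a $(k,\ell)$-sum-free subset of $A$. *)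

theory Defs
  imports Complex_Main
begin

text \<open>The summands \<open>x\<^sub>1, \<dots>, x\<^sub>k\<close> and \<open>y\<^sub>1, \<dots>, y\<^sub>l\<close> are given by functions on the indices
  below \<open>k\<close> and \<open>l\<close>; repetitions are allowed. Positivity of the elements of \<open>S\<close> is not part
  of the predicate and has to be assumed separately.\<close>

definition sum_free :: "nat \<Rightarrow> nat \<Rightarrow> nat set \<Rightarrow> bool" where
  "sum_free k l S \<longleftrightarrow>
     (\<forall>x y :: nat \<Rightarrow> nat. (\<forall>i<k. x i \<in> S) \<longrightarrow> (\<forall>j<l. y j \<in> S) \<longrightarrow>
        (\<Sum>i<k. x i) \<noteq> (\<Sum>j<l. y j))"

text \<open>Meaningful for finite \<open>A\<close> and \<open>k + l > 0\<close>: the set of sizes is then finite, and nonempty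
  because the empty set is sum-free.\<close>

definition max_sum_free :: "nat \<Rightarrow> nat \<Rightarrow> nat set \<Rightarrow> nat" where
  "max_sum_free k l A = Max {card S | S. S \<subseteq> A \<and> sum_free k l S}"

end

theory Submission
  imports Defs "HOL-Analysis.Analysis" "HOL-Computational_Algebra.Primes"
begin

text \<open>
  Here \<open>v / u = (k - l) / (k + l)\<close>; put \<open>w = (k - l) / 2\<close>. The \<open>n \<in> A\<close> for which \<open>n x\<close> lies, modulo 1, in a
  suitable arc of length \<open>1 / (k + l)\<close> form a sum-free set; there are \<open>2 w\<close> such arcs, and \<open>x \<mapsto> w x\<close> carries
  them onto two arcs of length \<open>v / 2 u\<close>, centred at \<open>1/4\<close> and at \<open>3/4\<close>. So it suffices that for some odd
  \<open>v < u\<close>, one of these two arcs and some \<open>y\<close>, the number of \<open>n \<in> A\<close> with \<open>n y\<close> in the arc exceeds its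
  mean by a multiple of \<open>ln N / ln (ln N)\<close>. Replacing \<open>u\<close> by its largest power of two divisor, which
  divides \<open>k + l\<close>, makes the constant depend on \<open>k\<close> and \<open>l\<close> only.

  If all these discrepancies are at most \<open>\<tau>\<close>, then, as they have mean zero, their \<open>L\<^sup>1\<close> norms are at most
  \<open>2 \<tau>\<close>. The difference of the two arcs is a difference of two translates of a square wave \<open>sqw\<close>, and an
  alternating sum over \<open>v\<close> of their sums is the square wave \<open>t \<mapsto> sqw (u t - 1/4)\<close>. A combination of these
  functions over the squarefree products \<open>d\<close> of odd primes below \<open>q\<^sup>4\<close>, where \<open>q\<close> is of order \<open>ln N\<close>, has
  \<open>L\<^sup>1\<close> norm \<open>O(\<tau> ln q)\<close>. Its Fourier series is the sum over \<open>n \<in> A\<close> of \<open>\<gamma>(r) e(n r x)\<close>, where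
  \<open>\<gamma>(-1) = 0\<close>, \<open>\<gamma>(1) = - 2 / \<pi>\<close>, and all other \<open>r\<close> with \<open>\<gamma>(r) \<noteq> 0\<close> have only prime factors
  \<open>\<ge> q\<^sup>4\<close>. Pairing with a band-limited version of the test function of McGehee, Pigno and Smith shows that
  the \<open>L\<^sup>1\<close> norm is at least a multiple of \<open>ln N\<close>: the frequencies \<open>n \<in> A\<close> contribute that much, and the
  multiples \<open>n r\<close> with \<open>\<bar>r\<bar> > 1\<close> are controlled in \<open>L\<^sup>2\<close>, because they rarely coincide.
\<close>

section \<open>Multiples by rough numbers\<close>

text \<open>Two obstacles shape the construction. The McGehee-Pigno-Smith function is controlled at
  the points of \<open>A\<close> but not at their negatives. So the arcs enter through an even and
  an odd square wave, mixed with the factor \<open>1 / sin (pi / (2 * u))\<close>: their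
  coefficients then add at \<open>r = 1\<close> and cancel at \<open>r = - 1\<close>. Secondly, a
  multiple \<open>n * r\<close> may meet another frequency. Sieving forces
  \<open>|r| \<ge> q ^ 4\<close>, and band-limiting the multipliers keeps stage \<open>i\<close> of
  the test function inside \<open>|j| \<le> 2 * J * X i\<close>. Hence only the elements
  \<open>n \<le> X i\<close>, at most \<open>4 / 3 * 4 ^ i\<close> of them, can disturb stage
  \<open>i\<close>. Their \<open>L^2\<close> mass, of order \<open>4 ^ i / q ^ 2\<close>, is
  balanced by the squared norm of the stage, of order \<open>1 / 4 ^ i\<close>, so that each stage
  loses only \<open>O(1 / q)\<close>. The estimate of that mass compares a second moment with the
  one of a \<open>q\<close>-th convolution power and costs \<open>N\<close> to the power
  \<open>1 / q\<close>; this is bounded when \<open>N \<le> 2 ^ q\<close>, whence \<open>q\<close>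
  is of order \<open>ln N\<close>. The denominator \<open>ln (ln N)\<close> stems only from the
  sieve, whose weights \<open>1 / d\<close> have sum \<open>O(ln q)\<close>.\<close>

definition sq_norm :: "(nat \<Rightarrow> real) \<Rightarrow> real" where
  "sq_norm w = (\<Sum>m | w m \<noteq> 0. (w m)\<^sup>2)"

lemma sq_norm_eq:
  assumes "finite S" "\<And>m. w m \<noteq> 0 \<Longrightarrow> m \<in> S"
  shows "sq_norm w = (\<Sum>m\<in>S. (w m)\<^sup>2)"
  unfolding sq_norm_def using assms by (intro sum.mono_neutral_left) auto

lemma sq_norm_nonneg: "0 \<le> sq_norm w"
  unfolding sq_norm_def by (intro sum_nonneg) auto

text \<open>Dirichlet convolution of \<open>w\<close> with \<open>r \<mapsto> 1 / r\<close> on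
  \<open>R\<close>. For the indicator of \<open>B\<close> its value at \<open>m > 0\<close> is the
  sum of \<open>n / m\<close> over the divisors \<open>n\<close> of \<open>m\<close> in
  \<open>B\<close> with \<open>m div n\<close> in \<open>R\<close>, the quantity to be bounded in
  \<open>L^2\<close>.\<close>

definition dil :: "nat set \<Rightarrow> (nat \<Rightarrow> real) \<Rightarrow> nat \<Rightarrow> real" where
  "dil R w m = (\<Sum>r | r \<in> R \<and> r dvd m. w (m div r) / real r)"

lemma dil_alt: "finite R \<Longrightarrow> dil R w m = (\<Sum>r\<in>R. if r dvd m then w (m div r) / real r else 0)"
  unfolding dil_def by (rule sum.inter_filter)

definition supported :: "(nat \<Rightarrow> real) \<Rightarrow> bool" where
  "supported w \<longleftrightarrow> finite {m. w m \<noteq> 0} \<and> w 0 = 0 \<and> (\<forall>m. 0 \<le> w m)"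

lemma dil_nz:
  assumes "dil R w m \<noteq> 0"
  obtains r m' where "r \<in> R" "m = r * m'" "w m' \<noteq> 0 \<or> r = 0"
proof -
  obtain r where "r \<in> R" "r dvd m" "w (m div r) / real r \<noteq> 0"
    using assms unfolding dil_def by (metis (mono_tags, lifting) mem_Collect_eq sum.not_neutral_contains_not_neutral)
  then show ?thesis using that[of r "m div r"] by auto
qed

lemma supported_dil:
  assumes "finite R" "supported w" "0 \<notin> R"
  shows "supported (dil R w)"
proof -
  have "{m. dil R w m \<noteq> 0} \<subseteq> (\<lambda>(r,m). r * m) ` (R \<times> {m. w m \<noteq> 0})"
  proof
    fix m assume "m \<in> {m. dil R w m \<noteq> 0}"
    then obtain r m' where "r \<in> R" "m = r * m'" "w m' \<noteq> 0"
      using assms(3) by (metis (mono_tags) dil_nz mem_Collect_eq)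
    then show "m \<in> (\<lambda>(r,m). r * m) ` (R \<times> {m. w m \<noteq> 0})" by force
  qed
  moreover have "finite ((\<lambda>(r,m). r * m) ` (R \<times> {m. w m \<noteq> 0}))"
    using assms by (auto simp: supported_def)
  ultimately have "finite {m. dil R w m \<noteq> 0}" using finite_subset by blast
  then show ?thesis using assms unfolding supported_def dil_def
    by (auto intro!: sum_nonneg)
qed

lemma dil_inner:
  assumes R: "finite R" "0 \<notin> R" and fin: "finite S" "finite S'"
    and S: "\<And>m. w m \<noteq> 0 \<Longrightarrow> m \<in> S" and S': "\<And>r m. r \<in> R \<Longrightarrow> m \<in> S \<Longrightarrow> r * m \<in> S'"
  shows "(\<Sum>m\<in>S'. v m * dil R w m) = (\<Sum>m\<in>S. w m * (\<Sum>r\<in>R. v (r * m) / real r))"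
proof -
  have "(\<Sum>m\<in>S'. v m * dil R w m) = (\<Sum>m\<in>S'. \<Sum>r\<in>R. if r dvd m then v m * w (m div r) / real r else 0)"
    by (simp add: dil_alt[OF R(1)] sum_distrib_left if_distrib[where f="(*) (v _)"] cong: if_cong)
  also have "\<dots> = (\<Sum>r\<in>R. \<Sum>m\<in>S'. if r dvd m then v m * w (m div r) / real r else 0)"
    by (rule sum.swap)
  also have "\<dots> = (\<Sum>r\<in>R. \<Sum>m\<in>S. v (r * m) * w m / real r)"
  proof (rule sum.cong[OF refl])
    fix r assume r: "r \<in> R"
    then have r0: "r > 0" using R by (cases r) auto
    have "(\<Sum>m\<in>S. v (r * m) * w m / real r) = (\<Sum>m\<in>(*) r ` S. if r dvd m then v m * w (m div r) / real r else 0)"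
      using r0 by (subst sum.reindex) (auto simp: inj_on_def)
    also have "\<dots> = (\<Sum>m\<in>S'. if r dvd m then v m * w (m div r) / real r else 0)"
    proof (intro sum.mono_neutral_left)
      show "\<forall>i\<in>S' - (*) r ` S. (if r dvd i then v i * w (i div r) / real r else 0) = 0"
        using S r0 by (fastforce elim!: dvdE)
    qed (use fin S' r in auto)
    finally show "(\<Sum>m\<in>S'. if r dvd m then v m * w (m div r) / real r else 0) = (\<Sum>m\<in>S. v (r * m) * w m / real r)" by (rule sym)
  qed
  also have "\<dots> = (\<Sum>m\<in>S. w m * (\<Sum>r\<in>R. v (r * m) / real r))"
    by (subst sum.swap) (simp add: sum_distrib_left mult_ac)
  finally show ?thesis .
qed

text \<open>\<open>dil R\<close> is hyponormal on nonnegative functions. The substitution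
  \<open>m \<mapsto> r * r' * m\<close> turns \<open>w (r * m) * w (r' * m)\<close> into a term of
  the expanded square of \<open>dil R w\<close>. That square has further terms, such as those at
  common multiples of \<open>r\<close> and \<open>r'\<close> not divisible by \<open>r * r'\<close>,
  and all of them are nonnegative.\<close>

lemma dil_adjoint_le:
  assumes R: "finite R" "0 \<notin> R" and w: "supported w" and S: "finite S"
  shows "(\<Sum>m\<in>S. (\<Sum>r\<in>R. w (r * m) / real r)\<^sup>2) \<le> sq_norm (dil R w)"
proof -
  let ?T = "{m. dil R w m \<noteq> 0} \<union> (\<lambda>(r,r',m). r * r' * m) ` (R \<times> R \<times> S)"
  have T: "finite ?T" using supported_dil[OF R(1) w R(2)] R S by (auto simp: supported_def)
  have w0: "0 \<le> w m" for m using w by (auto simp: supported_def)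
  have "(\<Sum>m\<in>S. (\<Sum>r\<in>R. w (r * m) / real r)\<^sup>2)
      = (\<Sum>r\<in>R. \<Sum>r'\<in>R. \<Sum>m\<in>S. w (r * m) * w (r' * m) / (real r * real r'))"
  proof -
    have "(\<Sum>m\<in>S. (\<Sum>r\<in>R. w (r * m) / real r)\<^sup>2)
      = (\<Sum>m\<in>S. \<Sum>r\<in>R. \<Sum>r'\<in>R. w (r * m) * w (r' * m) / (real r * real r'))"
      by (simp add: power2_eq_square sum_product)
    then show ?thesis by (simp add: sum.swap[of _ R S])
  qed
  also have "\<dots> \<le> (\<Sum>r\<in>R. \<Sum>r'\<in>R. \<Sum>m\<in>?T. if r dvd m \<and> r' dvd m
      then w (m div r) * w (m div r') / (real r * real r') else 0)"
  proof (intro sum_mono)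
    fix r r' assume r: "r \<in> R" "r' \<in> R"
    then have r0: "r > 0" "r' > 0" using R by (auto intro: gr0I)
    have "(\<Sum>m\<in>S. w (r * m) * w (r' * m) / (real r * real r'))
      = (\<Sum>m\<in>(\<lambda>m. r * r' * m) ` S. if r dvd m \<and> r' dvd m
      then w (m div r) * w (m div r') / (real r * real r') else 0)"
      using r0 by (subst sum.reindex) (auto simp: inj_on_def mult.assoc mult.left_commute mult.commute intro!: sum.cong)
    also have "\<dots> \<le> (\<Sum>m\<in>?T. if r dvd m \<and> r' dvd m
      then w (m div r) * w (m div r') / (real r * real r') else 0)"
    proof (intro sum_mono2)
      show "(\<lambda>m. r * r' * m) ` S \<subseteq> ?T" using r by (force simp: image_iff)
    qed (use T w0 in auto)
    finally show "(\<Sum>m\<in>S. w (r * m) * w (r' * m) / (real r * real r')) \<le> \<dots>" .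
  qed
  also have "\<dots> = (\<Sum>m\<in>?T. (dil R w m)\<^sup>2)"
  proof -
    have "(dil R w m)\<^sup>2 = (\<Sum>r\<in>R. \<Sum>r'\<in>R. if r dvd m \<and> r' dvd m
      then w (m div r) * w (m div r') / (real r * real r') else 0)" for m
    proof -
      have "dil R w m = (\<Sum>r\<in>R. if r dvd m then w (m div r) / real r else 0)"
        by (rule dil_alt[OF R(1)])
      then show ?thesis
        by (auto simp: power2_eq_square sum_product intro!: sum.cong)
    qed
    then show ?thesis by (simp add: sum.swap[of _ R ?T])
  qed
  also have "\<dots> = sq_norm (dil R w)"
    by (rule sq_norm_eq[symmetric]) (use T in auto)
  finally show ?thesis .
qed

text \<open>Cauchy-Schwarz after one \<open>dil R\<close> has been moved to the other side;
  \<open>dil_adjoint_le\<close> then replaces the adjoint by \<open>dil R\<close> itself.\<close>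

lemma dil_log_convex:
  assumes R: "finite R" "0 \<notin> R" and w: "supported w"
  shows "(sq_norm (dil R w))\<^sup>2 \<le> sq_norm w * sq_norm (dil R (dil R w))"
proof -
  let ?S = "{m. w m \<noteq> 0}"
  let ?S' = "{m. dil R w m \<noteq> 0} \<union> (\<lambda>(r,m). r * m) ` (R \<times> ?S)"
  have w1: "supported (dil R w)" using supported_dil R w by blast
  have fin: "finite ?S" "finite ?S'" using w w1 R by (auto simp: supported_def)
  have "sq_norm (dil R w) = (\<Sum>m\<in>?S'. dil R w m * dil R w m)"
    by (subst sq_norm_eq[OF fin(2)]) (auto simp: power2_eq_square)
  also have "\<dots> = (\<Sum>m\<in>?S. w m * (\<Sum>r\<in>R. dil R w (r * m) / real r))"
    by (rule dil_inner[OF R fin]) auto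
  finally have "(sq_norm (dil R w))\<^sup>2 = (\<Sum>m\<in>?S. w m * (\<Sum>r\<in>R. dil R w (r * m) / real r))\<^sup>2" by simp
  also have "\<dots> \<le> (\<Sum>m\<in>?S. (w m)\<^sup>2) * (\<Sum>m\<in>?S. (\<Sum>r\<in>R. dil R w (r * m) / real r)\<^sup>2)"
    by (rule Cauchy_Schwarz_ineq_sum)
  also have "\<dots> \<le> sq_norm w * sq_norm (dil R (dil R w))"
    using dil_adjoint_le[OF R w1 fin(1)] by (simp add: sq_norm_def mult_left_mono sum_nonneg)
  finally show ?thesis .
qed

lemma supported_iter:
  assumes R: "finite R" "0 \<notin> R" and w: "supported w"
  shows "supported ((dil R ^^ k) w)"
  using assms by (induction k) (auto intro: supported_dil)

text \<open>By log-convexity the quotients of successive second moments increase, so the first is at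
  most their geometric mean. A bound for a high convolution power thus yields one for
  \<open>dil R w\<close>, and crude factors in it cost only their \<open>Suc k\<close>-th
  root.\<close>

lemma dil_power_bound:
  assumes R: "finite R" "0 \<notin> R" and w: "supported w"
  shows "sq_norm (dil R w) ^ Suc k \<le> sq_norm w ^ k * sq_norm ((dil R ^^ Suc k) w)"
proof -
  define P where "P j = sq_norm ((dil R ^^ j) w)" for j
  have P0: "P j \<ge> 0" for j by (simp add: P_def sq_norm_nonneg)
  have conv: "(P (Suc j))\<^sup>2 \<le> P j * P (Suc (Suc j))" for j
    unfolding P_def using dil_log_convex[OF R supported_iter[OF R w, of j]] by simp
  \<comment> \<open>The first quotient against a later one, multiplied out because second moments
    may vanish.\<close>
  have rat: "P j * P 1 \<le> P 0 * P (Suc j)" for j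
  proof (induction j)
    case (Suc j)
    show ?case
    proof (cases "P (Suc j) = 0")
      case False
      then have pos: "P (Suc j) > 0" using P0[of "Suc j"] by simp
      have "P j * P (Suc (Suc j)) > 0" using conv[of j] pos by (smt (verit) zero_less_power)
      then have pj: "P j > 0" using P0[of j] by (cases "P j = 0") auto
      have "P (Suc j) * P 1 * P j \<le> P 0 * (P (Suc j))\<^sup>2"
        using mult_right_mono[OF Suc, of "P (Suc j)"] pos by (simp add: power2_eq_square mult_ac)
      also have "\<dots> \<le> P 0 * (P j * P (Suc (Suc j)))"
        using conv P0 by (intro mult_left_mono)
      finally have "(P (Suc j) * P 1) * P j \<le> (P 0 * P (Suc (Suc j))) * P j" by (simp add: mult_ac)
      then show ?thesis using pj by simp
    qed (simp add: P0)
  qed (simp add: P0)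
  have "P 1 ^ Suc j \<le> P 0 ^ j * P (Suc j)" for j
  proof (induction j)
    case (Suc j)
    have "P 1 ^ Suc (Suc j) \<le> (P 0 ^ j * P (Suc j)) * P 1"
      using mult_right_mono[OF Suc P0[of 1]] by (simp add: mult_ac)
    also have "\<dots> \<le> P 0 ^ j * (P 0 * P (Suc (Suc j)))"
      using rat[of "Suc j"] P0[of 0] by (simp add: mult.assoc mult_left_mono)
    finally show ?case by (simp add: mult_ac)
  qed simp
  from this[of k] show ?thesis by (simp add: P_def)
qed

section \<open>Rough numbers and ordered factorizations\<close>

abbreviation Om :: "nat \<Rightarrow> nat" where "Om n \<equiv> size (prime_factorization n)"

definition rough :: "nat \<Rightarrow> nat \<Rightarrow> bool" where
  "rough y n \<longleftrightarrow> 0 < n \<and> (\<forall>p. prime p \<longrightarrow> p dvd n \<longrightarrow> y \<le> p)"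

lemma rough_Om: "rough y n \<Longrightarrow> y ^ Om n \<le> n"
proof -
  assume r: "rough y n"
  then have n: "n \<noteq> 0" by (auto simp: rough_def)
  have "(\<Prod>p\<in>#M. y) \<le> \<Prod>\<^sub># M" if "\<forall>p\<in>#M. y \<le> p" for M :: "nat multiset"
    using that by (induction M) (auto intro: mult_le_mono)
  from this[of "prime_factorization n"] show ?thesis
    using r n by (simp add: rough_def prod_mset_prime_factorization_nat in_prime_factors_iff)
qed

text \<open>\<open>k ^ Om d\<close> bounds the number of ordered factorizations of \<open>d\<close>
  into \<open>k\<close> factors, and this is the passage from \<open>k\<close> to
  \<open>k + 1\<close>. The induction removes a prime: a divisor of \<open>p * x\<close> divides
  \<open>x\<close> or is \<open>p\<close> times a divisor of \<open>x\<close>.\<close>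

lemma sum_divisors_Om:
  assumes "n > 0"
  shows "(\<Sum>d | d dvd n. k ^ Om d) \<le> (Suc k) ^ Om n"
  using assms
proof (induction n rule: prime_divisors_induct)
  case (factor p x)
  then have x: "x > 0" and p: "prime p" by (auto intro: gr0I)
  have "{d. d dvd p * x} \<subseteq> {d. d dvd x} \<union> (*) p ` {d. d dvd x}"
  proof
    fix d assume "d \<in> {d. d dvd p * x}"
    then have d: "d dvd p * x" by simp
    show "d \<in> {d. d dvd x} \<union> (*) p ` {d. d dvd x}"
    proof (cases "p dvd d")
      case True
      then obtain e where "d = p * e" by (elim dvdE)
      then show ?thesis using d p by (auto simp: prime_gt_0_nat)
    next
      case False
      then have "coprime d p" using p prime_imp_coprime coprime_commute by blast
      then show ?thesis using d by (simp add: coprime_dvd_mult_right_iff)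
    qed
  qed
  then have "(\<Sum>d | d dvd p * x. k ^ Om d) \<le> (\<Sum>d\<in>{d. d dvd x} \<union> (*) p ` {d. d dvd x}. k ^ Om d)"
    using x by (intro sum_mono2) auto
  also have "\<dots> \<le> (\<Sum>d\<in>{d. d dvd x}. k ^ Om d) + (\<Sum>d\<in>(*) p ` {d. d dvd x}. k ^ Om d)"
    using x by (subst sum_Un_nat) auto
  also have "(\<Sum>d\<in>(*) p ` {d. d dvd x}. k ^ Om d) = (\<Sum>d | d dvd x. k ^ Om (p * d))"
    using p by (subst sum.reindex) (auto simp: inj_on_def prime_gt_0_nat)
  also have "\<dots> = (\<Sum>d | d dvd x. k * k ^ Om d)"
    using p x by (intro sum.cong refl) (auto simp: prime_factorization_mult prime_factorization_prime dest: dvd_pos_nat)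
  also have "(\<Sum>d | d dvd x. k ^ Om d) + (\<Sum>d | d dvd x. k * k ^ Om d) = Suc k * (\<Sum>d | d dvd x. k ^ Om d)"
    by (simp add: sum_distrib_left sum.distrib)
  also have "\<dots> \<le> Suc k * (Suc k) ^ Om x" using factor.IH x by (intro mult_left_mono) auto
  also have "\<dots> = (Suc k) ^ Om (p * x)"
    using p x by (simp add: prime_factorization_mult prime_factorization_prime)
  finally show ?case .
qed auto

text \<open>The unit of Dirichlet convolution. If \<open>0 \<notin> R\<close>, applying
  \<open>dil R\<close> to it \<open>k\<close> times gives at \<open>m > 0\<close> the number of
  ordered factorizations of \<open>m\<close> into \<open>k\<close> elements of \<open>R\<close>,
  divided by \<open>m\<close>.\<close>

definition unit1 :: "nat \<Rightarrow> real" where "unit1 m = (if m = 1 then 1 else 0)"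

lemma iter_unit_bound:
  assumes R: "finite R" "\<And>r. r \<in> R \<Longrightarrow> rough y r \<and> 1 < r" and y: "y > 1"
  shows "(dil R ^^ k) unit1 m \<noteq> 0 \<Longrightarrow> rough y m \<and> y ^ k \<le> m"
    and "m > 0 \<Longrightarrow> (dil R ^^ k) unit1 m \<le> real (k ^ Om m) / real m"
proof (induction k arbitrary: m)
  case 0
  {
    case 1 then show ?case by (auto simp: unit1_def rough_def split: if_splits)
  next
    case 2 then show ?case by (auto simp: unit1_def)
  }
next
  case (Suc k)
  {
    case 1
    then have "dil R ((dil R ^^ k) unit1) m \<noteq> 0" by simp
    then obtain r m' where rm: "r \<in> R" "m = r * m'" "(dil R ^^ k) unit1 m' \<noteq> 0 \<or> r = 0"
      by (rule dil_nz)
    then have r: "rough y r" "1 < r" using R(2)[OF rm(1)] by auto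
    then have "(dil R ^^ k) unit1 m' \<noteq> 0" using rm by auto
    then have m': "rough y m'" "y ^ k \<le> m'" using Suc(1) by blast+
    obtain p where "prime p" "p dvd r" using r by (metis nat_neq_iff prime_factor_nat)
    then have "y \<le> r" using r by (meson dvd_imp_le le_trans rough_def)
    then have "y ^ Suc k \<le> m" using m' rm by (simp add: mult_le_mono)
    moreover have "rough y m" using m' r rm by (auto simp: rough_def prime_dvd_mult_iff)
    ultimately show ?case by simp
  next
    case 2
    have "(dil R ^^ Suc k) unit1 m = (\<Sum>r | r \<in> R \<and> r dvd m. (dil R ^^ k) unit1 (m div r) / real r)"
      by (simp add: dil_def)
    also have "\<dots> \<le> (\<Sum>r | r \<in> R \<and> r dvd m. real (k ^ Om (m div r)) / real m)"
    proof (intro sum_mono)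
      fix r assume r: "r \<in> {r. r \<in> R \<and> r dvd m}"
      then have "r > 0" "m div r > 0" using 2 by (auto intro!: Nat.gr0I elim!: dvdE)
      have "(dil R ^^ k) unit1 (m div r) / real r \<le> (real (k ^ Om (m div r)) / real (m div r)) / real r"
        using Suc(2)[OF \<open>m div r > 0\<close>] by (intro divide_right_mono) auto
      also have "\<dots> = real (k ^ Om (m div r)) / real m"
        using r \<open>r > 0\<close> by (auto elim!: dvdE)
      finally show "(dil R ^^ k) unit1 (m div r) / real r \<le> real (k ^ Om (m div r)) / real m" .
    qed
    also have "\<dots> = (\<Sum>d\<in>(\<lambda>r. m div r) ` {r. r \<in> R \<and> r dvd m}. real (k ^ Om d) / real m)"
    proof (subst sum.reindex)
      show "inj_on (\<lambda>r. m div r) {r. r \<in> R \<and> r dvd m}"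
      proof (rule inj_onI, clarify)
        fix a b assume "a dvd m" "b dvd m" "m div a = m div b"
        then show "a = b" using 2 by (metis dvd_div_mult_self dvd_mult_div_cancel mult_cancel_left nonzero_mult_div_cancel_left not_gr_zero mult_0)
      qed
    qed simp
    also have "\<dots> \<le> (\<Sum>d | d dvd m. real (k ^ Om d) / real m)"
    proof (intro sum_mono2)
      show "(\<lambda>r. m div r) ` {r. r \<in> R \<and> r dvd m} \<subseteq> {d. d dvd m}"
        by (auto elim!: dvdE)
    qed (use 2 in auto)
    also have "\<dots> = real (\<Sum>d | d dvd m. k ^ Om d) / real m" by (simp add: sum_divide_distrib)
    also have "\<dots> \<le> real ((Suc k) ^ Om m) / real m"
      using sum_divisors_Om[OF 2, of k] by (intro divide_right_mono of_nat_mono) auto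
    finally show ?case .
  }
qed


text \<open>Comparison with the telescoping sum of \<open>- 2 / sqrt m\<close>; the 3 in place of 2
  pays for the shift from \<open>Y - 1\<close> to \<open>Y\<close>. The summand is kept in the shape
  in which it arises, the square of the fourth root of \<open>m\<close> over
  \<open>m\<close>.\<close>

lemma sum_three_halves:
  assumes "finite S" "\<And>m. m \<in> S \<Longrightarrow> Y \<le> m" "2 \<le> Y"
  shows "(\<Sum>m\<in>S. sqrt (real m) / (real m)\<^sup>2) \<le> 3 / sqrt (real Y)"
proof -
  define f where "f m = - 2 / sqrt (real m)" for m :: nat
  have step: "sqrt (real m) / (real m)\<^sup>2 \<le> f m - f (m - 1)" if "2 \<le> m" for m
  proof -
    define s where "s = sqrt (real m)"
    define t where "t = sqrt (real (m - 1))"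
    have s: "s > 0" "s\<^sup>2 = real m" and t: "t > 0" "t\<^sup>2 = real m - 1"
      using that by (auto simp: s_def t_def of_nat_diff)
    have ts: "t \<le> s" using that by (auto simp: s_def t_def)
    have "t * (s + t) \<le> s * (s + s)" using ts s t by (intro mult_mono) auto
    then have "1 / (s * (s + s)) \<le> 1 / (t * (s + t))"
      using s(1) t(1) by (intro divide_left_mono mult_pos_pos) auto
    then have "1 / (2 * s\<^sup>2) \<le> 1 / (t * (s + t))" by (simp add: power2_eq_square algebra_simps)
    moreover have "1 / (t * (s + t)) = (s - t) / t"
    proof -
      have "(s - t) * (s + t) = 1" using s t by (simp add: algebra_simps power2_eq_square)
      then have "1 / (t * (s + t)) = ((s - t) * (s + t)) / (t * (s + t))" by simp
      then show ?thesis using s(1) t(1) by simp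
    qed
    ultimately have "1 / (2 * s\<^sup>2) \<le> (s - t) / t" by simp
    then have "(2 / s) * (1 / (2 * s\<^sup>2)) \<le> (2 / s) * ((s - t) / t)" using s by (intro mult_left_mono) auto
    moreover have "(2 / s) * (1 / (2 * s\<^sup>2)) = s / (s\<^sup>2)\<^sup>2" using s(1) by (simp add: field_simps power2_eq_square)
    moreover have "(2 / s) * ((s - t) / t) = f m - f (m - 1)"
      using s t unfolding f_def s_def[symmetric] t_def[symmetric] by (simp add: field_simps)
    ultimately show ?thesis using s by (simp add: s_def[symmetric])
  qed
  define Z where "Z = Max (insert Y S)"
  have Z: "S \<subseteq> {Y..Z}" "Y \<le> Z" using assms by (auto simp: Z_def)
  have "(\<Sum>m\<in>S. sqrt (real m) / (real m)\<^sup>2) \<le> (\<Sum>m\<in>{Y..Z}. sqrt (real m) / (real m)\<^sup>2)"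
    using Z by (intro sum_mono2) auto
  also have "\<dots> \<le> (\<Sum>m\<in>{Y..Z}. f m - f (m - 1))"
    using assms(3) by (intro sum_mono step) auto
  also have "\<dots> = f Z - f (Y - 1)"
    using Z(2) assms(3)
  proof (induction Z rule: dec_induct)
    case (step n)
    then show ?case by (simp add: sum.cl_ivl_Suc)
  qed simp
  also have "\<dots> \<le> 2 / sqrt (real (Y - 1))" by (simp add: f_def)
  also have "\<dots> \<le> 3 / sqrt (real Y)"
  proof -
    have "2 * sqrt (real Y) = sqrt (4 * real Y)" by (simp add: real_sqrt_mult)
    also have "\<dots> \<le> sqrt (9 * real (Y - 1))" using assms(3) by (intro real_sqrt_le_mono) (auto simp: of_nat_diff)
    also have "\<dots> = 3 * sqrt (real (Y - 1))" by (simp add: real_sqrt_mult)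
    finally show ?thesis using assms(3) by (simp add: field_simps)
  qed
  finally show ?thesis .
qed

text \<open>\<open>dil R\<close> commutes with multiplicative translation, so its iterates on an
  indicator are superpositions of translated iterates on \<open>unit1\<close>.\<close>

lemma iter_indicator:
  assumes R: "finite R" "0 \<notin> R" and B: "finite B" "0 \<notin> B"
  shows "(dil R ^^ k) (\<lambda>m. if m \<in> B then 1 else 0) m
    = (\<Sum>n\<in>B. if n dvd m then (dil R ^^ k) unit1 (m div n) else 0)"
proof (induction k arbitrary: m)
  case 0
  have "(if n dvd m then unit1 (m div n) else 0) = (if n = m then 1 else 0)" if "n \<in> B" for n
    using that B by (cases "n = 0") (auto simp: unit1_def elim!: dvdE)
  then have "(\<Sum>n\<in>B. if n dvd m then unit1 (m div n) else 0) = (\<Sum>n\<in>B. if n = m then 1 else 0)"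
    by (intro sum.cong refl)
  then show ?case using B by (simp cong: if_cong)
next
  case (Suc k)
  let ?a = "(dil R ^^ k) unit1"
  have "(dil R ^^ Suc k) (\<lambda>m. if m \<in> B then 1 else 0) m
    = (\<Sum>r\<in>R. if r dvd m then (\<Sum>n\<in>B. if n dvd m div r then ?a (m div r div n) else 0) / real r else 0)"
    by (simp only: funpow.simps o_apply dil_alt[OF R(1), of "(dil R ^^ k) (\<lambda>m. if m \<in> B then 1 else 0)"] Suc)
  also have "\<dots> = (\<Sum>r\<in>R. \<Sum>n\<in>B. if r dvd m \<and> n dvd m div r then ?a (m div r div n) / real r else 0)"
    by (intro sum.cong refl) (auto simp: sum_divide_distrib intro!: sum.cong)
  also have "\<dots> = (\<Sum>r\<in>R. \<Sum>n\<in>B. if n dvd m \<and> r dvd m div n then ?a (m div n div r) / real r else 0)"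
  proof (intro sum.cong refl)
    fix r n assume "r \<in> R" "n \<in> B"
    then have "r > 0" "n > 0" using R B by (auto intro: gr0I)
    then have "(r dvd m \<and> n dvd m div r) = (n dvd m \<and> r dvd m div n)"
      by (metis dvd_div_iff_mult dvd_mult_left dvd_mult_right mult.commute not_gr_zero)
    moreover have "m div r div n = m div n div r" by (simp add: div_mult2_eq[symmetric] mult.commute)
    ultimately show "(if r dvd m \<and> n dvd m div r then ?a (m div r div n) / real r else 0)
      = (if n dvd m \<and> r dvd m div n then ?a (m div n div r) / real r else 0)" by simp
  qed
  also have "\<dots> = (\<Sum>n\<in>B. if n dvd m then (dil R ^^ Suc k) unit1 (m div n) else 0)"
    by (subst sum.swap) (auto simp: dil_alt[OF R(1), of ?a] intro!: sum.cong)
  finally show ?case .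
qed

text \<open>The exponent 4 has its origin here. A \<open>q ^ 4\<close>-rough \<open>m\<close> has at
  most \<open>q ^ Om m\<close> ordered factorizations into \<open>q\<close> factors, hence at most
  the fourth root of \<open>m\<close>. The squares are therefore at most \<open>m\<close> to the
  power -3/2, and only \<open>m \<ge> q ^ (4 * q)\<close> occur.\<close>

lemma sq_norm_iter_unit:
  assumes R: "finite R" "\<And>r. r \<in> R \<Longrightarrow> rough (q^4) r \<and> 1 < r" and q: "2 \<le> q"
  shows "sq_norm ((dil R ^^ q) unit1) \<le> 3 / real q ^ (2 * q)"
proof -
  let ?a = "(dil R ^^ q) unit1"
  have R0: "0 \<notin> R" using R(2) by force
  have s: "supported ?a" using R(1) R0
    by (rule supported_iter) (auto simp: supported_def unit1_def)
  have y: "1 < q ^ 4" using q by (intro one_less_power) auto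
  have "sq_norm ?a = (\<Sum>m | ?a m \<noteq> 0. (?a m)\<^sup>2)" by (simp add: sq_norm_def)
  also have "\<dots> \<le> (\<Sum>m | ?a m \<noteq> 0. sqrt (real m) / (real m)\<^sup>2)"
  proof (intro sum_mono)
    fix m assume "m \<in> {m. ?a m \<noteq> 0}"
    then have m: "rough (q^4) m" using iter_unit_bound(1)[OF R y] by auto
    then have m0: "m > 0" by (simp add: rough_def)
    have "(q ^ Om m) ^ 4 \<le> m" using rough_Om[OF m] by (simp add: power_mult[symmetric] mult.commute)
    then have "(real (q ^ Om m) ^ 2)\<^sup>2 \<le> real m"
      by (simp add: mult.commute flip: power_mult of_nat_power)
    then have "real (q ^ Om m) ^ 2 \<le> sqrt (real m)" using real_le_rsqrt by blast
    have "(?a m)\<^sup>2 \<le> (real (q ^ Om m) / real m)\<^sup>2"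
      using iter_unit_bound(2)[OF R y m0] s by (intro power_mono) (auto simp: supported_def)
    also have "\<dots> \<le> sqrt (real m) / (real m)\<^sup>2"
      using \<open>real (q ^ Om m) ^ 2 \<le> sqrt (real m)\<close> by (simp add: power_divide divide_right_mono)
    finally show "(?a m)\<^sup>2 \<le> sqrt (real m) / (real m)\<^sup>2" .
  qed
  also have "\<dots> \<le> 3 / sqrt (real ((q^4)^q))"
  proof (rule sum_three_halves)
    show "2 \<le> (q ^ 4) ^ q"
      using q y self_le_power[of "q ^ 4" q] by linarith
  qed (use s iter_unit_bound(1)[OF R y] in \<open>auto simp: supported_def\<close>)
  also have "sqrt (real ((q^4)^q)) = real q ^ (2 * q)"
  proof -
    have "real ((q^4)^q) = (real q ^ (2 * q))\<^sup>2" by (simp add: power_mult[symmetric] mult.commute)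
    then show ?thesis by simp
  qed
  finally show ?thesis .
qed

text \<open>The multiples \<open>r n\<close> of elements of \<open>B\<close> by rough numbers overlap so little that the sum behaves
  like its diagonal. The second moment is compared with its \<open>q\<close>-th Dirichlet convolution power.\<close>

lemma rough_multiples_l2:
  assumes B: "finite B" "\<And>n. n \<in> B \<Longrightarrow> 0 < n" "card B \<le> 2 ^ q" and q: "2 \<le> q" and M: "finite M"
    "\<And>m. m \<in> M \<Longrightarrow> 0 < m"
  shows "(\<Sum>m\<in>M. (\<Sum>n | n \<in> B \<and> n dvd m \<and> rough (q^4) (m div n) \<and> m div n \<noteq> 1. real n / real m)\<^sup>2)
    \<le> 6 * real (card B) / (real q)\<^sup>2"
proof -
  \<comment> \<open>Only quotients dividing some \<open>m\<close> in \<open>M\<close> matter, so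
    cutting at \<open>Max M\<close> makes the set finite without loss.\<close>
  define R where "R = {r. rough (q^4) r \<and> 1 < r \<and> r \<le> Max M}"
  define w :: "nat \<Rightarrow> real" where "w m = (if m \<in> B then 1 else 0)" for m
  have R: "finite R" "\<And>r. r \<in> R \<Longrightarrow> rough (q^4) r \<and> 1 < r" "0 \<notin> R" by (auto simp: R_def)
  have B0: "0 \<notin> B" using B(2) by force
  have w: "supported w" using B B0 by (auto simp: supported_def w_def)
  have w1: "supported (dil R w)" using supported_dil R w by blast
  have sw: "sq_norm w = card B"
    using B by (subst sq_norm_eq[of B]) (auto simp: w_def split: if_splits)
  have eq: "(\<Sum>n | n \<in> B \<and> n dvd m \<and> rough (q^4) (m div n) \<and> m div n \<noteq> 1. real n / real m) = dil R w m"
    if m: "m \<in> M" for m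
  proof -
    have m0: "m > 0" "m \<le> Max M" using M m by auto
    have "dil R w m = (\<Sum>r | r \<in> R \<and> r dvd m \<and> m div r \<in> B. 1 / real r)"
      unfolding dil_def w_def using R(1) by (auto intro!: sum.mono_neutral_cong_right split: if_splits)
    also have "\<dots> = (\<Sum>n | n \<in> B \<and> n dvd m \<and> rough (q^4) (m div n) \<and> m div n \<noteq> 1. real n / real m)"
    proof (rule sum.reindex_bij_witness[of _ "\<lambda>n. m div n" "\<lambda>r. m div r"])
      fix n assume n: "n \<in> {n. n \<in> B \<and> n dvd m \<and> rough (q^4) (m div n) \<and> m div n \<noteq> 1}"
      then show "m div (m div n) = n" using m0 by (auto elim!: dvdE)
      have "m div n \<le> Max M" using m0 by (meson div_le_dividend le_trans)
      then show "m div n \<in> {r \<in> R. r dvd m \<and> m div r \<in> B}"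
        using n m0 by (auto simp: R_def rough_def elim!: dvdE)
    next
      fix r assume r: "r \<in> {r \<in> R. r dvd m \<and> m div r \<in> B}"
      then show "m div (m div r) = r" using m0 by (auto elim!: dvdE)
      show "m div r \<in> {n. n \<in> B \<and> n dvd m \<and> rough (q^4) (m div n) \<and> m div n \<noteq> 1}"
        using r m0 by (auto simp: R_def elim!: dvdE)
      show "real (m div r) / real m = 1 / real r" using r m0 by (auto elim!: dvdE)
    qed
    finally show ?thesis ..
  qed
  have "(\<Sum>m\<in>M. (\<Sum>n | n \<in> B \<and> n dvd m \<and> rough (q^4) (m div n) \<and> m div n \<noteq> 1. real n / real m)\<^sup>2)
     = (\<Sum>m\<in>M. (dil R w m)\<^sup>2)" by (rule sum.cong[OF refl]) (simp only: eq)
  also have "\<dots> \<le> (\<Sum>m\<in>M \<union> {m. dil R w m \<noteq> 0}. (dil R w m)\<^sup>2)"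
    using M w1 by (intro sum_mono2) (auto simp: supported_def)
  also have "\<dots> = sq_norm (dil R w)"
    by (rule sq_norm_eq[symmetric]) (use M w1 in \<open>auto simp: supported_def\<close>)
  also have "\<dots> \<le> 6 * real (card B) / (real q)\<^sup>2"
  proof -
    obtain k where k: "q = Suc k" using q by (cases q) auto
    let ?a = "(dil R ^^ q) unit1"
    have a: "supported ?a" using R(1,3) by (rule supported_iter) (auto simp: supported_def unit1_def)
    let ?T = "{m. (dil R ^^ q) w m \<noteq> 0} \<union> (\<lambda>(n,m). n * m) ` (B \<times> {m. ?a m \<noteq> 0})"
    have T: "finite ?T" using B a supported_iter[OF R(1,3) w, of q] by (auto simp: supported_def)
    have "sq_norm ((dil R ^^ q) w) = (\<Sum>m\<in>?T. ((dil R ^^ q) w m)\<^sup>2)"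
      by (rule sq_norm_eq[OF T]) auto
    \<comment> \<open>Cauchy-Schwarz over \<open>B\<close> loses a factor \<open>card B\<close>,
      harmless because a \<open>q\<close>-th root is taken at the end.\<close>
    also have "\<dots> \<le> (\<Sum>m\<in>?T. real (card B) * (\<Sum>n\<in>B. (if n dvd m then ?a (m div n) else 0)\<^sup>2))"
    proof (intro sum_mono)
      fix m
      have "((dil R ^^ q) w m)\<^sup>2 = (\<Sum>n\<in>B. 1 * (if n dvd m then ?a (m div n) else 0))\<^sup>2"
        using iter_indicator[OF R(1,3) B(1) B0, of q m] by (simp add: w_def[abs_def])
      also have "\<dots> \<le> (\<Sum>n\<in>B. 1\<^sup>2) * (\<Sum>n\<in>B. (if n dvd m then ?a (m div n) else 0)\<^sup>2)"
        by (rule Cauchy_Schwarz_ineq_sum)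
      finally show "((dil R ^^ q) w m)\<^sup>2 \<le> real (card B) * (\<Sum>n\<in>B. (if n dvd m then ?a (m div n) else 0)\<^sup>2)"
        by simp
    qed
    also have "\<dots> = real (card B) * (\<Sum>n\<in>B. \<Sum>m\<in>?T. (if n dvd m then ?a (m div n) else 0)\<^sup>2)"
      unfolding sum_distrib_left[symmetric] by (subst sum.swap) (rule refl)
    also have "\<dots> = real (card B) * (\<Sum>n\<in>B. sq_norm ?a)"
    proof -
      have "(\<Sum>m\<in>?T. (if n dvd m then ?a (m div n) else 0)\<^sup>2) = sq_norm ?a" if n: "n \<in> B" for n
      proof -
        have n0: "n > 0" using B n by auto
        have "sq_norm ?a = (\<Sum>m | ?a m \<noteq> 0. (?a m)\<^sup>2)" by (simp add: sq_norm_def)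
        also have "\<dots> = (\<Sum>m\<in>(*) n ` {m. ?a m \<noteq> 0}. (if n dvd m then ?a (m div n) else 0)\<^sup>2)"
          using n0 by (subst sum.reindex) (auto simp: inj_on_def)
        also have "\<dots> = (\<Sum>m\<in>?T. (if n dvd m then ?a (m div n) else 0)\<^sup>2)"
        proof (rule sum.mono_neutral_left[OF T])
          show "(*) n ` {m. ?a m \<noteq> 0} \<subseteq> ?T" using n by force
          show "\<forall>i\<in>?T - (*) n ` {m. ?a m \<noteq> 0}. (if n dvd i then ?a (i div n) else 0)\<^sup>2 = 0"
          proof
            fix i assume "i \<in> ?T - (*) n ` {m. ?a m \<noteq> 0}"
            then have "?a k = 0" if "i = n * k" for k using that by blast
            then show "(if n dvd i then ?a (i div n) else 0)\<^sup>2 = 0" using n0 by (auto elim!: dvdE)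
          qed
        qed
        finally show ?thesis ..
      qed
      then show ?thesis by simp
    qed
    also have "\<dots> \<le> real (card B) * (real (card B) * (3 / real q ^ (2 * q)))"
      using mult_left_mono[OF mult_left_mono[OF sq_norm_iter_unit[OF R(1,2) q], of "real (card B)"], of "real (card B)"] by simp
    finally have fin: "sq_norm ((dil R ^^ q) w) \<le> real (card B) * (real (card B) * (3 / real q ^ (2 * q)))" .
    have "sq_norm (dil R w) ^ q \<le> real (card B) ^ k * sq_norm ((dil R ^^ q) w)"
      using dil_power_bound[OF R(1,3) w, of k] by (simp add: k sw)
    also have "\<dots> \<le> real (card B) ^ k * (real (card B) * (real (card B) * (3 / real q ^ (2 * q))))"
      using fin by (intro mult_left_mono) auto
    also have "\<dots> = real (card B) ^ q * (real (card B) * 3) / real q ^ (2 * q)" by (simp add: k)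
    \<comment> \<open>Here \<open>card B \<le> 2 ^ q\<close> enters: the surplus
      \<open>3 * card B\<close> is at most \<open>6 ^ q\<close>.\<close>
    also have "\<dots> \<le> real (card B) ^ q * (2 ^ q * 3 ^ q) / real q ^ (2 * q)"
    proof (intro divide_right_mono mult_left_mono mult_mono)
      show "real (card B) \<le> 2 ^ q" using B(3) by (metis of_nat_le_iff of_nat_numeral of_nat_power)
      show "(3::real) \<le> 3 ^ q" using q by (metis one_le_numeral power_increasing power_one_right le_trans one_le_numeral)
    qed auto
    also have "\<dots> = (6 * real (card B) / (real q)\<^sup>2) ^ q"
      by (simp add: power_divide power_mult_distrib power_mult[symmetric] flip: power_mult_distrib[of 2 3])
    finally show ?thesis
      by (subst (asm) power_mono_iff) (use q in \<open>auto simp: sq_norm_nonneg\<close>)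
  qed
  finally show ?thesis .
qed

section \<open>The sieve weights\<close>

text \<open>Double counting of the pairs \<open>p dvd m\<close> with \<open>m \<le> n\<close>,
  weighted by \<open>ln p\<close>. Each \<open>m\<close> contributes the logarithm of its radical,
  at most \<open>ln n\<close>; each \<open>p\<close> has \<open>n div p \<ge> n / (2 * p)\<close>
  multiples, which is where the factor 2 comes from.\<close>

lemma sum_ln_prime_le:
  assumes n: "1 \<le> n"
  shows "(\<Sum>p | prime p \<and> p \<le> n. ln (real p) / real p) \<le> 2 * ln (real n)"
proof -
  let ?P = "{p. prime p \<and> p \<le> n}"
  have finP: "finite ?P" by (rule finite_subset[of _ "{..n}"]) auto
  have "real n / 2 * (\<Sum>p\<in>?P. ln (real p) / real p) = (\<Sum>p\<in>?P. (real n / (2 * real p)) * ln (real p))"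
    by (simp add: sum_distrib_left)
  also have "\<dots> \<le> (\<Sum>p\<in>?P. real (card {m\<in>{1..n}. p dvd m}) * ln (real p))"
  proof (intro sum_mono mult_right_mono)
    fix p assume p: "p \<in> ?P"
    then have p0: "0 < p" "p \<le> n" by (auto simp: prime_gt_0_nat)
    have "(\<lambda>i. p * i) ` {1..n div p} \<subseteq> {m\<in>{1..n}. p dvd m}"
    proof safe
      fix i assume i: "i \<in> {1..n div p}"
      then show "p * i \<in> {1..n}"
        using p0 by (auto simp: less_eq_div_iff_mult_less_eq mult.commute)
    qed auto
    then have "card ((\<lambda>i. p * i) ` {1..n div p}) \<le> card {m\<in>{1..n}. p dvd m}"
      by (intro card_mono) auto
    also have "card ((\<lambda>i. p * i) ` {1..n div p}) = n div p"
      using p0 by (subst card_image) (auto simp: inj_on_def)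
    finally have c: "n div p \<le> card {m\<in>{1..n}. p dvd m}" .
    have "n div p \<ge> 1" using p0 by (simp add: less_eq_div_iff_mult_less_eq)
    have "n = p * (n div p) + n mod p" by simp
    also have "\<dots> \<le> p * (n div p) + p * (n div p)"
      using p0 \<open>n div p \<ge> 1\<close> by (intro add_left_mono) (metis le_trans less_imp_le mod_less_divisor mult_le_mono2 nat_mult_1_right)
    finally have "n \<le> 2 * p * (n div p)" by simp
    then have "real n \<le> 2 * real p * real (n div p)" by (metis of_nat_le_iff of_nat_mult of_nat_numeral)
    then have "real n / (2 * real p) \<le> real (n div p)" using p0 by (simp add: field_simps)
    then show "real n / (2 * real p) \<le> real (card {m\<in>{1..n}. p dvd m})" using c by linarith
    show "0 \<le> ln (real p)" using p0 by simp
  qed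
  also have "\<dots> = (\<Sum>p\<in>?P. \<Sum>m\<in>{1..n}. if p dvd m then ln (real p) else 0)"
    by (intro sum.cong refl) (simp add: sum.If_cases Int_def)
  also have "\<dots> = (\<Sum>m\<in>{1..n}. \<Sum>p\<in>?P. if p dvd m then ln (real p) else 0)" by (rule sum.swap)
  also have "\<dots> \<le> (\<Sum>m\<in>{1..n}. ln (real n))"
  proof (intro sum_mono)
    fix m assume m: "m \<in> {1..n}"
    have "(\<Sum>p\<in>?P. if p dvd m then ln (real p) else 0) = (\<Sum>p\<in>{p\<in>?P. p dvd m}. ln (real p))"
      by (rule sum.inter_filter[OF finP, symmetric])
    also have "\<dots> = (\<Sum>p\<in>prime_factors m. ln (real p))"
      using m by (intro sum.cong refl) (auto simp: in_prime_factors_iff intro: order.trans[OF dvd_imp_le])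
    also have "\<dots> = ln (real (\<Prod>p\<in>prime_factors m. p))"
      unfolding of_nat_prod by (rule ln_prod[symmetric]) (auto simp: prime_gt_0_nat in_prime_factors_iff)
    also have "\<dots> \<le> ln (real n)"
    proof -
      have "(\<Prod>p\<in>prime_factors m. p) \<le> (\<Prod>p\<in>prime_factors m. p ^ multiplicity p m)"
        using m by (intro prod_mono) (auto simp: in_prime_factors_iff prime_gt_0_nat Suc_le_eq intro!: self_le_power prime_multiplicity_gt_zero_iff[THEN iffD2])
      also have "\<dots> = m" using m prime_factorization_nat[of m] by simp
      finally have "(\<Prod>p\<in>prime_factors m. p) \<le> n" using m by simp
      moreover have "0 < (\<Prod>p\<in>prime_factors m. p)" by (intro prod_pos) (auto simp: in_prime_factors_iff prime_gt_0_nat)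
      ultimately show ?thesis by (simp only: ln_le_cancel_iff of_nat_le_iff of_nat_0_less_iff)
    qed
    finally show "(\<Sum>p\<in>?P. if p dvd m then ln (real p) else 0) \<le> ln (real n)" .
  qed
  also have "\<dots> = real n / 2 * (2 * ln (real n))" by simp
  finally show ?thesis using n by (subst (asm) mult_le_cancel_left_pos) auto
qed

lemma harm_le_ln: "1 \<le> n \<Longrightarrow> (\<Sum>d\<in>{1..n}. 1 / real d) \<le> 1 + ln (real n)"
proof (induction n rule: nat_induct_at_least)
  case (Suc n)
  have "ln (real n / real (Suc n)) \<le> real n / real (Suc n) - 1" using Suc by (intro ln_le_minus_one) auto
  also have "\<dots> = - (1 / real (Suc n))" by (simp add: field_simps)
  finally have "1 / real (Suc n) \<le> ln (real (Suc n)) - ln (real n)" using Suc by (simp add: ln_div)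
  then show ?case using Suc by simp
qed simp

lemma sum_Pow_insert:
  fixes f :: "nat set \<Rightarrow> real"
  assumes "finite P" "p \<notin> P"
  shows "(\<Sum>X\<in>Pow (insert p P). f X) = (\<Sum>X\<in>Pow P. f X) + (\<Sum>X\<in>Pow P. f (insert p X))"
proof -
  have "(\<Sum>X\<in>Pow (insert p P). f X) = (\<Sum>X\<in>Pow P. f X) + (\<Sum>X\<in>insert p ` Pow P. f X)"
    unfolding Pow_insert using assms by (intro sum.union_disjoint) auto
  also have "(\<Sum>X\<in>insert p ` Pow P. f X) = (\<Sum>X\<in>Pow P. f (insert p X))"
    using assms(2) by (subst sum.reindex) (auto simp: inj_on_def)
  finally show ?thesis .
qed

text \<open>\<open>ln (\<Prod>X)\<close> splits over the members of \<open>X\<close>, and removing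
  one of them leaves another subset product. The induction drops a nonnegative term that accounts
  for the removed element being absent from the rest.\<close>

lemma sum_Pow_prod_inverse:
  assumes P: "finite P" "\<And>p. p \<in> P \<Longrightarrow> 0 < p"
  shows "(\<Sum>X\<in>Pow P. ln (real (\<Prod>X)) / real (\<Prod>X)) \<le> (\<Sum>p\<in>P. ln (real p) / real p) * (\<Sum>X\<in>Pow P. 1 / real (\<Prod>X))"
  using P
proof (induction P)
  case (insert p P)
  define L where "L = (\<Sum>X\<in>Pow P. ln (real (\<Prod>X)) / real (\<Prod>X))"
  define W where "W = (\<Sum>X\<in>Pow P. 1 / real (\<Prod>X))"
  define S where "S = (\<Sum>p\<in>P. ln (real p) / real p)"
  have IH: "L \<le> S * W" using insert unfolding L_def W_def S_def by auto
  have p: "1 \<le> p" using insert.prems by (simp add: Suc_leI)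
  have W0: "0 \<le> W" unfolding W_def by (rule sum_nonneg) (simp del: of_nat_prod)
  have ins: "\<Prod>(insert p X) = p * \<Prod>X" "0 < \<Prod>X" if "X \<in> Pow P" for X
  proof -
    have X: "finite X" "p \<notin> X" using that insert.hyps by (auto intro: finite_subset)
    show "\<Prod>(insert p X) = p * \<Prod>X" using X by simp
    show "0 < \<Prod>X" using that insert.prems by (intro prod_pos) auto
  qed
  have "(\<Sum>X\<in>Pow P. ln (real (\<Prod>(insert p X))) / real (\<Prod>(insert p X)))
      = (\<Sum>X\<in>Pow P. (1 / real p) * (ln (real (\<Prod>X)) / real (\<Prod>X)) + (ln (real p) / real p) * (1 / real (\<Prod>X)))"
    using p by (intro sum.cong[OF refl]) (simp add: ins ln_mult add_divide_distrib del: of_nat_prod)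
  then have L': "(\<Sum>X\<in>Pow (insert p P). ln (real (\<Prod>X)) / real (\<Prod>X)) = L + (1 / real p * L + ln (real p) / real p * W)"
    unfolding L_def W_def sum_Pow_insert[OF insert.hyps] by (simp only: sum.distrib sum_distrib_left)
  have "(\<Sum>X\<in>Pow P. 1 / real (\<Prod>(insert p X))) = (\<Sum>X\<in>Pow P. 1 / real p * (1 / real (\<Prod>X)))"
    by (intro sum.cong[OF refl]) (simp add: ins del: of_nat_prod)
  then have W': "(\<Sum>X\<in>Pow (insert p P). 1 / real (\<Prod>X)) = W + 1 / real p * W"
    unfolding W_def sum_Pow_insert[OF insert.hyps] by (simp only: sum_distrib_left)
  have "L + (1 / real p * L + ln (real p) / real p * W) \<le> S * W + (1 / real p * (S * W) + ln (real p) / real p * W)"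
    using IH p by (intro add_mono mult_left_mono) auto
  also have "\<dots> \<le> (ln (real p) / real p + S) * (W + 1 / real p * W)"
  proof -
    have "0 \<le> ln (real p) / real p * (1 / real p * W)" using p W0 by simp
    then show ?thesis by (simp only: algebra_simps)
  qed
  finally show ?case unfolding L' W' using insert.hyps by (simp add: S_def)
qed auto

lemma prime_prod_inj:
  assumes "finite P" "\<And>p. p \<in> P \<Longrightarrow> prime (p::nat)"
  shows "inj_on (\<lambda>X. \<Prod>X) (Pow P)"
proof (rule inj_on_inverseI[where g = prime_factors])
  fix X assume X: "X \<in> Pow P"
  have fX: "finite X" using X assms(1) finite_subset by auto
  show "prime_factors (\<Prod>X) = X"
  proof safe
    fix p assume "p \<in> prime_factors (\<Prod>X)"
    then have p: "prime p" "p dvd \<Prod>X" by (auto simp: in_prime_factors_iff)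
    then obtain q where "q \<in> X" "p dvd q" using fX by (auto simp: prime_dvd_prod_iff)
    then show "p \<in> X" using X assms(2) p by (metis PowD primes_dvd_imp_eq subsetD)
  next
    fix p assume p: "p \<in> X"
    then have "prime p" "p dvd \<Prod>X" using X assms fX by (auto intro: dvd_prodI[where f = id, simplified])
    moreover have "\<Prod>X \<noteq> 0" using fX X assms(2)[of 0] by (auto simp: prod_zero_iff)
    ultimately show "p \<in> prime_factors (\<Prod>X)" by (auto simp: in_prime_factors_iff)
  qed
qed

text \<open>With respect to the weights \<open>1 / d\<close>, the mean of \<open>ln d\<close> is at
  most \<open>2 * ln y\<close> by the two preceding estimates. By Markov's inequality the products
  \<open>d > y ^ 4\<close> carry at most half of the total weight, and the others are covered by a
  harmonic sum up to \<open>y ^ 4\<close>.\<close>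

lemma sieve_weight:
  assumes y: "2 \<le> y"
  shows "(\<Sum>X\<in>Pow {p. prime p \<and> odd p \<and> p < y}. 1 / real (\<Prod>X)) \<le> 2 + 8 * ln (real y)"
proof -
  let ?P = "{p. prime p \<and> odd p \<and> p < y}"
  let ?D = "\<Sum>X\<in>Pow ?P. 1 / real (\<Prod>X)"
  have P: "finite ?P" "\<And>p. p \<in> ?P \<Longrightarrow> prime p" by (auto intro: finite_subset[of _ "{..y}"])
  have pos: "1 \<le> \<Prod>X" if "X \<in> Pow ?P" for X
    using that by (intro prod_ge_1) (auto simp: Suc_le_eq prime_gt_0_nat)
  have ly: "0 < ln (real y)" using y by simp
  have D0: "0 \<le> ?D" by (rule sum_nonneg) (simp del: of_nat_prod)
  have "(\<Sum>X\<in>Pow ?P. ln (real (\<Prod>X)) / real (\<Prod>X)) \<le> (\<Sum>p\<in>?P. ln (real p) / real p) * ?D"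
    by (rule sum_Pow_prod_inverse[OF P(1)]) (simp add: prime_gt_0_nat)
  also have "(\<Sum>p\<in>?P. ln (real p) / real p) \<le> (\<Sum>p | prime p \<and> p \<le> y. ln (real p) / real p)"
    by (intro sum_mono2) (auto intro: finite_subset[of _ "{..y}"] simp: prime_gt_0_nat Suc_le_eq)
  also have "\<dots> \<le> 2 * ln (real y)" using y by (intro sum_ln_prime_le) auto
  finally have log: "(\<Sum>X\<in>Pow ?P. ln (real (\<Prod>X)) / real (\<Prod>X)) \<le> 2 * ln (real y) * ?D"
    using D0 by (meson mult_right_mono order_trans)
  have "?D \<le> (\<Sum>X\<in>Pow ?P. (if \<Prod>X \<le> y^4 then 1 / real (\<Prod>X) else 0) + (ln (real (\<Prod>X)) / real (\<Prod>X)) / (4 * ln (real y)))"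
  proof (intro sum_mono)
    fix X assume X: "X \<in> Pow ?P"
    define d where "d = \<Prod>X"
    have d: "1 \<le> d" using pos[OF X] by (simp only: d_def)
    have "1 / real d \<le> (if d \<le> y^4 then 1 / real d else 0) + (ln (real d) / real d) / (4 * ln (real y))"
    proof (cases "d \<le> y^4")
      case False
      have "4 * ln (real y) = ln (real (y^4))" using y by (simp add: ln_realpow)
      also have "\<dots> \<le> ln (real d)"
        using False y d by (subst ln_le_cancel_iff) (auto simp del: of_nat_power)
      finally have "1 / real d * (4 * ln (real y)) \<le> 1 / real d * ln (real d)"
        by (intro mult_left_mono) auto
      then show ?thesis using ly False d by (simp add: field_simps)
    qed (use ly d in auto)
    then show "1 / real (\<Prod>X) \<le> (if \<Prod>X \<le> y^4 then 1 / real (\<Prod>X) else 0) + (ln (real (\<Prod>X)) / real (\<Prod>X)) / (4 * ln (real y))"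
      by (simp only: d_def)
  qed
  also have "\<dots> = (\<Sum>X\<in>Pow ?P. (if \<Prod>X \<le> y^4 then 1 / real (\<Prod>X) else 0))
      + (\<Sum>X\<in>Pow ?P. ln (real (\<Prod>X)) / real (\<Prod>X)) / (4 * ln (real y))"
    by (simp only: sum.distrib sum_divide_distrib)
  also have "\<dots> \<le> (\<Sum>X\<in>Pow ?P. (if \<Prod>X \<le> y^4 then 1 / real (\<Prod>X) else 0)) + 2 * ln (real y) * ?D / (4 * ln (real y))"
    using log ly by (intro add_left_mono divide_right_mono) auto
  also have "2 * ln (real y) * ?D / (4 * ln (real y)) = ?D / 2" using ly by simp
  finally have "?D / 2 \<le> (\<Sum>X\<in>Pow ?P. (if \<Prod>X \<le> y^4 then 1 / real (\<Prod>X) else 0))" by linarith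
  also have "\<dots> = (\<Sum>X | X \<in> Pow ?P \<and> \<Prod>X \<le> y^4. 1 / real (\<Prod>X))"
    by (rule sum.inter_filter[symmetric]) (simp add: P(1))
  also have "\<dots> = (\<Sum>d\<in>(\<lambda>X. \<Prod>X) ` {X. X \<in> Pow ?P \<and> \<Prod>X \<le> y^4}. 1 / real d)"
    by (subst sum.reindex) (auto intro: inj_on_subset[OF prime_prod_inj[OF P]])
  also have "\<dots> \<le> (\<Sum>d\<in>{1..y^4}. 1 / real d)"
  proof (intro sum_mono2)
    show "(\<lambda>X. \<Prod>X) ` {X. X \<in> Pow ?P \<and> \<Prod>X \<le> y^4} \<subseteq> {1..y^4}"
    proof (rule image_subsetI)
      fix X assume "X \<in> {X. X \<in> Pow ?P \<and> \<Prod>X \<le> y^4}"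
      then show "\<Prod>X \<in> {1..y^4}" using pos[of X] by simp
    qed
  qed auto
  also have "\<dots> \<le> 1 + ln (real (y^4))" using y by (intro harm_le_ln) auto
  also have "\<dots> = 1 + 4 * ln (real y)" using y by (simp add: ln_realpow)
  finally show ?thesis by linarith
qed

text \<open>The products dividing \<open>r\<close> come from the subsets of the set of those primes
  in \<open>P\<close> that divide \<open>r\<close>, and a nonempty finite set has as many even as
  odd subsets.\<close>

lemma sieve_moebius:
  assumes P: "finite P" "\<And>p. p \<in> P \<Longrightarrow> prime (p::nat)"
  shows "(\<Sum>X | X \<in> Pow P \<and> \<Prod>X dvd r. (-1::real) ^ card X) = (if \<exists>p\<in>P. p dvd r then 0 else 1)"
proof -
  have "{X. X \<in> Pow P \<and> \<Prod>X dvd r} = Pow {p\<in>P. p dvd r}"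
  proof safe
    fix X x assume "X \<subseteq> P" "\<Prod>X dvd r" "x \<in> X"
    then show "x dvd r" using P(1) dvd_prodI[of X x "\<lambda>x. x"] by (auto intro: finite_subset dvd_trans)
  next
    fix X assume X: "X \<subseteq> {p\<in>P. p dvd r}"
    then have "finite X" using P(1) by (auto intro: finite_subset[of X P])
    then show "\<Prod>X dvd r" using X
    proof (induction X)
      case (insert x X)
      have "coprime x (\<Prod>X)"
        using insert.prems insert.hyps P(2) by (intro prod_coprime_right primes_coprime) auto
      then show ?case using insert by (simp add: divides_mult)
    qed auto
  qed auto
  moreover have "(\<Sum>X\<in>Pow Q. (-1::real) ^ card X) = (if Q = {} then 1 else 0)" if "finite Q" for Q :: "nat set"
    using prod_diff_conv_sum[OF that, of "\<lambda>_. 1::real" "\<lambda>_. 1"] card_0_eq[OF that] by (auto simp: power_0_left split: if_splits)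
  ultimately show ?thesis using P(1) by auto
qed

section \<open>Fourier coefficients and trigonometric polynomials\<close>

definition ee :: "int \<Rightarrow> real \<Rightarrow> complex" where
  "ee m x = cis (2 * pi * of_int m * x)"

lemma ee_0 [simp]: "ee 0 x = 1" "ee m 0 = 1"
  by (simp_all add: ee_def)

lemma norm_ee [simp]: "norm (ee m x) = 1"
  by (simp add: ee_def)

lemma ee_add: "ee (m + n) x = ee m x * ee n x"
  by (simp add: ee_def cis_mult algebra_simps)

lemma ee_diff: "ee (m - n) x = ee m x * ee (- n) x"
  using ee_add[of m "- n"] by simp

lemma ee_add_arg: "ee m (x + y) = ee m x * ee m y"
  by (simp add: ee_def cis_mult algebra_simps)

lemma ee_minus_arg: "ee m (- x) = ee (- m) x"
  by (simp add: ee_def)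

lemma ee_diff_arg: "ee m (x - y) = ee m x * ee (- m) y"
  using ee_add_arg[of m x "- y"] by (simp add: ee_minus_arg)

lemma cnj_ee: "cnj (ee m x) = ee (- m) x"
  by (simp add: ee_def cis_cnj)

lemma ee_mult_minus [simp]: "ee m x * ee (- m) x = 1"
  using ee_add[of m "- m" x] by simp

lemma ee_of_int: "ee m (of_int k) = 1"
proof -
  have "2 * pi * of_int m * of_int k = 2 * pi * (of_int (m * k) :: real)" by simp
  then show ?thesis unfolding ee_def by (simp only: cis_multiple_2pi Ints_of_int)
qed

lemma continuous_ee [continuous_intros]: "continuous_on S (ee m)"
  unfolding ee_def by (intro continuous_intros)

lemma has_integral_ee:
  assumes m: "m \<noteq> 0" and ab: "a \<le> b"
  shows "(ee m has_integral (ee m b - ee m a) / (2 * pi * of_int m * \<i>)) {a..b}"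
proof -
  define c where "c = 2 * pi * of_int m * \<i>"
  have c: "c \<noteq> 0" using m by (simp add: c_def)
  have eq: "ee m = (\<lambda>x. exp (c * of_real x))"
    by (rule ext) (simp add: ee_def c_def cis_conv_exp mult_ac)
  have "((\<lambda>x. exp (c * of_real x) / c) has_vector_derivative exp (c * of_real x)) (at x within {a..b})" for x
    using c by (auto intro!: derivative_eq_intros has_vector_derivative_real_field simp: field_simps)
  then have "((\<lambda>x. exp (c * of_real x)) has_integral exp (c * of_real b) / c - exp (c * of_real a) / c) {a..b}"
    using ab by (intro fundamental_theorem_of_calculus) auto
  then show ?thesis unfolding c_def[symmetric] eq by (simp add: diff_divide_distrib)
qed

lemma integral_ee: "integral {0..1} (ee m) = (if m = 0 then 1 else 0)"
proof (cases "m = 0")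
  case False
  then show ?thesis using has_integral_ee[of m 0 1] ee_of_int[of m 1] by (simp add: integral_unique)
next
  case True
  have "ee 0 = (\<lambda>_. 1)" by auto
  then show ?thesis using True by simp
qed

definition fc :: "(real \<Rightarrow> complex) \<Rightarrow> int \<Rightarrow> complex" where
  "fc f m = integral {0..1} (\<lambda>x. f x * ee (- m) x)"

lemma fc_integrable:
  "continuous_on {0..1} f \<Longrightarrow> (\<lambda>x. f x * ee m x) integrable_on {0..1}"
  by (intro integrable_continuous_interval continuous_intros)

lemma fc_add:
  "continuous_on {0..1} f \<Longrightarrow> continuous_on {0..1} g \<Longrightarrow> fc (\<lambda>x. f x + g x) m = fc f m + fc g m"
  unfolding fc_def by (simp add: distrib_right Henstock_Kurzweil_Integration.integral_add fc_integrable)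

lemma fc_cmult: "fc (\<lambda>x. c * f x) m = c * fc f m"
  unfolding fc_def by (simp add: mult.assoc)

lemma fc_diff:
  "continuous_on {0..1} f \<Longrightarrow> continuous_on {0..1} g \<Longrightarrow> fc (\<lambda>x. f x - g x) m = fc f m - fc g m"
  unfolding fc_def by (simp add: left_diff_distrib Henstock_Kurzweil_Integration.integral_diff fc_integrable)

lemma fc_sum:
  "finite I \<Longrightarrow> (\<And>i. i \<in> I \<Longrightarrow> continuous_on {0..1} (f i)) \<Longrightarrow> fc (\<lambda>x. \<Sum>i\<in>I. f i x) m = (\<Sum>i\<in>I. fc (f i) m)"
  unfolding fc_def by (simp add: sum_distrib_right Henstock_Kurzweil_Integration.integral_sum fc_integrable)

lemma fc_ee: "fc (ee m) n = (if m = n then 1 else 0)"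
  unfolding fc_def by (simp add: ee_diff[symmetric] integral_ee)

lemma fc_trig_sum:
  assumes "finite M"
  shows "fc (\<lambda>x. \<Sum>m\<in>M. c m * ee m x) n = (if n \<in> M then c n else 0)"
proof -
  have "fc (\<lambda>x. \<Sum>m\<in>M. c m * ee m x) n = (\<Sum>m\<in>M. fc (\<lambda>x. c m * ee m x) n)"
    using assms by (intro fc_sum) (auto intro!: continuous_intros)
  also have "\<dots> = (\<Sum>m\<in>M. if m = n then c m else 0)"
    by (intro sum.cong refl) (simp add: fc_cmult fc_ee)
  finally show ?thesis using assms by simp
qed

definition trig :: "int \<Rightarrow> int \<Rightarrow> (real \<Rightarrow> complex) \<Rightarrow> bool" where
  "trig a b f \<longleftrightarrow> (\<exists>c. f = (\<lambda>x. \<Sum>m\<in>{a..b}. c m * ee m x))"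

lemma trig_expand:
  assumes "trig a b f"
  shows "f = (\<lambda>x. \<Sum>m\<in>{a..b}. fc f m * ee m x)"
proof -
  obtain c where c: "f = (\<lambda>x. \<Sum>m\<in>{a..b}. c m * ee m x)" using assms unfolding trig_def by blast
  then have "fc f m = c m" if "m \<in> {a..b}" for m using that fc_trig_sum[of "{a..b}" c m] by simp
  then show ?thesis by (subst c) (auto intro!: sum.cong ext)
qed

lemma trig_fc_0:
  assumes "trig a b f" "m \<notin> {a..b}"
  shows "fc f m = 0"
proof -
  obtain c where c: "f = (\<lambda>x. \<Sum>m\<in>{a..b}. c m * ee m x)" using assms unfolding trig_def by blast
  show ?thesis using fc_trig_sum[of "{a..b}" c m] assms(2) by (auto simp: c)
qed

lemma trig_sumI:
  assumes "M \<subseteq> {a..b}"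
  shows "trig a b (\<lambda>x. \<Sum>m\<in>M. c m * ee m x)"
  unfolding trig_def
proof (intro exI ext)
  fix x
  show "(\<Sum>m\<in>M. c m * ee m x) = (\<Sum>m\<in>{a..b}. (if m \<in> M then c m else 0) * ee m x)"
    using assms by (intro sum.mono_neutral_cong_left) auto
qed

lemma trig_mono: "trig a b f \<Longrightarrow> a' \<le> a \<Longrightarrow> b \<le> b' \<Longrightarrow> trig a' b' f"
  by (subst trig_expand, assumption) (rule trig_sumI, auto)

lemma trig_continuous: "trig a b f \<Longrightarrow> continuous_on S f"
  by (subst trig_expand, assumption) (intro continuous_intros)

lemma trig_ee: "a \<le> m \<Longrightarrow> m \<le> b \<Longrightarrow> trig a b (ee m)"
  using trig_sumI[of "{m}" a b "\<lambda>_. 1"] by simp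

lemma trig_const: "a \<le> 0 \<Longrightarrow> 0 \<le> b \<Longrightarrow> trig a b (\<lambda>_. c)"
  using trig_sumI[of "{0}" a b "\<lambda>_. c"] by simp

lemma trig_add:
  assumes "trig a b f" "trig a b g" shows "trig a b (\<lambda>x. f x + g x)"
proof -
  have "(\<lambda>x. f x + g x) = (\<lambda>x. \<Sum>m\<in>{a..b}. (fc f m + fc g m) * ee m x)"
    by (subst trig_expand[OF assms(1)], subst trig_expand[OF assms(2)]) (simp add: sum.distrib distrib_right)
  then show ?thesis unfolding trig_def by (rule exI[of _ "\<lambda>m. fc f m + fc g m"])
qed

lemma trig_cmult:
  assumes "trig a b f" shows "trig a b (\<lambda>x. c * f x)"
proof -
  have "(\<lambda>x. c * f x) = (\<lambda>x. \<Sum>m\<in>{a..b}. (c * fc f m) * ee m x)"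
    by (subst trig_expand[OF assms]) (simp add: sum_distrib_left mult.assoc)
  then show ?thesis unfolding trig_def by (rule exI[of _ "\<lambda>m. c * fc f m"])
qed

lemma trig_diff: "trig a b f \<Longrightarrow> trig a b g \<Longrightarrow> trig a b (\<lambda>x. f x - g x)"
  using trig_add[of a b f "\<lambda>x. -1 * g x"] trig_cmult[of a b g "-1"] by simp

lemma trig_sum: "(\<And>i. i \<in> I \<Longrightarrow> trig a b (f i)) \<Longrightarrow> trig a b (\<lambda>x. \<Sum>i\<in>I. f i x)"
proof (induction I rule: infinite_finite_induct)
  case (insert i I)
  then show ?case using trig_add[of a b "f i" "\<lambda>x. \<Sum>i\<in>I. f i x"] by simp
qed (auto simp: trig_def intro!: exI[of _ "\<lambda>_. 0"])

lemma trig_mult: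
  assumes "trig a b f" "trig c d g" shows "trig (a + c) (b + d) (\<lambda>x. f x * g x)"
proof -
  have "(\<lambda>x. f x * g x) = (\<lambda>x. \<Sum>m\<in>{a..b}. \<Sum>n\<in>{c..d}. (fc f m * fc g n) * ee (m + n) x)"
    by (subst trig_expand[OF assms(1)], subst trig_expand[OF assms(2)])
       (simp add: sum_product ee_add mult_ac)
  moreover have "trig (a + c) (b + d) (\<lambda>x. \<Sum>m\<in>{a..b}. \<Sum>n\<in>{c..d}. (fc f m * fc g n) * ee (m + n) x)"
    by (intro trig_sum trig_cmult trig_ee) auto
  ultimately show ?thesis by simp
qed

lemma trig_cnj:
  assumes "trig a b f" shows "trig (- b) (- a) (\<lambda>x. cnj (f x))"
proof -
  have "(\<lambda>x. cnj (f x)) = (\<lambda>x. \<Sum>m\<in>{a..b}. cnj (fc f m) * ee (- m) x)"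
    by (subst trig_expand[OF assms]) (simp add: cnj_ee)
  moreover have "trig (- b) (- a) (\<lambda>x. \<Sum>m\<in>{a..b}. cnj (fc f m) * ee (- m) x)"
    by (intro trig_sum trig_cmult trig_ee) auto
  ultimately show ?thesis by simp
qed

lemma trig_power:
  assumes "trig (- d) d f" shows "trig (- (int n * d)) (int n * d) (\<lambda>x. f x ^ n)"
proof (induction n)
  case (Suc n)
  then show ?case using trig_mult[OF assms Suc] by (simp add: algebra_simps)
qed (simp add: trig_const)

lemma fc_trig_mult:
  assumes "trig a b f" "continuous_on {0..1} g"
  shows "fc (\<lambda>x. f x * g x) n = (\<Sum>m\<in>{a..b}. fc f m * fc g (n - m))"
proof -
  have "fc (\<lambda>x. f x * g x) n = fc (\<lambda>x. \<Sum>m\<in>{a..b}. fc f m * (ee m x * g x)) n"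
    by (subst trig_expand[OF assms(1)]) (simp add: sum_distrib_right mult.assoc)
  also have "\<dots> = (\<Sum>m\<in>{a..b}. fc (\<lambda>x. fc f m * (ee m x * g x)) n)"
    using assms(2) by (intro fc_sum) (auto intro!: continuous_intros)
  also have "\<dots> = (\<Sum>m\<in>{a..b}. fc f m * fc g (n - m))"
  proof (intro sum.cong refl)
    fix m
    have "fc (\<lambda>x. ee m x * g x) n = fc g (n - m)"
      unfolding fc_def by (simp add: ee_diff mult_ac)
    then show "fc (\<lambda>x. fc f m * (ee m x * g x)) n = fc f m * fc g (n - m)" by (simp add: fc_cmult)
  qed
  finally show ?thesis .
qed

lemma cnj_integral: "integral S (\<lambda>x. cnj (f x)) = cnj (integral S f)"
  by (rule integral_cnj[symmetric])

lemma norm2_complex: "complex_of_real ((norm z)\<^sup>2) = z * cnj z"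
  by (rule complex_norm_square)

lemma integral_complex_of_real:
  "f integrable_on S \<Longrightarrow> integral S (\<lambda>x. complex_of_real (f x)) = complex_of_real (integral S f)"
  by (intro integral_unique has_integral_of_real integrable_integral)

text \<open>The common source of \<open>bessel\<close>, where the left side is nonnegative, and of
  \<open>parseval\<close>, where it vanishes.\<close>

lemma bessel_eq:
  fixes f :: "real \<Rightarrow> complex"
  assumes f: "continuous_on {0..1} f" and M: "finite M"
  shows "integral {0..1} (\<lambda>x. (norm (f x - (\<Sum>m\<in>M. fc f m * ee m x)))\<^sup>2)
    = integral {0..1} (\<lambda>x. (norm (f x))\<^sup>2) - (\<Sum>m\<in>M. (norm (fc f m))\<^sup>2)"
proof -
  let ?p = "\<lambda>x. \<Sum>m\<in>M. fc f m * ee m x"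
  have cp: "continuous_on {0..1} ?p" by (intro continuous_intros)
  have ip: "integral {0..1} (\<lambda>x. g x * cnj (?p x)) = (\<Sum>m\<in>M. cnj (fc f m) * fc g m)"
    if g: "continuous_on {0..1} g" for g
  proof -
    have "integral {0..1} (\<lambda>x. g x * cnj (?p x)) = integral {0..1} (\<lambda>x. \<Sum>m\<in>M. cnj (fc f m) * (g x * ee (- m) x))"
      by (simp add: cnj_ee sum_distrib_left mult_ac)
    also have "\<dots> = (\<Sum>m\<in>M. integral {0..1} (\<lambda>x. cnj (fc f m) * (g x * ee (- m) x)))"
      using g M by (intro Henstock_Kurzweil_Integration.integral_sum integrable_continuous_interval continuous_intros)
    finally show ?thesis by (simp add: fc_def)
  qed
  have "complex_of_real (integral {0..1} (\<lambda>x. (norm (f x - ?p x))\<^sup>2))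
    = integral {0..1} (\<lambda>x. (f x - ?p x) * cnj (f x - ?p x))"
    using f cp by (subst integral_complex_of_real[symmetric])
      (auto intro!: integrable_continuous_interval continuous_intros simp: norm2_complex simp del: of_real_power)
  also have "\<dots> = integral {0..1} (\<lambda>x. f x * cnj (f x) - (f x * cnj (?p x)) - cnj (f x * cnj (?p x)) + ?p x * cnj (?p x))"
    by (simp add: algebra_simps del: cnj_sum)
  also have "\<dots> = integral {0..1} (\<lambda>x. f x * cnj (f x)) - integral {0..1} (\<lambda>x. f x * cnj (?p x))
      - integral {0..1} (\<lambda>x. cnj (f x * cnj (?p x))) + integral {0..1} (\<lambda>x. ?p x * cnj (?p x))"
  proof -
    have "(\<lambda>x. f x * cnj (f x)) integrable_on {0..1}" "(\<lambda>x. f x * cnj (?p x)) integrable_on {0..1}"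
      "(\<lambda>x. cnj (f x * cnj (?p x))) integrable_on {0..1}" "(\<lambda>x. ?p x * cnj (?p x)) integrable_on {0..1}"
      by (intro integrable_continuous_interval continuous_intros f)+
    then show ?thesis
      by (simp only: Henstock_Kurzweil_Integration.integral_add Henstock_Kurzweil_Integration.integral_diff
          Henstock_Kurzweil_Integration.integrable_diff)
  qed
  also have "integral {0..1} (\<lambda>x. cnj (f x * cnj (?p x))) = cnj (\<Sum>m\<in>M. cnj (fc f m) * fc f m)"
    using ip[OF f] cnj_integral[of "{0..1}" "\<lambda>x. f x * cnj (?p x)"] by simp
  also have "integral {0..1} (\<lambda>x. ?p x * cnj (?p x)) = (\<Sum>m\<in>M. cnj (fc f m) * fc f m)"
    unfolding ip[OF cp] using M by (intro sum.cong refl) (simp add: fc_trig_sum)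
  also have "integral {0..1} (\<lambda>x. f x * cnj (?p x)) = (\<Sum>m\<in>M. cnj (fc f m) * fc f m)" by (rule ip[OF f])
  also have "integral {0..1} (\<lambda>x. f x * cnj (f x)) = complex_of_real (integral {0..1} (\<lambda>x. (norm (f x))\<^sup>2))"
    using f by (subst integral_complex_of_real[symmetric])
      (auto intro!: integrable_continuous_interval continuous_intros simp: norm2_complex simp del: of_real_power)
  also have "(\<Sum>m\<in>M. cnj (fc f m) * fc f m) = complex_of_real (\<Sum>m\<in>M. (norm (fc f m))\<^sup>2)"
    by (simp add: norm2_complex mult.commute del: of_real_power)
  finally have "complex_of_real (integral {0..1} (\<lambda>x. (norm (f x - ?p x))\<^sup>2))
    = complex_of_real (integral {0..1} (\<lambda>x. (norm (f x))\<^sup>2) - (\<Sum>m\<in>M. (norm (fc f m))\<^sup>2))"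
    by simp
  then show ?thesis by (simp only: of_real_eq_iff)
qed

lemma bessel:
  assumes f: "continuous_on {0..1} f" and M: "finite M"
  shows "(\<Sum>m\<in>M. (norm (fc f m))\<^sup>2) \<le> integral {0..1} (\<lambda>x. (norm (f x))\<^sup>2)"
proof -
  have "0 \<le> integral {0..1} (\<lambda>x. (norm (f x - (\<Sum>m\<in>M. fc f m * ee m x)))\<^sup>2)"
    by (rule integral_nonneg) (auto intro!: integrable_continuous_interval continuous_intros f)
  then show ?thesis using bessel_eq[OF assms] by simp
qed

lemma parseval:
  assumes "trig a b f"
  shows "integral {0..1} (\<lambda>x. (norm (f x))\<^sup>2) = (\<Sum>m\<in>{a..b}. (norm (fc f m))\<^sup>2)"
proof -
  have "f x - (\<Sum>m\<in>{a..b}. fc f m * ee m x) = 0" for x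
    using fun_cong[OF trig_expand[OF assms], of x] by simp
  then show ?thesis using bessel_eq[OF trig_continuous[OF assms], of "{a..b}"] by simp
qed

section \<open>Band-limited multipliers\<close>

lemma sqrt_polynomial:
  assumes "0 < \<delta>"
  obtains a :: "nat \<Rightarrow> real" and N where "\<And>t. 0 \<le> t \<Longrightarrow> t \<le> 1 \<Longrightarrow> \<bar>sqrt t - (\<Sum>k\<le>N. a k * t ^ k)\<bar> < \<delta>"
proof -
  have "continuous_on {0..1} sqrt" by (intro continuous_intros)
  then obtain g where g: "real_polynomial_function g" "\<And>x. x \<in> {0..1} \<Longrightarrow> \<bar>sqrt x - g x\<bar> < \<delta>"
    using Stone_Weierstrass_real_polynomial_function[of "{0..1::real}" sqrt \<delta>] assms by auto
  then show ?thesis using that by (auto simp: real_polynomial_function_iff_sum)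
qed

text \<open>\<open>|f|\<close> need not be a trigonometric polynomial, but a polynomial in
  \<open>f * cnj f\<close> is one. A uniform approximation of the square root within
  \<open>\<delta>\<close>, raised by \<open>\<delta>\<close>, is a majorant. Its degree
  \<open>d\<close> is not controlled, so the bandwidth has to be restored later by
  smoothing.\<close>

lemma trig_majorant:
  assumes f: "trig a b f" "\<And>x. norm (f x) \<le> 1" and \<delta>: "0 < \<delta>"
  obtains d w where "0 \<le> d" "trig (- d) d (\<lambda>x. complex_of_real (w x))"
    "\<And>x. norm (f x) \<le> w x" "\<And>x. w x \<le> norm (f x) + 2 * \<delta>"
proof -
  obtain c :: "nat \<Rightarrow> real" and N where c: "\<And>t. 0 \<le> t \<Longrightarrow> t \<le> 1 \<Longrightarrow> \<bar>sqrt t - (\<Sum>k\<le>N. c k * t ^ k)\<bar> < \<delta>"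
    using sqrt_polynomial[OF \<delta>] by metis
  define D where "D = \<bar>b - a\<bar>"
  define w where "w x = (\<Sum>k\<le>N. c k * ((norm (f x))\<^sup>2) ^ k) + \<delta>" for x
  have sq: "trig (- D) D (\<lambda>x. f x * cnj (f x))"
    using trig_mult[OF f(1) trig_cnj[OF f(1)]] by (rule trig_mono) (auto simp: D_def)
  have "trig (- (int N * D)) (int N * D) (\<lambda>x. complex_of_real (c k) * (f x * cnj (f x)) ^ k)" if "k \<le> N" for k
  proof (rule trig_cmult, rule trig_mono[OF trig_power[OF sq]])
    have "int k * D \<le> int N * D" using that by (intro mult_right_mono) (auto simp: D_def)
    then show "- (int N * D) \<le> - (int k * D)" "int k * D \<le> int N * D" by auto
  qed
  then have "trig (- (int N * D)) (int N * D) (\<lambda>x. (\<Sum>k\<le>N. complex_of_real (c k) * (f x * cnj (f x)) ^ k) + complex_of_real \<delta>)"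
    by (intro trig_add trig_sum trig_const) (auto simp: D_def)
  then have w: "trig (- (int N * D)) (int N * D) (\<lambda>x. complex_of_real (w x))"
    by (simp add: w_def norm2_complex del: of_real_power complex_mult_cnj)
       (simp add: norm2_complex[symmetric])
  have "\<bar>norm (f x) - (w x - \<delta>)\<bar> < \<delta>" for x
    using c[of "(norm (f x))\<^sup>2"] f(2)[of x] by (simp add: w_def power_le_one)
  then have "norm (f x) \<le> w x" "w x \<le> norm (f x) + 2 * \<delta>" for x by (smt (verit))+
  then show ?thesis using that[of "int N * D" w] w by (auto simp: D_def)
qed

lemma fc_cnj: "fc (\<lambda>x. cnj (f x)) m = cnj (fc f (- m))"
  unfolding fc_def cnj_integral[symmetric] by (simp add: cnj_ee)

lemma sum_symmetric_interval:
  fixes g :: "int \<Rightarrow> 'a :: comm_monoid_add"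
  assumes "0 \<le> d"
  shows "(\<Sum>m\<in>{-d..d}. g m) = g 0 + (\<Sum>m\<in>{-d..-1}. g m + g (- m))"
proof -
  have "{-d..d} = insert 0 ({-d..-1} \<union> uminus ` {-d..-1})"
  proof -
    have "uminus ` {-d..-1} = {1..d}" by simp
    then show ?thesis using assms by auto
  qed
  then have "(\<Sum>m\<in>{-d..d}. g m) = g 0 + (\<Sum>m\<in>{-d..-1} \<union> uminus ` {-d..-1}. g m)"
    by (simp add: sum.insert)
  also have "(\<Sum>m\<in>{-d..-1} \<union> uminus ` {-d..-1}. g m) = (\<Sum>m\<in>{-d..-1}. g m) + (\<Sum>m\<in>uminus ` {-d..-1}. g m)"
    by (intro sum.union_disjoint) auto
  also have "(\<Sum>m\<in>uminus ` {-d..-1}. g m) = (\<Sum>m\<in>{-d..-1}. g (- m))"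
    by (subst sum.reindex) (auto simp: inj_on_def)
  finally show ?thesis by (simp add: sum.distrib)
qed

text \<open>\<open>h\<close> is \<open>w\<close> plus \<open>\<i>\<close> times a conjugate
  function: drop the positive frequencies and double the negative ones. Frequencies at most 0 are
  kept so that multiplication by exponentials of \<open>h\<close> never moves a spectrum upwards.
  The factor 2 is \<open>4 / 2\<close>: coefficients are doubled on one of two symmetric
  halves.\<close>

lemma analytic_completion:
  fixes w :: "real \<Rightarrow> real"
  assumes w: "trig (- d) d (\<lambda>x. complex_of_real (w x))" and d: "0 \<le> d"
  obtains h where "trig (- d) 0 h" "\<And>x. Re (h x) = w x"
    "integral {0..1} (\<lambda>x. (norm (h x))\<^sup>2) \<le> 2 * integral {0..1} (\<lambda>x. (w x)\<^sup>2)"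
proof -
  define W where "W = fc (\<lambda>x. complex_of_real (w x))"
  define c where "c m = (if m = 0 then W 0 else 2 * W m)" for m
  define h where "h = (\<lambda>x. \<Sum>m\<in>{-d..0}. c m * ee m x)"
  have Wneg: "W (- m) = cnj (W m)" for m
    using fc_cnj[of "\<lambda>x. complex_of_real (w x)" "- m"] by (simp add: W_def)
  have W0: "Re (W 0) = Re (W 0)" ..
  have split: "{-d..0} = insert 0 {-d..-1}" using d by auto
  have h: "trig (- d) 0 h" unfolding h_def trig_def by blast
  have "Re (h x) = w x" for x
  proof -
    have "complex_of_real (w x) = (\<Sum>m\<in>{-d..d}. W m * ee m x)"
      using fun_cong[OF trig_expand[OF w], of x] by (simp add: W_def)
    also have "\<dots> = W 0 + (\<Sum>m\<in>{-d..-1}. W m * ee m x + cnj (W m * ee m x))"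
      using sum_symmetric_interval[OF d, of "\<lambda>m. W m * ee m x"] by (simp add: Wneg cnj_ee)
    finally have "w x = Re (W 0 + (\<Sum>m\<in>{-d..-1}. W m * ee m x + cnj (W m * ee m x)))"
      by (metis Re_complex_of_real)
    also have "\<dots> = Re (W 0) + (\<Sum>m\<in>{-d..-1}. 2 * Re (W m * ee m x))" by simp
    also have "\<dots> = Re (h x)"
    proof -
      have "Re (h x) = Re (W 0) + (\<Sum>m\<in>{-d..-1}. Re (c m * ee m x))"
        unfolding h_def split by (simp add: c_def)
      also have "(\<Sum>m\<in>{-d..-1}. Re (c m * ee m x)) = (\<Sum>m\<in>{-d..-1}. 2 * Re (W m * ee m x))"
        by (intro sum.cong refl) (simp add: c_def algebra_simps)
      finally show ?thesis by simp
    qed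
    finally show ?thesis ..
  qed
  moreover have "integral {0..1} (\<lambda>x. (norm (h x))\<^sup>2) \<le> 2 * integral {0..1} (\<lambda>x. (w x)\<^sup>2)"
  proof -
    have "integral {0..1} (\<lambda>x. (norm (h x))\<^sup>2) = (\<Sum>m\<in>{-d..0}. (norm (c m))\<^sup>2)"
      unfolding parseval[OF h] by (intro sum.cong refl) (simp add: h_def fc_trig_sum)
    also have "\<dots> = (norm (W 0))\<^sup>2 + (\<Sum>m\<in>{-d..-1}. 4 * (norm (W m))\<^sup>2)"
      unfolding split by (simp add: c_def norm_mult power_mult_distrib)
    also have "\<dots> \<le> 2 * ((norm (W 0))\<^sup>2 + (\<Sum>m\<in>{-d..-1}. (norm (W m))\<^sup>2 + (norm (W (- m)))\<^sup>2))"
      by (simp add: Wneg sum_distrib_left)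
    also have "(norm (W 0))\<^sup>2 + (\<Sum>m\<in>{-d..-1}. (norm (W m))\<^sup>2 + (norm (W (- m)))\<^sup>2) = (\<Sum>m\<in>{-d..d}. (norm (W m))\<^sup>2)"
      using sum_symmetric_interval[OF d, of "\<lambda>m. (norm (W m))\<^sup>2"] by simp
    also have "\<dots> = integral {0..1} (\<lambda>x. (w x)\<^sup>2)"
      using parseval[OF w] by (simp add: W_def)
    finally show ?thesis .
  qed
  ultimately show ?thesis using that h by blast
qed

text \<open>No power of \<open>h\<close> has a positive frequency, and the exponential series
  converges uniformly on the interval, so the integral may be taken termwise.\<close>

lemma fc_exp_eq_0:
  assumes h: "trig (- d) 0 h" and m: "0 < m"
  shows "fc (\<lambda>x. exp (h x)) m = 0"
proof -
  have ch: "continuous_on {0..1} h" using h by (rule trig_continuous)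
  have pw: "trig (- (int k * d)) 0 (\<lambda>x. h x ^ k)" for k
  proof (induction k)
    case (Suc k)
    then show ?case using trig_mult[OF h Suc] by (simp add: algebra_simps)
  qed (simp add: trig_const)
  have "bounded (h ` {0..1})" using ch by (intro compact_imp_bounded compact_continuous_image) auto
  then obtain B where B: "\<And>x. x \<in> {0..1} \<Longrightarrow> norm (h x) \<le> B" unfolding bounded_iff by blast
  define t where "t k x = h x ^ k /\<^sub>R fact k * ee (- m) x" for k x
  have "uniform_limit {0..1} (\<lambda>n x. \<Sum>k<n. t k x) (\<lambda>x. suminf (\<lambda>k. t k x)) sequentially"
  proof (rule Weierstrass_m_test)
    fix n x assume "x \<in> {0..1::real}"
    then have "norm (h x) ^ n \<le> B ^ n" using B by (intro power_mono) auto
    then show "norm (t n x) \<le> inverse (fact n) * B ^ n"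
      by (simp add: t_def norm_mult norm_power mult_left_mono)
  qed (rule summable_exp)
  moreover have "(\<lambda>x. suminf (\<lambda>k. t k x)) = (\<lambda>x. exp (h x) * ee (- m) x)"
  proof
    fix x
    have "(\<lambda>k. t k x) sums (exp (h x) * ee (- m) x)"
      unfolding t_def by (intro sums_mult2 exp_converges)
    then show "suminf (\<lambda>k. t k x) = exp (h x) * ee (- m) x" by (rule sums_unique[symmetric])
  qed
  ultimately have ul: "uniform_limit {0..1} (\<lambda>n x. \<Sum>k<n. t k x) (\<lambda>x. exp (h x) * ee (- m) x) sequentially"
    by simp
  have ct: "continuous_on {0..1} (\<lambda>x. \<Sum>k<n. t k x)" for n
    unfolding t_def by (intro continuous_intros ch)
  have zero: "integral {0..1} (\<lambda>x. \<Sum>k<n. t k x) = 0" for n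
  proof -
    have "integral {0..1} (\<lambda>x. \<Sum>k<n. t k x) = (\<Sum>k<n. integral {0..1} (t k))"
      unfolding t_def by (intro Henstock_Kurzweil_Integration.integral_sum integrable_continuous_interval continuous_intros ch) auto
    also have "\<dots> = (\<Sum>k<n. inverse (fact k) * fc (\<lambda>x. h x ^ k) m)"
    proof (intro sum.cong refl)
      fix k
      have "t k = (\<lambda>x. inverse (fact k) * (h x ^ k * ee (- m) x))"
        by (auto simp: t_def scaleR_conv_of_real fun_eq_iff)
      then show "integral {0..1} (t k) = inverse (fact k) * fc (\<lambda>x. h x ^ k) m" by (simp add: fc_def)
    qed
    also have "\<dots> = 0" using trig_fc_0[OF pw] m by (intro sum.neutral) simp
    finally show ?thesis .
  qed
  obtain I J where IJ: "\<And>n. ((\<lambda>x. \<Sum>k<n. t k x) has_integral I n) {0..1}"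
    "((\<lambda>x. exp (h x) * ee (- m) x) has_integral J) {0..1}" "(I \<longlongrightarrow> J) sequentially"
    using uniform_limit_integral[OF ul ct trivial_limit_sequentially] by blast
  have "I = (\<lambda>n. 0)" using integral_unique[OF IJ(1)] zero by (auto simp: fun_eq_iff)
  then have "J = 0" using IJ(3) by (simp add: LIMSEQ_const_iff)
  then show ?thesis using IJ(2) by (simp add: fc_def integral_unique)
qed

lemma norm_exp_minus_1_le:
  fixes z :: complex
  assumes "Re z \<le> 0"
  shows "norm (exp z - 1) \<le> norm z"
proof -
  have "norm (exp z - exp 0) \<le> 1 * norm (z - 0)"
  proof (rule field_differentiable_bound[of "{z. Re z \<le> 0}" exp exp])
    show "convex {z. Re z \<le> 0}" by (rule convex_halfspace_Re_le)
  qed (use assms in \<open>auto intro: DERIV_exp DERIV_subset\<close>)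
  then show ?thesis by simp
qed


section \<open>Smoothing by a kernel of Fejer type\<close>

definition dsum :: "nat \<Rightarrow> real \<Rightarrow> complex" where
  "dsum n x = (\<Sum>j<n. ee (int j) x)"

lemma norm_dsum_sq: "complex_of_real ((norm (dsum n x))\<^sup>2) = (\<Sum>j<n. \<Sum>k<n. ee (int j - int k) x)"
  by (simp add: norm2_complex dsum_def sum_product ee_diff cnj_ee del: of_real_power)

lemma continuous_ee_reflect [continuous_intros]: "continuous_on S (\<lambda>t. ee m (x - t))"
  unfolding ee_def by (intro continuous_intros)

lemma continuous_dsum_reflect [continuous_intros]: "continuous_on S (\<lambda>t. dsum n (x - t))"
  unfolding dsum_def by (intro continuous_intros)

lemma integral_ee_conv:
  "integral {0..1} (\<lambda>t. ee m (x - t) * u t) = ee m x * fc u m"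
proof -
  have "(\<lambda>t. ee m (x - t) * u t) = (\<lambda>t. ee m x * (u t * ee (- m) t))"
    by (simp add: ee_diff_arg mult_ac fun_eq_iff)
  then show ?thesis by (simp add: fc_def)
qed

lemma count_diff_le: "card {(j,k). j < n \<and> k < n \<and> int j - int k = m} \<le> n"
proof -
  have "inj_on snd {(j,k). j < n \<and> k < n \<and> int j - int k = m}" by (auto simp: inj_on_def)
  then have "card {(j,k). j < n \<and> k < n \<and> int j - int k = m} = card (snd ` {(j,k). j < n \<and> k < n \<and> int j - int k = m})"
    by (simp add: card_image)
  also have "\<dots> \<le> card {..<n}" by (intro card_mono) auto
  finally show ?thesis by simp
qed

lemma count_diff_0: "card {(j,k). j < n \<and> k < n \<and> int j - int k = 0} = n"
proof -
  have "{(j,k). j < n \<and> k < n \<and> int j - int k = 0} = (\<lambda>j. (j,j)) ` {..<n}" by auto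
  then show ?thesis by (simp add: card_image inj_on_def)
qed

text \<open>A nonnegative kernel of mean one that is, up to the factor \<open>3 / 2\<close>, a majorant of the modulus of a kernel reproducing
  the trigonometric polynomials with frequencies in \<open>[0, L]\<close>.\<close>

definition fker :: "nat \<Rightarrow> real \<Rightarrow> real" where
  "fker L x = ((norm (dsum (2 * L) x))\<^sup>2 + (norm (dsum L x))\<^sup>2) / (3 * real L)"

definition fconv :: "nat \<Rightarrow> (real \<Rightarrow> complex) \<Rightarrow> real \<Rightarrow> complex" where
  "fconv L u x = integral {0..1} (\<lambda>t. complex_of_real (fker L (x - t)) * u t)"

lemma continuous_fker [continuous_intros]: "continuous_on S (\<lambda>t. fker L (x - t))"
  unfolding fker_def divide_inverse by (intro continuous_intros)

lemma fker_nonneg: "0 \<le> fker L x"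
  unfolding fker_def by simp

lemma fconv_expand:
  assumes u: "continuous_on {0..1} u"
  shows "fconv L u x = ((\<Sum>j<2*L. \<Sum>k<2*L. fc u (int j - int k) * ee (int j - int k) x)
    + (\<Sum>j<L. \<Sum>k<L. fc u (int j - int k) * ee (int j - int k) x)) / of_nat (3 * L)"
proof -
  have i: "(\<lambda>t. ee m (x - t) * u t) integrable_on {0..1}" for m
    using u by (intro integrable_continuous_interval continuous_intros)
  have "integral {0..1} (\<lambda>t. (\<Sum>j<n. \<Sum>k<n. ee (int j - int k) (x - t)) * u t)
    = (\<Sum>j<n. \<Sum>k<n. fc u (int j - int k) * ee (int j - int k) x)"
    and ii: "(\<lambda>t. (\<Sum>j<n. \<Sum>k<n. ee (int j - int k) (x - t)) * u t) integrable_on {0..1}" for n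
  proof -
    show "(\<lambda>t. (\<Sum>j<n. \<Sum>k<n. ee (int j - int k) (x - t)) * u t) integrable_on {0..1}"
      unfolding sum_distrib_right by (intro integrable_sum i) auto
    show "integral {0..1} (\<lambda>t. (\<Sum>j<n. \<Sum>k<n. ee (int j - int k) (x - t)) * u t)
    = (\<Sum>j<n. \<Sum>k<n. fc u (int j - int k) * ee (int j - int k) x)"
    proof -
      have "integral {0..1} (\<lambda>t. \<Sum>j<n. \<Sum>k<n. ee (int j - int k) (x - t) * u t)
        = (\<Sum>j<n. \<Sum>k<n. integral {0..1} (\<lambda>t. ee (int j - int k) (x - t) * u t))"
        by (simp add: Henstock_Kurzweil_Integration.integral_sum integrable_sum i)
      also have "\<dots> = (\<Sum>j<n. \<Sum>k<n. fc u (int j - int k) * ee (int j - int k) x)"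
        by (intro sum.cong refl) (subst integral_ee_conv, rule mult.commute)
      finally show ?thesis by (simp only: sum_distrib_right)
    qed
  qed note n = this
  have "fconv L u x = integral {0..1} (\<lambda>t. ((\<Sum>j<2*L. \<Sum>k<2*L. ee (int j - int k) (x - t)) * u t
    + (\<Sum>j<L. \<Sum>k<L. ee (int j - int k) (x - t)) * u t) / of_nat (3 * L))"
    unfolding fconv_def fker_def
    by (simp add: norm_dsum_sq algebra_simps add_divide_distrib del: of_real_power)
  also have "\<dots> = (integral {0..1} (\<lambda>t. (\<Sum>j<2*L. \<Sum>k<2*L. ee (int j - int k) (x - t)) * u t)
    + integral {0..1} (\<lambda>t. (\<Sum>j<L. \<Sum>k<L. ee (int j - int k) (x - t)) * u t)) / of_nat (3 * L)"
    by (simp only: integral_divide Henstock_Kurzweil_Integration.integral_add ii)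
  finally show ?thesis by (simp only: n)
qed

text \<open>Smoothing multiplies each coefficient by a number in \<open>[0, 1]\<close>, which is 1
  at frequency 0. Consequently it does not increase the \<open>L^2\<close> distance from the
  constant 1.\<close>

lemma fc_fconv:
  assumes u: "continuous_on {0..1} u" and L: "1 \<le> L"
  shows "norm (fc (fconv L u) m) \<le> norm (fc u m)" "fc (fconv L u) 0 = fc u 0"
proof -
  define ct where "ct n m = real (card {(j,k). j < n \<and> k < n \<and> int j - int k = m})" for n m
  have dd: "fc (\<lambda>x. \<Sum>j<n. \<Sum>k<n. fc u (int j - int k) * ee (int j - int k) x) m = of_real (ct n m) * fc u m" for n m
  proof -
    have "fc (\<lambda>x. \<Sum>j<n. \<Sum>k<n. fc u (int j - int k) * ee (int j - int k) x) m
      = (\<Sum>j<n. \<Sum>k<n. fc (\<lambda>x. fc u (int j - int k) * ee (int j - int k) x) m)"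
      by (simp add: fc_sum continuous_intros)
    also have "\<dots> = (\<Sum>(j,k)\<in>{..<n}\<times>{..<n}. if int j - int k = m then fc u m else 0)"
      unfolding sum.cartesian_product[symmetric] by (intro sum.cong refl) (auto simp: fc_cmult fc_ee)
    also have "\<dots> = (\<Sum>p\<in>{(j,k). j < n \<and> k < n \<and> int j - int k = m}. fc u m)"
      by (intro sum.mono_neutral_cong_right) (auto split: if_splits)
    finally show ?thesis by (simp add: ct_def)
  qed
  have eq: "fc (fconv L u) m = of_real ((ct (2 * L) m + ct L m) / (3 * real L)) * fc u m" for m
  proof -
    have "fc (fconv L u) m = fc (\<lambda>x. 1 / of_nat (3 * L) * ((\<Sum>j<2*L. \<Sum>k<2*L. fc u (int j - int k) * ee (int j - int k) x)
    + (\<Sum>j<L. \<Sum>k<L. fc u (int j - int k) * ee (int j - int k) x))) m"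
      by (rule arg_cong[of _ _ "\<lambda>f. fc f m"]) (simp add: fun_eq_iff fconv_expand[OF u])
    also have "\<dots> = 1 / of_nat (3 * L) * (of_real (ct (2 * L) m) * fc u m + of_real (ct L m) * fc u m)"
      by (subst fc_cmult, subst fc_add) (auto intro!: continuous_intros simp: dd)
    finally show ?thesis by (simp add: algebra_simps add_divide_distrib)
  qed
  have "0 \<le> ct n m" "ct n m \<le> real n" "ct n 0 = real n" for n m
    using count_diff_le[of n m] count_diff_0[of n] by (auto simp: ct_def simp del: diff_eq_eq)
  note ct = this
  have "norm (fc (fconv L u) m) = (ct (2 * L) m + ct L m) / (3 * real L) * norm (fc u m)"
    unfolding eq norm_mult norm_of_real using ct(1)[of "2 * L" m] ct(1)[of L m] by simp
  also have "\<dots> \<le> 1 * norm (fc u m)"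
    using ct(2)[of "2 * L" m] ct(2)[of L m] L by (intro mult_right_mono) (auto simp: field_simps)
  finally show "norm (fc (fconv L u) m) \<le> norm (fc u m)" by simp
  show "fc (fconv L u) 0 = fc u 0" unfolding eq ct(3) using L by (simp add: field_simps)
qed

lemma trig_fconv:
  assumes u: "continuous_on {0..1} u" and "\<And>m. 0 < m \<Longrightarrow> fc u m = 0"
  shows "trig (- (2 * int L)) 0 (fconv L u)"
proof -
  have t: "trig (- (2 * int L)) 0 (\<lambda>x. fc u (int j - int k) * ee (int j - int k) x)" if "k < 2 * L" for j k
  proof (cases "k < j")
    case True
    then show ?thesis using assms(2)[of "int j - int k"] by (simp add: trig_const)
  next
    case False
    then show ?thesis using that by (intro trig_cmult trig_ee) auto
  qed
  have "trig (- (2 * int L)) 0 (\<lambda>x. 1 / of_nat (3 * L) * ((\<Sum>j<2*L. \<Sum>k<2*L. fc u (int j - int k) * ee (int j - int k) x)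
    + (\<Sum>j<L. \<Sum>k<L. fc u (int j - int k) * ee (int j - int k) x)))"
    by (intro trig_cmult trig_add trig_sum t) auto
  then show ?thesis by (simp add: fconv_expand[OF u, abs_def])
qed

lemma integral_fker: "1 \<le> L \<Longrightarrow> integral {0..1} (\<lambda>t. fker L (x - t)) = 1"
proof -
  assume L: "1 \<le> L"
  have "fc (\<lambda>_. 1) m = (if m = 0 then 1 else 0)" for m
    using fc_ee[of 0 m] by (auto simp: fc_def)
  then have z: "fc (\<lambda>_. 1) m * z = (if m = 0 then z else 0)" for m z by simp
  have s: "(\<Sum>j<n. \<Sum>k<n. fc (\<lambda>_. 1) (int j - int k) * ee (int j - int k) x) = of_nat n" for n
  proof -
    have "(\<Sum>j<n. \<Sum>k<n. fc (\<lambda>_. 1) (int j - int k) * ee (int j - int k) x) = (\<Sum>j<n. \<Sum>k<n. if k = j then 1 else 0)"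
      unfolding z by (intro sum.cong refl) auto
    then show ?thesis by simp
  qed
  have "complex_of_real (integral {0..1} (\<lambda>t. fker L (x - t))) = fconv L (\<lambda>_. 1) x"
    unfolding fconv_def by (subst integral_complex_of_real[symmetric])
      (auto intro!: integrable_continuous_interval continuous_intros)
  also have "\<dots> = 1" unfolding fconv_expand[OF continuous_on_const] s using L by simp
  finally show ?thesis by simp
qed

text \<open>The kernel \<open>D\<close> reproduces \<open>f\<close>: for each \<open>k < L\<close>
  the frequencies \<open>j - k\<close> with \<open>j < 2 * L\<close> cover \<open>[0, L]\<close>, so
  averaging over \<open>k\<close> gives coefficient 1 there. By the inequality of the means its
  modulus is at most \<open>3 / 2\<close> times \<open>fker L\<close>.\<close>

lemma norm_le_fker:
  assumes f: "trig 0 (int L) f" and L: "1 \<le> L"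
  shows "norm (f x) \<le> 3 / 2 * integral {0..1} (\<lambda>t. fker L (x - t) * norm (f t))"
proof -
  have cf: "continuous_on {0..1} f" using f by (rule trig_continuous)
  define D where "D y = dsum (2 * L) y * cnj (dsum L y) / of_nat L" for y
  have cD: "continuous_on {0..1} (\<lambda>t. D (x - t))"
    unfolding D_def divide_inverse by (intro continuous_intros)
  have i: "(\<lambda>t. ee m (x - t) * f t) integrable_on {0..1}" for m
    using cf by (intro integrable_continuous_interval continuous_intros)
  have "integral {0..1} (\<lambda>t. D (x - t) * f t)
    = integral {0..1} (\<lambda>t. (\<Sum>k<L. \<Sum>j<2*L. ee (int j - int k) (x - t) * f t) / of_nat L)"
  proof (rule arg_cong[of _ _ "integral {0..1}"], rule ext)
    fix t
    have "dsum (2 * L) (x - t) * cnj (dsum L (x - t)) = (\<Sum>k<L. \<Sum>j<2*L. ee (int j - int k) (x - t))"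
      unfolding dsum_def cnj_sum sum_product by (subst sum.swap) (simp add: ee_diff cnj_ee)
    then show "D (x - t) * f t = (\<Sum>k<L. \<Sum>j<2*L. ee (int j - int k) (x - t) * f t) / of_nat L"
      by (simp add: D_def sum_distrib_right)
  qed
  also have "\<dots> = (\<Sum>k<L. \<Sum>j<2*L. ee (int j - int k) x * fc f (int j - int k)) / of_nat L"
    by (simp add: Henstock_Kurzweil_Integration.integral_sum integrable_sum i integral_ee_conv)
  also have "(\<Sum>k<L. \<Sum>j<2*L. ee (int j - int k) x * fc f (int j - int k)) = (\<Sum>k<L. f x)"
  proof (intro sum.cong refl)
    fix k assume k: "k \<in> {..<L}"
    have "(\<Sum>j<2*L. ee (int j - int k) x * fc f (int j - int k))
      = (\<Sum>m\<in>(\<lambda>j. int j - int k) ` {..<2*L}. fc f m * ee m x)"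
      by (subst sum.reindex) (auto simp: inj_on_def mult.commute)
    also have "\<dots> = (\<Sum>m\<in>{0..int L}. fc f m * ee m x)"
    proof (rule sum.mono_neutral_right)
      show "{0..int L} \<subseteq> (\<lambda>j. int j - int k) ` {..<2*L}"
      proof
        fix m assume "m \<in> {0..int L}"
        then have "m = int (nat m + k) - int k" "nat m + k < 2 * L" using k by auto
        then show "m \<in> (\<lambda>j. int j - int k) ` {..<2*L}" by blast
      qed
      show "\<forall>i\<in>(\<lambda>j. int j - int k) ` {..<2*L} - {0..int L}. fc f i * ee i x = 0"
        using trig_fc_0[OF f] by auto
    qed simp
    also have "\<dots> = f x" using fun_cong[OF trig_expand[OF f], of x] by simp
    finally show "(\<Sum>j<2*L. ee (int j - int k) x * fc f (int j - int k)) = f x" .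
  qed
  finally have "f x = integral {0..1} (\<lambda>t. D (x - t) * f t)" using L by simp
  then have "norm (f x) = norm (integral {0..1} (\<lambda>t. D (x - t) * f t))" by simp
  also have "\<dots> \<le> integral {0..1} (\<lambda>t. 3 / 2 * (fker L (x - t) * norm (f t)))"
  proof (rule Henstock_Kurzweil_Integration.integral_norm_bound_integral)
    fix t
    define a where "a = norm (dsum (2 * L) (x - t))"
    define b where "b = norm (dsum L (x - t))"
    have "norm (D (x - t)) = a * b / real L" by (simp add: D_def norm_mult norm_divide a_def b_def)
    also have "\<dots> \<le> ((a\<^sup>2 + b\<^sup>2) / 2) / real L"
      using sum_squares_bound[of a b] by (intro divide_right_mono) auto
    also have "\<dots> = 3 / 2 * fker L (x - t)" using L by (simp add: fker_def a_def b_def field_simps)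
    finally have "norm (D (x - t)) * norm (f t) \<le> 3 / 2 * fker L (x - t) * norm (f t)"
      by (rule mult_right_mono) simp
    then show "norm (D (x - t) * f t) \<le> 3 / 2 * (fker L (x - t) * norm (f t))"
      by (simp add: norm_mult)
  qed (intro integrable_continuous_interval continuous_intros cD cf)+
  finally show ?thesis by simp
qed

lemma exp_minus_le:
  fixes r :: real
  assumes "0 \<le> r" "r \<le> 1"
  shows "exp (- r) \<le> 1 - r / 2"
proof -
  have "(1 - r / 2) * (1 + r) = 1 + r * (1 - r) / 2" by (simp add: field_simps)
  also have "\<dots> \<ge> 1" using assms by simp
  finally have "1 \<le> (1 - r / 2) * (1 + r)" .
  also have "\<dots> \<le> (1 - r / 2) * exp r" using assms by (intro mult_left_mono exp_ge_add_one_self) auto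
  finally show ?thesis by (simp add: exp_minus inverse_eq_divide divide_le_eq)
qed

text \<open>Take \<open>E = exp (- \<eta> * h)\<close>, where \<open>Re h = w\<close> majorizes
  \<open>|f|\<close>: then \<open>|E| \<le> 1 - \<eta> / 2 * |f|\<close> and \<open>E\<close> has no
  positive frequencies. Smoothing by \<open>fker L\<close> confines the band to
  \<open>[- 2 * L, 0]\<close>. As the kernel is nonnegative with mean 1 and
  \<open>norm_le_fker\<close> holds, the bound on the modulus survives with
  \<open>\<eta> / 2 * (2 / 3) = \<eta> / 3\<close>.\<close>

lemma band_limited_multiplier:
  assumes f: "trig 0 (int L) f" "\<And>x. norm (f x) \<le> 1" and L: "1 \<le> L"
    and \<eta>: "0 < \<eta>" "\<eta> \<le> 1 / 2" and s: "s = integral {0..1} (\<lambda>x. (norm (f x))\<^sup>2)" "0 < s"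
  obtains g where "trig (- (2 * int L)) 0 g" "\<And>x. norm (g x) \<le> 1 - \<eta> / 3 * norm (f x)"
    "integral {0..1} (\<lambda>x. (norm (g x - 1))\<^sup>2) \<le> 6 * \<eta>\<^sup>2 * s"
proof -
  have cf: "continuous_on S f" for S using f(1) by (rule trig_continuous)
  \<comment> \<open>The error \<open>2 * \<delta>\<close> of the majorant is thus comparable to the
    \<open>L^2\<close> norm of \<open>f\<close>: it adds \<open>2 * (2 * \<delta>) ^ 2 = s\<close>
    to the integral of \<open>w ^ 2\<close>. Also \<open>\<delta> \<le> 1 / 2\<close> gives
    \<open>w \<le> 2\<close> and \<open>\<eta> * w \<le> 1\<close>, as \<open>exp_minus_le\<close>
    requires.\<close>
  define \<delta> where "\<delta> = sqrt (s / 8)"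
  have \<delta>: "0 < \<delta>" "8 * \<delta>\<^sup>2 = s" using s(2) by (auto simp: \<delta>_def)
  have "s \<le> integral {0..1} (\<lambda>x::real. 1::real)"
    unfolding s(1)
  proof (rule Henstock_Kurzweil_Integration.integral_le)
    show "(norm (f x))\<^sup>2 \<le> 1" for x using f(2)[of x] by (simp add: power_le_one)
  qed (intro integrable_continuous_interval continuous_intros cf)+
  then have "s \<le> 1" by simp
  then have "\<delta> \<le> 1 / 2" unfolding \<delta>_def using s(2) by (intro real_le_lsqrt) (auto simp: power2_eq_square)
  obtain d w where d: "0 \<le> d" and w: "trig (- d) d (\<lambda>x. complex_of_real (w x))"
    "\<And>x. norm (f x) \<le> w x" "\<And>x. w x \<le> norm (f x) + 2 * \<delta>"
    by (rule trig_majorant[OF f \<delta>(1)]) blast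
  obtain h where h: "trig (- d) 0 h" "\<And>x. Re (h x) = w x"
    "integral {0..1} (\<lambda>x. (norm (h x))\<^sup>2) \<le> 2 * integral {0..1} (\<lambda>x. (w x)\<^sup>2)"
    by (rule analytic_completion[OF w(1) d]) blast
  have cw: "continuous_on S w" for S
  proof -
    have "continuous_on S (\<lambda>x. Re (complex_of_real (w x)))" by (intro continuous_intros trig_continuous[OF w(1)])
    then show ?thesis by simp
  qed
  have ch: "continuous_on S h" for S using h(1) by (rule trig_continuous)
  define E where "E x = exp (- of_real \<eta> * h x)" for x
  have cE: "continuous_on S E" for S unfolding E_def by (intro continuous_intros ch)
  have E0: "fc E m = 0" if "0 < m" for m
    unfolding E_def by (rule fc_exp_eq_0[OF trig_cmult[OF h(1)] that])
  have w0: "0 \<le> w x" for x using w(2)[of x] norm_ge_zero order_trans by blast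
  have wi: "integral {0..1} (\<lambda>x. (w x)\<^sup>2) \<le> 3 * s"
  proof -
    have "integral {0..1} (\<lambda>x. (w x)\<^sup>2) \<le> integral {0..1} (\<lambda>x. 2 * (norm (f x))\<^sup>2 + s)"
    proof (rule Henstock_Kurzweil_Integration.integral_le)
      fix x
      have "(w x)\<^sup>2 \<le> (norm (f x) + 2 * \<delta>)\<^sup>2" using w0 w(3) by (intro power_mono) auto
      also have "\<dots> \<le> 2 * (norm (f x))\<^sup>2 + 2 * (2 * \<delta>)\<^sup>2"
        using sum_squares_bound[of "norm (f x)" "2 * \<delta>"] by (simp add: power2_sum)
      finally show "(w x)\<^sup>2 \<le> 2 * (norm (f x))\<^sup>2 + s" using \<delta>(2) by (simp add: power_mult_distrib)
    qed (intro integrable_continuous_interval continuous_intros cf cw)+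
    also have "\<dots> = 2 * s + s"
      unfolding s(1) by (subst Henstock_Kurzweil_Integration.integral_add) (auto intro!: integrable_continuous_interval continuous_intros cf)
    finally show ?thesis by simp
  qed
  have E1: "integral {0..1} (\<lambda>x. (norm (E x - 1))\<^sup>2) \<le> 6 * \<eta>\<^sup>2 * s"
  proof -
    have "integral {0..1} (\<lambda>x. (norm (E x - 1))\<^sup>2) \<le> integral {0..1} (\<lambda>x. \<eta>\<^sup>2 * (norm (h x))\<^sup>2)"
    proof (rule Henstock_Kurzweil_Integration.integral_le)
      fix x
      have "norm (E x - 1) \<le> norm (- of_real \<eta> * h x)"
        unfolding E_def using \<eta> w0[of x] h(2) by (intro norm_exp_minus_1_le) simp
      also have "\<dots> = \<eta> * norm (h x)" using \<eta> by (simp add: norm_mult)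
      finally have "(norm (E x - 1))\<^sup>2 \<le> (\<eta> * norm (h x))\<^sup>2" by (intro power_mono) auto
      then show "(norm (E x - 1))\<^sup>2 \<le> \<eta>\<^sup>2 * (norm (h x))\<^sup>2" by (simp add: power_mult_distrib)
    qed (intro integrable_continuous_interval continuous_intros cE ch)+
    also have "\<dots> = \<eta>\<^sup>2 * integral {0..1} (\<lambda>x. (norm (h x))\<^sup>2)" by simp
    also have "\<dots> \<le> \<eta>\<^sup>2 * (2 * (3 * s))" using h(3) wi by (intro mult_left_mono) auto
    finally show ?thesis by simp
  qed
  have Ew: "norm (E x) \<le> 1 - \<eta> / 2 * norm (f x)" for x
  proof -
    have t: "0 \<le> \<eta> * w x" "\<eta> * w x \<le> 1"
      using \<eta> w0[of x] w(3)[of x] f(2)[of x] \<open>\<delta> \<le> 1 / 2\<close> mult_mono[of \<eta> "1/2" "w x" 2] by auto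
    have "norm (E x) = exp (- (\<eta> * w x))" by (simp add: E_def h(2))
    also have "\<dots> \<le> 1 - (\<eta> * w x) / 2" by (rule exp_minus_le[OF t])
    also have "\<dots> \<le> 1 - \<eta> / 2 * norm (f x)" using w(2)[of x] \<eta> by (simp add: mult_left_mono)
    finally show ?thesis .
  qed
  define g where "g = fconv L E"
  have tg: "trig (- (2 * int L)) 0 g" unfolding g_def by (rule trig_fconv[OF cE E0])
  moreover have "norm (g x) \<le> 1 - \<eta> / 3 * norm (f x)" for x
  proof -
    have "norm (g x) \<le> integral {0..1} (\<lambda>t. fker L (x - t) - \<eta> / 2 * (fker L (x - t) * norm (f t)))"
      unfolding g_def fconv_def
    proof (rule Henstock_Kurzweil_Integration.integral_norm_bound_integral)
      fix t
      have "norm (of_real (fker L (x - t)) * E t) \<le> fker L (x - t) * (1 - \<eta> / 2 * norm (f t))"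
        using Ew[of t] fker_nonneg by (simp add: norm_mult mult_left_mono)
      then show "norm (of_real (fker L (x - t)) * E t) \<le> fker L (x - t) - \<eta> / 2 * (fker L (x - t) * norm (f t))"
        by (simp add: algebra_simps)
    qed (intro integrable_continuous_interval continuous_intros cE cf)+
    also have "\<dots> = integral {0..1} (\<lambda>t. fker L (x - t)) - integral {0..1} (\<lambda>t. \<eta> / 2 * (fker L (x - t) * norm (f t)))"
      by (intro Henstock_Kurzweil_Integration.integral_diff integrable_continuous_interval continuous_intros cf)
    also have "\<dots> = 1 - \<eta> / 2 * integral {0..1} (\<lambda>t. fker L (x - t) * norm (f t))"
      by (simp add: integral_fker[OF L])
    also have "\<dots> \<le> 1 - \<eta> / 2 * (2 / 3 * norm (f x))"
      using norm_le_fker[OF f(1) L, of x] \<eta> by (intro diff_left_mono mult_left_mono) auto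
    finally show ?thesis by simp
  qed
  moreover have "integral {0..1} (\<lambda>x. (norm (g x - 1))\<^sup>2) \<le> 6 * \<eta>\<^sup>2 * s"
  proof -
    have cg: "continuous_on S g" for S using tg by (rule trig_continuous)
    have one: "fc (\<lambda>_. 1) m = (if m = 0 then 1 else 0)" for m
      using fc_ee[of 0 m] by (auto simp: fc_def)
    have "integral {0..1} (\<lambda>x. (norm (g x - 1))\<^sup>2) = (\<Sum>m\<in>{-(2 * int L)..0}. (norm (fc (\<lambda>x. g x - 1) m))\<^sup>2)"
      by (rule parseval[OF trig_diff[OF tg trig_const]]) auto
    also have "\<dots> \<le> (\<Sum>m\<in>{-(2 * int L)..0}. (norm (fc (\<lambda>x. E x - 1) m))\<^sup>2)"
    proof (intro sum_mono power_mono)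
      fix m
      show "norm (fc (\<lambda>x. g x - 1) m) \<le> norm (fc (\<lambda>x. E x - 1) m)"
        using fc_fconv(1)[OF cE L, of m] fc_fconv(2)[OF cE L]
        by (cases "m = 0") (auto simp: fc_diff cg cE one g_def[symmetric])
    qed auto
    also have "\<dots> \<le> integral {0..1} (\<lambda>x. (norm (E x - 1))\<^sup>2)"
      by (intro bessel continuous_intros cE) auto
    also note E1
    finally show ?thesis .
  qed
  ultimately show ?thesis using that by blast
qed

section \<open>The test function\<close>

lemma sum_half_powers: "(\<Sum>i\<in>{k..<n}. (1/2::real) ^ i) \<le> 2 * (1/2) ^ k"
proof (induction "n - k" arbitrary: k)
  case (Suc d)
  then have "k < n" by simp
  then have "(\<Sum>i\<in>{k..<n}. (1/2::real) ^ i) = (1/2) ^ k + (\<Sum>i\<in>{Suc k..<n}. (1/2) ^ i)"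
    by (simp add: sum.atLeast_Suc_lessThan)
  also have "\<dots> \<le> (1/2) ^ k + 2 * (1/2) ^ Suc k" using Suc(1)[of "Suc k"] Suc(2) by simp
  finally show ?case by simp
qed simp

text \<open>The constructive proof of the Littlewood conjecture by McGehee, Pigno and Smith, with band-limited
  multipliers in place of the boundary values of \<open>exp (- h)\<close> for an analytic \<open>h\<close>.\<close>

lemma mps_test_function:
  fixes blk :: "nat \<Rightarrow> nat set" and X :: "nat \<Rightarrow> nat"
  assumes J: "1 \<le> J"
    and blk: "\<And>k. k < J \<Longrightarrow> finite (blk k)" "\<And>k. k < J \<Longrightarrow> card (blk k) = 4 ^ k"
    and pos: "\<And>k n. k < J \<Longrightarrow> n \<in> blk k \<Longrightarrow> 0 < n \<and> n \<le> X k"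
    and ord: "\<And>k n. Suc k < J \<Longrightarrow> n \<in> blk (Suc k) \<Longrightarrow> X k < n"
    and \<eta>: "\<eta> = 1 / (128::real)"
  obtains D :: "nat \<Rightarrow> real \<Rightarrow> complex" where
    "\<And>x. norm (\<Sum>i<J. D i x) \<le> 3"
    "\<And>i. i < J \<Longrightarrow> trig (- (2 * (int i + 1) * int (X i))) (int (X i)) (D i)"
    "\<And>i. i < J \<Longrightarrow> integral {0..1} (\<lambda>x. (norm (D i x))\<^sup>2) \<le> 110 * \<eta>\<^sup>2 / 4 ^ i"
    "\<And>k n. k < J \<Longrightarrow> n \<in> blk k \<Longrightarrow> \<eta> / 2 / 4 ^ k \<le> Re (fc (\<lambda>x. \<Sum>i<J. D i x) (int n))"
proof -
  \<comment> \<open>Normalized by the block size: modulus at most 1 and squared \<open>L^2\<close>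
    norm \<open>1 / 4 ^ k\<close>.\<close>
  define f where "f k = (\<lambda>x. \<Sum>m\<in>int ` blk k. (1 / 4 ^ k) * ee m x)" for k
  have ne: "\<exists>n. n \<in> blk k" if "k < J" for k
    using blk(2)[OF that] by (metis all_not_in_conv card.empty power_eq_0_iff zero_neq_numeral)
  have X1: "1 \<le> X k" if "k < J" for k using ne[OF that] pos[OF that] by fastforce
  have Xstep: "X k < X (Suc k)" if "Suc k < J" for k
    using ne[OF that] pos[OF that] ord[OF that] by fastforce
  have Xmono: "X i \<le> X k" if "i \<le> k" "k < J" for i k
    using that
  proof (induction k rule: dec_induct)
    case (step k)
    then show ?case using Xstep[of k] by simp
  qed simp
  have Xlt: "X i < n" if "i < k" "k < J" "n \<in> blk k" for i k n
  proof -
    from \<open>i < k\<close> obtain k' where k': "k = Suc k'" by (cases k) auto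
    then have "X i \<le> X k'" using that by (intro Xmono) auto
    then show ?thesis using ord[of k' n] that k' by simp
  qed
  have tf: "trig 0 (int (X k)) (f k)" if "k < J" for k
    unfolding f_def using pos[OF that] by (intro trig_sumI) auto
  have fcf: "fc (f k) m = (if m \<in> int ` blk k then 1 / 4 ^ k else 0)" if "k < J" for k m
    unfolding f_def using blk(1)[OF that] by (subst fc_trig_sum) auto
  have nf: "norm (f k x) \<le> 1" if "k < J" for k x
  proof -
    have "norm (f k x) \<le> (\<Sum>m\<in>int ` blk k. norm ((1 / 4 ^ k) * ee m x))" unfolding f_def by (rule norm_sum)
    also have "\<dots> = 1" using blk(2)[OF that] by (simp add: norm_mult norm_divide norm_power card_image)
    finally show ?thesis .
  qed
  have sf: "integral {0..1} (\<lambda>x. (norm (f k x))\<^sup>2) = 1 / 4 ^ k" if k: "k < J" for k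
  proof -
    have "integral {0..1} (\<lambda>x. (norm (f k x))\<^sup>2) = (\<Sum>m\<in>{0..int (X k)}. (norm (fc (f k) m))\<^sup>2)"
      by (rule parseval[OF tf[OF k]])
    also have "\<dots> = (\<Sum>m\<in>int ` blk k. (1 / 4 ^ k)\<^sup>2)"
      using pos[OF k] by (intro sum.mono_neutral_cong_right) (auto simp: fcf[OF k] norm_divide norm_power)
    also have "\<dots> = 1 / 4 ^ k" using blk(2)[OF k] by (simp add: card_image power2_eq_square)
    finally show ?thesis .
  qed
  have "\<exists>g. k < J \<longrightarrow> trig (- (2 * int (X k))) 0 g \<and> (\<forall>x. norm (g x) \<le> 1 - \<eta> / 3 * norm (f k x)) \<and>
    integral {0..1} (\<lambda>x. (norm (g x - 1))\<^sup>2) \<le> 6 * \<eta>\<^sup>2 * (1 / 4 ^ k)" for k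
  proof (cases "k < J")
    case True
    have e: "0 < \<eta>" "\<eta> \<le> 1 / 2" "(0::real) < 1 / 4 ^ k" using \<eta> by auto
    obtain g where "trig (- (2 * int (X k))) 0 g" "\<And>x. norm (g x) \<le> 1 - \<eta> / 3 * norm (f k x)"
      "integral {0..1} (\<lambda>x. (norm (g x - 1))\<^sup>2) \<le> 6 * \<eta>\<^sup>2 * (1 / 4 ^ k)"
      by (rule band_limited_multiplier[OF tf[OF True] nf[OF True] X1[OF True] e(1,2) sf[OF True, symmetric] e(3)])
        blast
    then show ?thesis by blast
  qed auto
  then obtain g where g: "\<And>k. k < J \<Longrightarrow> trig (- (2 * int (X k))) 0 (g k)"
    "\<And>k x. k < J \<Longrightarrow> norm (g k x) \<le> 1 - \<eta> / 3 * norm (f k x)"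
    "\<And>k. k < J \<Longrightarrow> integral {0..1} (\<lambda>x. (norm (g k x - 1))\<^sup>2) \<le> 6 * \<eta>\<^sup>2 * (1 / 4 ^ k)"
    by metis
  \<comment> \<open>Multiplication by \<open>g (Suc k)\<close> makes room for the next block, so the
    bound 3 persists: \<open>3 * (1 - \<eta> / 3 * |f|) + \<eta> * |f| = 3\<close>.\<close>
  define F where "F = rec_nat (\<lambda>x. of_real \<eta> * f 0 x) (\<lambda>k Fk x. Fk x * g (Suc k) x + of_real \<eta> * f (Suc k) x)"
  have F0: "F 0 = (\<lambda>x. of_real \<eta> * f 0 x)"
    and FS: "F (Suc k) = (\<lambda>x. F k x * g (Suc k) x + of_real \<eta> * f (Suc k) x)" for k
    by (auto simp: F_def)
  \<comment> \<open>The increments are recorded separately because each has its own band of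
    frequencies and a norm decaying like \<open>1 / 2 ^ i\<close>, on which the later estimate of
    the multiples relies.\<close>
  define D where "D i = (case i of 0 \<Rightarrow> F 0 | Suc k \<Rightarrow> (\<lambda>x. F (Suc k) x - F k x))" for i
  have D0: "D 0 = F 0" and DS: "D (Suc k) = (\<lambda>x. F k x * (g (Suc k) x - 1) + of_real \<eta> * f (Suc k) x)" for k
    by (auto simp: D_def FS algebra_simps)
  have FD: "F k x = (\<Sum>i\<le>k. D i x)" for k x
    by (induction k) (auto simp: D0 DS FS algebra_simps)
  have nF: "norm (F k x) \<le> 3" if "k < J" for k x
    using that
  proof (induction k)
    case 0
    have "norm (F 0 x) = \<eta> * norm (f 0 x)" using \<eta> by (simp add: F0 norm_mult)
    then show ?case using nf[OF 0, of x] \<eta> by simp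
  next
    case (Suc k)
    have "norm (F (Suc k) x) \<le> norm (F k x) * norm (g (Suc k) x) + \<eta> * norm (f (Suc k) x)"
      unfolding FS using \<eta> by (intro norm_triangle_le) (simp add: norm_mult)
    also have "\<dots> \<le> 3 * (1 - \<eta> / 3 * norm (f (Suc k) x)) + \<eta> * norm (f (Suc k) x)"
      using Suc g(2)[OF Suc.prems] by (intro add_right_mono mult_mono) auto
    finally show ?case by (simp add: algebra_simps)
  qed
  have tF: "trig (- (2 * (int k + 1) * int (X k))) (int (X k)) (F k)" if "k < J" for k
    using that
  proof (induction k)
    case 0
    then show ?case unfolding F0 by (intro trig_cmult trig_mono[OF tf]) auto
  next
    case (Suc k)
    have XX: "int (X k) \<le> int (X (Suc k))" using Xstep[OF Suc.prems] by simp
    have "2 * (int k + 1) * int (X k) \<le> 2 * (int k + 1) * int (X (Suc k))"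
      using XX by (intro mult_left_mono) auto
    then have "2 * (int k + 1) * int (X k) + 2 * int (X (Suc k)) \<le> 2 * (int (Suc k) + 1) * int (X (Suc k))"
      by (simp add: algebra_simps)
    then show ?case
      unfolding FS using Suc XX
      by (intro trig_add trig_cmult trig_mono[OF trig_mult[OF Suc.IH g(1)]] trig_mono[OF tf]) auto
  qed
  have tD: "trig (- (2 * (int i + 1) * int (X i))) (int (X i)) (D i)" if i: "i < J" for i
  proof (cases i)
    case 0
    then show ?thesis using tF[OF i] by (simp add: D0)
  next
    case (Suc k)
    have XX: "int (X k) \<le> int (X (Suc k))" using Xstep[of k] i Suc by simp
    have "2 * (int k + 1) * int (X k) \<le> 2 * (int i + 1) * int (X i)"
      using XX Suc by (intro mult_mono) auto
    then show ?thesis using tF[of k] tF[OF i] XX i Suc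
      by (auto simp: D_def intro!: trig_diff intro: trig_mono)
  qed
  have cF: "continuous_on S (F k)" if "k < J" for S k using tF[OF that] by (rule trig_continuous)
  have cD: "continuous_on S (D k)" if "k < J" for S k using tD[OF that] by (rule trig_continuous)
  have cg: "continuous_on S (g k)" if "k < J" for S k using g(1)[OF that] by (rule trig_continuous)
  have cf: "continuous_on S (f k)" if "k < J" for S k using tf[OF that] by (rule trig_continuous)
  have iD: "integral {0..1} (\<lambda>x. (norm (D i x))\<^sup>2) \<le> 110 * \<eta>\<^sup>2 / 4 ^ i" if i: "i < J" for i
  proof (cases i)
    case 0
    have "integral {0..1} (\<lambda>x. (norm (D i x))\<^sup>2) = integral {0..1} (\<lambda>x. \<eta>\<^sup>2 * (norm (f 0 x))\<^sup>2)"
      using \<eta> by (simp add: 0 D0 F0 norm_mult power_mult_distrib)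
    also have "\<dots> = \<eta>\<^sup>2" using sf[of 0] i 0 by simp
    finally show ?thesis using 0 by simp
  next
    case (Suc k)
    have k: "k < J" using i Suc by simp
    \<comment> \<open>Squaring a sum of two terms, with \<open>|F k| \<le> 3\<close>, gives the
      factors \<open>2 * 3 ^ 2 = 18\<close> and 2; with the constant 6 for \<open>g\<close> the
      total is \<open>18 * 6 + 2 = 110\<close>.\<close>
    have "integral {0..1} (\<lambda>x. (norm (D i x))\<^sup>2)
      \<le> integral {0..1} (\<lambda>x. 18 * (norm (g i x - 1))\<^sup>2 + 2 * \<eta>\<^sup>2 * (norm (f i x))\<^sup>2)"
    proof (rule Henstock_Kurzweil_Integration.integral_le)
      fix x
      define a where "a = 3 * norm (g i x - 1)"
      define b where "b = \<eta> * norm (f i x)"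
      have "norm (D i x) \<le> norm (F k x) * norm (g i x - 1) + \<eta> * norm (f i x)"
        unfolding Suc DS using \<eta> by (intro norm_triangle_le) (simp add: norm_mult)
      also have "\<dots> \<le> a + b"
        unfolding a_def b_def using nF[OF k] by (intro add_right_mono mult_right_mono) auto
      finally have "(norm (D i x))\<^sup>2 \<le> (a + b)\<^sup>2" by (intro power_mono) auto
      also have "\<dots> \<le> 2 * a\<^sup>2 + 2 * b\<^sup>2" using sum_squares_bound[of a b] by (simp add: power2_sum)
      finally show "(norm (D i x))\<^sup>2 \<le> 18 * (norm (g i x - 1))\<^sup>2 + 2 * \<eta>\<^sup>2 * (norm (f i x))\<^sup>2"
        by (simp add: a_def b_def power_mult_distrib)
    qed (intro integrable_continuous_interval continuous_intros cD cg cf i)+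
    also have "\<dots> = integral {0..1} (\<lambda>x. 18 * (norm (g i x - 1))\<^sup>2) + integral {0..1} (\<lambda>x. 2 * \<eta>\<^sup>2 * (norm (f i x))\<^sup>2)"
      by (intro Henstock_Kurzweil_Integration.integral_add integrable_continuous_interval continuous_intros cg cf i)
    also have "\<dots> = 18 * integral {0..1} (\<lambda>x. (norm (g i x - 1))\<^sup>2) + 2 * \<eta>\<^sup>2 * (1 / 4 ^ i)"
      using sf[OF i] by simp
    also have "\<dots> \<le> 18 * (6 * \<eta>\<^sup>2 * (1 / 4 ^ i)) + 2 * \<eta>\<^sup>2 * (1 / 4 ^ i)"
      using g(3)[OF i] by simp
    finally show ?thesis by simp
  qed
  \<comment> \<open>The block \<open>k\<close> is hit exactly at its own stage: the previous part,
    even after multiplication by \<open>g k\<close>, has frequencies at most \<open>X k'\<close>,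
    all below \<open>n\<close>.\<close>
  have fcF: "fc (F k) (int n) = of_real \<eta> / 4 ^ k" if k: "k < J" and n: "n \<in> blk k" for k n
  proof (cases k)
    case 0
    then show ?thesis using n fcf[OF k, of "int n"] by (simp add: F0 fc_cmult)
  next
    case (Suc k')
    have k': "k' < J" using k Suc by simp
    have "fc (F k) (int n) = fc (\<lambda>x. F k' x * g k x) (int n) + of_real \<eta> * fc (f k) (int n)"
      unfolding Suc FS by (subst fc_add) (auto intro!: continuous_intros cF cg cf simp: fc_cmult k' k[unfolded Suc])
    also have "fc (\<lambda>x. F k' x * g k x) (int n) = 0"
      by (rule trig_fc_0[OF trig_mult[OF tF[OF k'] g(1)[OF k]]]) (use ord[of k' n] k n Suc in auto)
    finally show ?thesis using fcf[OF k, of "int n"] n by simp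
  qed
  \<comment> \<open>Stage \<open>i\<close> disturbs the coefficient at \<open>n\<close> through
    \<open>F i' * (g i - 1)\<close> alone. As \<open>g i - 1\<close> has no positive frequencies,
    only frequencies \<open>m \<ge> n\<close> of \<open>F i'\<close> matter, and they come from the
    stages \<open>k\<close> and later, collected in \<open>G\<close>. Omitting the earlier stages is
    what supplies the factor \<open>(1/2) ^ k\<close>.\<close>
  have tail: "norm (fc (D i) (int n)) \<le> 52 * \<eta>\<^sup>2 * (1/2) ^ k * (1/2) ^ i"
    if k: "k < i" "i < J" and n: "n \<in> blk k" for i k n
  proof -
    obtain i' where i': "i = Suc i'" using k by (cases i) auto
    have kJ: "k < J" "i' < J" "k \<le> i'" using k i' by auto
    define G where "G x = (\<Sum>l\<in>{k..<i}. D l x)" for x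
    have cG: "continuous_on S G" for S unfolding G_def using k by (intro continuous_intros cD) auto
    have FG: "F i' x = (\<Sum>l<k. D l x) + G x" for x
      unfolding FD G_def i' using kJ(3)
      by (subst sum.union_disjoint[symmetric]) (auto intro!: sum.cong)
    have GF: "fc (F i') m = fc G m" if m: "int n \<le> m" for m
    proof -
      have "fc (F i') m = fc (\<lambda>x. \<Sum>l<k. D l x) m + fc G m"
        unfolding FG[abs_def] using kJ by (intro fc_add continuous_intros cD cG) auto
      also have "fc (\<lambda>x. \<Sum>l<k. D l x) m = (\<Sum>l<k. fc (D l) m)"
        using kJ by (intro fc_sum cD) auto
      also have "\<dots> = 0"
      proof (intro sum.neutral ballI)
        fix l assume l: "l \<in> {..<k}"
        then have "int (X l) < m" using Xlt[of l k n] kJ(1) n m by simp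
        then show "fc (D l) m = 0" using l kJ(1) by (intro trig_fc_0[OF tD]) auto
      qed
      finally show ?thesis by simp
    qed
    have iG: "integral {0..1} (\<lambda>x. (norm (G x))\<^sup>2) \<le> 440 * \<eta>\<^sup>2 * ((1/2) ^ k)\<^sup>2"
    proof -
      have "integral {0..1} (\<lambda>x. (norm (G x))\<^sup>2)
        \<le> integral {0..1} (\<lambda>x. 2 * (1/2) ^ k * (\<Sum>l\<in>{k..<i}. 2 ^ l * (norm (D l x))\<^sup>2))"
      proof (rule Henstock_Kurzweil_Integration.integral_le)
        fix x
        have "norm (G x) \<le> (\<Sum>l\<in>{k..<i}. norm (D l x))" unfolding G_def by (rule norm_sum)
        \<comment> \<open>Geometric weights \<open>2 ^ l\<close> in Cauchy-Schwarz avoid a loss in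
          the number of stages.\<close>
        also have "\<dots> = (\<Sum>l\<in>{k..<i}. sqrt ((1/2) ^ l) * (sqrt (2 ^ l) * norm (D l x)))"
          by (intro sum.cong refl) (simp add: real_sqrt_mult[symmetric] power_mult_distrib[symmetric] mult.assoc[symmetric])
        finally have "(norm (G x))\<^sup>2 \<le> (\<Sum>l\<in>{k..<i}. sqrt ((1/2) ^ l) * (sqrt (2 ^ l) * norm (D l x)))\<^sup>2"
          by (intro power_mono) auto
        also have "\<dots> \<le> (\<Sum>l\<in>{k..<i}. (sqrt ((1/2) ^ l))\<^sup>2) * (\<Sum>l\<in>{k..<i}. (sqrt (2 ^ l) * norm (D l x))\<^sup>2)"
          by (rule Cauchy_Schwarz_ineq_sum)
        also have "\<dots> = (\<Sum>l\<in>{k..<i}. (1/2) ^ l) * (\<Sum>l\<in>{k..<i}. 2 ^ l * (norm (D l x))\<^sup>2)"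
          by (simp add: power_mult_distrib)
        also have "\<dots> \<le> 2 * (1/2) ^ k * (\<Sum>l\<in>{k..<i}. 2 ^ l * (norm (D l x))\<^sup>2)"
          by (intro mult_right_mono sum_half_powers sum_nonneg) auto
        finally show "(norm (G x))\<^sup>2 \<le> 2 * (1/2) ^ k * (\<Sum>l\<in>{k..<i}. 2 ^ l * (norm (D l x))\<^sup>2)" .
      qed (use k in \<open>(intro integrable_continuous_interval continuous_intros cG cD; simp)+\<close>)
      also have "\<dots> = 2 * (1/2) ^ k * (\<Sum>l\<in>{k..<i}. 2 ^ l * integral {0..1} (\<lambda>x. (norm (D l x))\<^sup>2))"
      proof -
        have "(\<lambda>x. 2 ^ l * (norm (D l x))\<^sup>2) integrable_on {0..1}" if "l \<in> {k..<i}" for l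
          using that k by (intro integrable_continuous_interval continuous_intros cD) auto
        then have "integral {0..1} (\<lambda>x. \<Sum>l\<in>{k..<i}. 2 ^ l * (norm (D l x))\<^sup>2)
          = (\<Sum>l\<in>{k..<i}. integral {0..1} (\<lambda>x. 2 ^ l * (norm (D l x))\<^sup>2))"
          by (intro Henstock_Kurzweil_Integration.integral_sum) auto
        then show ?thesis by simp
      qed
      also have "\<dots> \<le> 2 * (1/2) ^ k * (\<Sum>l\<in>{k..<i}. 110 * \<eta>\<^sup>2 * (1/2) ^ l)"
      proof (intro mult_left_mono sum_mono)
        fix l assume l: "l \<in> {k..<i}"
        have "2 ^ l * integral {0..1} (\<lambda>x. (norm (D l x))\<^sup>2) \<le> 2 ^ l * (110 * \<eta>\<^sup>2 / 4 ^ l)"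
          using iD[of l] l k by (intro mult_left_mono) auto
        also have "\<dots> = 110 * \<eta>\<^sup>2 * (1/2) ^ l"
        proof -
          have "(4::real) ^ l = 2 ^ l * 2 ^ l" by (simp flip: power_mult_distrib)
          then show ?thesis by (simp add: power_divide)
        qed
        finally show "2 ^ l * integral {0..1} (\<lambda>x. (norm (D l x))\<^sup>2) \<le> 110 * \<eta>\<^sup>2 * (1/2) ^ l" .
      qed auto
      also have "\<dots> = 220 * \<eta>\<^sup>2 * (1/2) ^ k * (\<Sum>l\<in>{k..<i}. (1/2) ^ l)"
        by (simp add: sum_distrib_left mult_ac)
      also have "\<dots> \<le> 220 * \<eta>\<^sup>2 * (1/2) ^ k * (2 * (1/2) ^ k)" by (intro mult_left_mono sum_half_powers) auto
      finally show ?thesis by (simp add: power2_eq_square)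
    qed
    define M where "M = {int n..int (X i')}"
    have tg1: "trig (- (2 * int (X i))) 0 (\<lambda>x. g i x - 1)"
      using g(1)[OF k(2)] by (intro trig_diff trig_const) auto
    have cg1: "continuous_on S (\<lambda>x. g i x - 1)" for S using tg1 by (rule trig_continuous)
    have "fc (D i) (int n) = fc (\<lambda>x. F i' x * (g i x - 1)) (int n) + of_real \<eta> * fc (f i) (int n)"
      unfolding i' DS using k i' by (subst fc_add) (auto intro!: continuous_intros cF cg cf simp: fc_cmult)
    also have "fc (f i) (int n) = 0"
      using Xlt[of k i n] k n pos[OF kJ(1) n] fcf[OF k(2), of "int n"] by (auto dest: Xlt[of k i])
    also have "fc (\<lambda>x. F i' x * (g i x - 1)) (int n)
      = (\<Sum>m\<in>{- (2 * (int i' + 1) * int (X i'))..int (X i')}. fc (F i') m * fc (\<lambda>x. g i x - 1) (int n - m))"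
      by (rule fc_trig_mult[OF tF[OF kJ(2)] cg1])
    also have "\<dots> = (\<Sum>m\<in>M. fc G m * fc (\<lambda>x. g i x - 1) (int n - m))"
    proof (rule sum.mono_neutral_cong_right)
      show "M \<subseteq> {- (2 * (int i' + 1) * int (X i'))..int (X i')}"
      proof -
        have "- (2 * (int i' + 1) * int (X i')) \<le> 0" by simp
        then have "- (2 * (int i' + 1) * int (X i')) \<le> int n" by linarith
        then show ?thesis unfolding M_def by auto
      qed
    qed (auto simp: M_def GF trig_fc_0[OF tg1])
    finally have eq: "fc (D i) (int n) = (\<Sum>m\<in>M. fc G m * fc (\<lambda>x. g i x - 1) (int n - m))" by simp
    have "norm (fc (D i) (int n)) \<le> (\<Sum>m\<in>M. norm (fc G m) * norm (fc (\<lambda>x. g i x - 1) (int n - m)))"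
      unfolding eq by (rule order_trans[OF norm_sum]) (simp add: norm_mult)
    then have "(norm (fc (D i) (int n)))\<^sup>2 \<le> (\<Sum>m\<in>M. norm (fc G m) * norm (fc (\<lambda>x. g i x - 1) (int n - m)))\<^sup>2"
      by (intro power_mono) auto
    also have "\<dots> \<le> (\<Sum>m\<in>M. (norm (fc G m))\<^sup>2) * (\<Sum>m\<in>M. (norm (fc (\<lambda>x. g i x - 1) (int n - m)))\<^sup>2)"
      by (rule Cauchy_Schwarz_ineq_sum)
    also have "(\<Sum>m\<in>M. (norm (fc (\<lambda>x. g i x - 1) (int n - m)))\<^sup>2)
      = (\<Sum>m\<in>(\<lambda>m. int n - m) ` M. (norm (fc (\<lambda>x. g i x - 1) m))\<^sup>2)"
      by (subst sum.reindex) (auto simp: inj_on_def)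
    also have "(\<Sum>m\<in>M. (norm (fc G m))\<^sup>2) * (\<Sum>m\<in>(\<lambda>m. int n - m) ` M. (norm (fc (\<lambda>x. g i x - 1) m))\<^sup>2)
      \<le> (440 * \<eta>\<^sup>2 * ((1/2) ^ k)\<^sup>2) * (6 * \<eta>\<^sup>2 * (1 / 4 ^ i))"
    proof (intro mult_mono)
      show "(\<Sum>m\<in>M. (norm (fc G m))\<^sup>2) \<le> 440 * \<eta>\<^sup>2 * ((1/2) ^ k)\<^sup>2"
        using bessel[OF cG, of M] iG by (simp add: M_def)
      show "(\<Sum>m\<in>(\<lambda>m. int n - m) ` M. (norm (fc (\<lambda>x. g i x - 1) m))\<^sup>2) \<le> 6 * \<eta>\<^sup>2 * (1 / 4 ^ i)"
        using bessel[OF cg1, of "(\<lambda>m. int n - m) ` M"] g(3)[OF k(2)] by (simp add: M_def)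
    qed (auto intro!: sum_nonneg)
    \<comment> \<open>\<open>440 * 6 = 2640 \<le> 52 ^ 2\<close>.\<close>
    also have "\<dots> \<le> (52 * \<eta>\<^sup>2 * (1/2) ^ k * (1/2) ^ i)\<^sup>2"
    proof -
      have q: "1 / 4 ^ i = (((1/2) ^ i)\<^sup>2 :: real)" by (simp add: power_divide power2_eq_square flip: power_mult_distrib)
      have "0 \<le> \<eta>" using \<eta> by simp
      then show ?thesis unfolding q by (simp add: power_mult_distrib power2_eq_square)
    qed
    finally show ?thesis by (rule power2_le_imp_le) (use \<eta> in simp)
  qed
  have main: "\<eta> / 2 / 4 ^ k \<le> Re (fc (\<lambda>x. \<Sum>i<J. D i x) (int n))" if k: "k < J" and n: "n \<in> blk k" for k n
  proof -
    have split: "(\<Sum>i<J. h i) = (\<Sum>i\<le>k. h i) + (\<Sum>i\<in>{Suc k..<J}. h i)" for h :: "nat \<Rightarrow> complex"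
      using k by (subst sum.union_disjoint[symmetric]) (auto intro!: sum.cong)
    have "fc (\<lambda>x. \<Sum>i<J. D i x) (int n) = (\<Sum>i<J. fc (D i) (int n))" by (intro fc_sum cD) auto
    also have "\<dots> = (\<Sum>i\<le>k. fc (D i) (int n)) + (\<Sum>i\<in>{Suc k..<J}. fc (D i) (int n))" by (rule split)
    also have "(\<Sum>i\<le>k. fc (D i) (int n)) = fc (F k) (int n)"
      unfolding FD[abs_def] using k by (intro fc_sum[symmetric] cD) auto
    also have "\<dots> = of_real (\<eta> / 4 ^ k)" using fcF[OF k n] by simp
    finally have "Re (fc (\<lambda>x. \<Sum>i<J. D i x) (int n)) = \<eta> / 4 ^ k + Re (\<Sum>i\<in>{Suc k..<J}. fc (D i) (int n))"
      by simp
    moreover have "\<bar>Re (\<Sum>i\<in>{Suc k..<J}. fc (D i) (int n))\<bar> \<le> \<eta> / 2 / 4 ^ k"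
    proof -
      have "\<bar>Re (\<Sum>i\<in>{Suc k..<J}. fc (D i) (int n))\<bar> \<le> norm (\<Sum>i\<in>{Suc k..<J}. fc (D i) (int n))"
        by (rule abs_Re_le_cmod)
      also have "\<dots> \<le> (\<Sum>i\<in>{Suc k..<J}. 52 * \<eta>\<^sup>2 * (1/2) ^ k * (1/2) ^ i)"
        using n by (intro sum_norm_le tail) auto
      also have "\<dots> = 52 * \<eta>\<^sup>2 * (1/2) ^ k * (\<Sum>i\<in>{Suc k..<J}. (1/2) ^ i)"
        by (simp add: sum_distrib_left mult_ac)
      also have "\<dots> \<le> 52 * \<eta>\<^sup>2 * (1/2) ^ k * (2 * (1/2) ^ Suc k)" by (intro mult_left_mono sum_half_powers) auto
      also have "\<dots> = 52 * \<eta> * (\<eta> / 4 ^ k)"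
        by (simp add: power_divide power2_eq_square flip: power_mult_distrib)
      \<comment> \<open>This is where \<open>\<eta>\<close> has to be small:
        \<open>52 / 128 \<le> 1 / 2\<close>.\<close>
      also have "\<dots> \<le> 1 / 2 * (\<eta> / 4 ^ k)" using \<eta> by (intro mult_right_mono) auto
      finally show ?thesis by simp
    qed
    ultimately show ?thesis by simp
  qed
  have nFJ: "norm (\<Sum>i<J. D i x) \<le> 3" for x
  proof -
    have "{..<J} = {..J - 1}" using J by auto
    then show ?thesis using nF[of "J - 1" x] FD[of "J - 1" x] J by simp
  qed
  show ?thesis by (rule that[OF nFJ tD iD main])
qed

section \<open>Square waves\<close>

text \<open>The class of integrands from here on: it contains the discontinuous square waves and
  arcs, is closed under the operations that occur, and consists of functions integrable on compact
  intervals.\<close>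

definition bbm :: "(real \<Rightarrow> 'a::euclidean_space) \<Rightarrow> bool" where
  "bbm f \<longleftrightarrow> f \<in> borel_measurable borel \<and> (\<exists>B. \<forall>x. norm (f x) \<le> B)"

named_theorems bbm_intros

lemma bbm_const [bbm_intros]: "bbm (\<lambda>x. c)"
  unfolding bbm_def by auto

lemma bbm_add [bbm_intros]: "bbm f \<Longrightarrow> bbm g \<Longrightarrow> bbm (\<lambda>x. f x + g x)"
  unfolding bbm_def
  by (auto intro!: borel_measurable_add) (meson norm_triangle_le add_mono)

lemma bbm_uminus [bbm_intros]: "bbm f \<Longrightarrow> bbm (\<lambda>x. - f x)"
  unfolding bbm_def by (auto intro!: borel_measurable_uminus)

lemma bbm_diff [bbm_intros]: "bbm f \<Longrightarrow> bbm g \<Longrightarrow> bbm (\<lambda>x. f x - g x)"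
  using bbm_add[OF _ bbm_uminus, of f g] by simp

lemma bbm_mult [bbm_intros]:
  fixes f g :: "real \<Rightarrow> 'a::{euclidean_space, real_normed_algebra}"
  assumes "bbm f" "bbm g"
  shows "bbm (\<lambda>x. f x * g x)"
proof -
  obtain B C where B: "\<And>x. norm (f x) \<le> B" and C: "\<And>x. norm (g x) \<le> C"
    using assms unfolding bbm_def by blast
  have "norm (f x * g x) \<le> B * C" for x
    by (rule order_trans[OF norm_mult_ineq mult_mono[OF B C]]) (auto intro: order_trans[OF norm_ge_zero B])
  then show ?thesis using assms unfolding bbm_def by (auto intro!: borel_measurable_times)
qed

lemma bbm_sum [bbm_intros]:
  assumes "\<And>i. i \<in> I \<Longrightarrow> bbm (f i)"
  shows "bbm (\<lambda>x. \<Sum>i\<in>I. f i x)"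
  using assms by (induction I rule: infinite_finite_induct) (auto intro: bbm_intros)

lemma bbm_norm [bbm_intros]: "bbm f \<Longrightarrow> bbm (\<lambda>x. norm (f x))"
  unfolding bbm_def by auto

lemma bbm_abs [bbm_intros]: "bbm f \<Longrightarrow> bbm (\<lambda>x. \<bar>f x :: real\<bar>)"
  using bbm_norm[of f] by simp

lemma bbm_of_real [bbm_intros]: "bbm f \<Longrightarrow> bbm (\<lambda>x. complex_of_real (f x))"
  unfolding bbm_def by auto

lemma bbm_ee [bbm_intros]: "bbm (ee m)" "bbm (\<lambda>x. ee m x)"
  unfolding bbm_def by (auto intro!: borel_measurable_continuous_onI continuous_ee exI[of _ 1])

lemma bbm_trig: "trig a b f \<Longrightarrow> bbm f"
  by (subst trig_expand, assumption) (intro bbm_intros)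

lemma bbm_comp: "bbm f \<Longrightarrow> g \<in> borel_measurable borel \<Longrightarrow> bbm (\<lambda>x. f (g x))"
  unfolding bbm_def by (auto intro: measurable_compose)

lemma bbm_integrable:
  assumes "bbm f"
  shows "f integrable_on {a..b}"
proof -
  obtain B where B: "\<And>x. norm (f x) \<le> B" and f: "f \<in> borel_measurable borel"
    using assms unfolding bbm_def by blast
  have "f \<in> borel_measurable (lebesgue_on {a..b})"
    using f by (intro measurable_restrict_space1 measurable_completion) simp
  then show ?thesis
    by (rule measurable_bounded_by_integrable_imp_integrable[OF _ _ B]) auto
qed

lemma fc_sum_bbm:
  "finite I \<Longrightarrow> (\<And>i. i \<in> I \<Longrightarrow> bbm (f i)) \<Longrightarrow> fc (\<lambda>x. \<Sum>i\<in>I. f i x) m = (\<Sum>i\<in>I. fc (f i) m)"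
  unfolding fc_def
  by (simp add: sum_distrib_right Henstock_Kurzweil_Integration.integral_sum bbm_integrable bbm_intros)

lemma fc_diff_bbm: "bbm f \<Longrightarrow> bbm g \<Longrightarrow> fc (\<lambda>x. f x - g x) m = fc f m - fc g m"
  unfolding fc_def
  by (simp add: left_diff_distrib Henstock_Kurzweil_Integration.integral_diff bbm_integrable bbm_intros)

lemma periodic_of_int:
  fixes f :: "real \<Rightarrow> 'a"
  assumes "\<And>x. f (x + 1) = f x"
  shows "f (x + of_int k) = f x"
proof (induction k rule: int_induct[of _ 0])
  case (step1 i)
  then show ?case using assms[of "x + of_int i"] by (simp add: add.assoc)
next
  case (step2 i)
  then show ?case using assms[of "x + of_int i - 1"] by (simp add: algebra_simps)
qed simp

lemma integral_periodic_shift: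
  fixes f :: "real \<Rightarrow> 'a::euclidean_space"
  assumes per: "\<And>x. f (x + 1) = f x" and f: "bbm f"
  shows "integral {0..1} (\<lambda>x. f (x + a)) = integral {0..1} f"
proof -
  define b where "b = frac a"
  have b: "0 \<le> b" "b \<le> 1" using frac_lt_1[of a] by (auto simp: b_def less_imp_le)
  have ab: "f (x + a) = f (b + x)" for x
    using periodic_of_int[of f, OF per, of "b + x" "\<lfloor>a\<rfloor>"] by (simp add: b_def frac_def algebra_simps)
  have "integral {0..1} (\<lambda>x. f (x + a)) = integral {0..1} (f \<circ> ((+) b))" by (simp add: ab o_def)
  also have "\<dots> = integral {b..1 + b} f" by (simp add: integral_shift_Icc_real)
  also have "\<dots> = integral {b..1} f + integral {1..1 + b} f"
    using b by (intro Henstock_Kurzweil_Integration.integral_combine[symmetric] bbm_integrable f) auto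
  also have "integral {1..1 + b} f = integral {0..b} (f \<circ> ((+) 1))"
    by (simp add: integral_shift_Icc_real add.commute)
  also have "f \<circ> ((+) 1) = f" using per by (auto simp: add.commute)
  also have "integral {b..1} f + integral {0..b} f = integral {0..1} f"
    using b by (subst add.commute) (intro Henstock_Kurzweil_Integration.integral_combine bbm_integrable f; simp)
  finally show ?thesis .
qed

lemma integral_periodic_dilate:
  fixes f :: "real \<Rightarrow> 'a::euclidean_space"
  assumes per: "\<And>x. f (x + 1) = f x" and f: "bbm f" and n: "0 < (n::nat)"
  shows "integral {0..1} (\<lambda>x. f (real n * x)) = integral {0..1} f"
proof -
  have "integral {0..real k} f = real k *\<^sub>R integral {0..1} f" for k
  proof (induction k)
    case (Suc k)
    have "integral {0..real (Suc k)} f = integral {0..real k} f + integral {real k..real (Suc k)} f"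
      by (intro Henstock_Kurzweil_Integration.integral_combine[symmetric] bbm_integrable f) auto
    also have "integral {real k..real (Suc k)} f = integral {0..1} (f \<circ> ((+) (real k)))"
      by (simp add: integral_shift_Icc_real add.commute)
    also have "f \<circ> ((+) (real k)) = f"
      using periodic_of_int[of f, OF per, of _ "int k"] by (auto simp: add.commute)
    finally show ?case using Suc by (simp add: scaleR_left_distrib)
  qed simp
  then have "(f has_integral (real n *\<^sub>R integral {0..1} f)) {0..real n}"
    using integrable_integral[OF bbm_integrable[OF f, of 0 "real n"]] by simp
  then have "((\<lambda>x. f (real n * x)) has_integral (1 / \<bar>real n\<bar>) *\<^sub>R (real n *\<^sub>R integral {0..1} f)) ((\<lambda>x. x / real n) ` {0..real n})"
    by (rule has_integral_stretch_real) (use n in simp)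
  moreover have "(\<lambda>x. x / real n) ` {0..real n} = {0..1}"
    using n by (auto simp: image_iff field_simps intro!: bexI[where x = "real n * x" for x])
  ultimately show ?thesis using n by (auto intro: integral_unique)
qed

definition sqw :: "real \<Rightarrow> real" where
  "sqw t = (if frac t < 1 / 2 then 1 / 2 else - (1 / 2))"

lemma sqw_periodic: "sqw (t + 1) = sqw t" "sqw (t + of_int k) = sqw t" "sqw (t - 1) = sqw t"
proof -
  show "sqw (t + of_int k) = sqw t" for t k by (simp add: sqw_def frac_def)
  from this[of t 1] this[of t "-1"] show "sqw (t + 1) = sqw t" "sqw (t - 1) = sqw t" by simp_all
qed

lemma sqw_half: "sqw (t + 1 / 2) = - sqw t"
proof -
  have "frac (t + 1 / 2) = (if frac t < 1 / 2 then frac t + 1 / 2 else frac t - 1 / 2)"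
  proof (cases "frac t < 1 / 2")
    case True
    have "t + 1 / 2 - (frac t + 1 / 2) = of_int \<lfloor>t\<rfloor>" by (simp add: frac_def)
    then show ?thesis using True frac_ge_0[of t] by (subst frac_unique_iff) (auto simp del: of_int_floor_cancel)
  next
    case False
    have "t + 1 / 2 - (frac t - 1 / 2) = of_int (\<lfloor>t\<rfloor> + 1)" by (simp add: frac_def)
    then have "t + 1 / 2 - (frac t - 1 / 2) \<in> \<int>" by (metis Ints_of_int)
    then show ?thesis using False frac_lt_1[of t] by (subst frac_unique_iff) auto
  qed
  moreover have "\<not> frac t < 0" using frac_ge_0[of t] by linarith
  ultimately show ?thesis using frac_lt_1[of t] by (auto simp: sqw_def)
qed

lemma sqw_measurable [measurable]: "sqw \<in> borel_measurable borel"
  unfolding sqw_def frac_def by measurable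

lemma bbm_sqw: "g \<in> borel_measurable borel \<Longrightarrow> bbm (\<lambda>x. sqw (g x))"
proof (rule bbm_comp[of sqw])
  have "norm (sqw x) \<le> 1 / 2" for x by (simp add: sqw_def)
  then show "bbm sqw" using sqw_measurable unfolding bbm_def by blast
qed

lemma bbm_sqw_affine [bbm_intros]: "bbm (\<lambda>x. sqw (a * x + b))" "bbm (\<lambda>x. sqw (a * x - b))"
  by (intro bbm_sqw; measurable)+

lemma ee_half: "ee r (1 / 2) = (if even r then 1 else - 1)"
proof (cases "even r")
  case True
  then obtain k where "r = 2 * k" by auto
  then show ?thesis using ee_of_int[of k 1] by (simp add: ee_def mult.assoc)
next
  case False
  then obtain k where r: "r = 2 * k + 1" by (auto elim: oddE)
  have "ee (2 * k) (1 / 2) = 1" using ee_of_int[of k 1] by (simp add: ee_def mult.assoc)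
  moreover have "ee 1 (1 / 2) = - 1" by (simp add: ee_def)
  ultimately show ?thesis using False by (simp add: r ee_add)
qed

lemma fc_sqw: "fc (\<lambda>x. of_real (sqw x)) r = (if even r then 0 else 1 / (pi * of_int r * \<i>))"
proof (cases "r = 0")
  case True
  have "((\<lambda>x. 1 / 2) has_integral (1 / 4 :: complex)) {0..1/2::real}"
    using has_integral_const_real[of "1/2::complex" 0 "1/2::real"] by (simp add: scaleR_conv_of_real)
  then have 1: "((\<lambda>x. of_real (sqw x)) has_integral (1 / 4 :: complex)) {0..1/2::real}"
    by (rule has_integral_spike_finite[of "{1/2}", rotated 2]) (auto simp: sqw_def frac_eq)
  have "((\<lambda>x. - (1 / 2)) has_integral (- (1 / 4) :: complex)) {1/2..1::real}"
    using has_integral_const_real[of "-(1/2)::complex" "1/2::real" 1] by (simp add: scaleR_conv_of_real)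
  then have "((\<lambda>x. of_real (sqw x)) has_integral (- (1 / 4) :: complex)) {1/2..1::real}"
    by (rule has_integral_spike_finite[of "{1}", rotated 2]) (auto simp: sqw_def frac_eq)
  from has_integral_combine[OF _ _ 1 this] show ?thesis
    using True by (simp add: fc_def integral_unique)
next
  case False
  define c where "c = 2 * pi * of_int (- r) * \<i>"
  have c: "c \<noteq> 0" using False by (simp add: c_def)
  have e1: "ee (- r) 1 = 1" using ee_of_int[of "- r" 1] by simp
  have "((\<lambda>x. 1 / 2 * ee (- r) x) has_integral 1 / 2 * ((ee (- r) (1/2) - ee (- r) 0) / c)) {0..1/2}"
    unfolding c_def by (intro has_integral_mult_right has_integral_ee) (use False in auto)
  then have 1: "((\<lambda>x. of_real (sqw x) * ee (- r) x) has_integral 1 / 2 * ((ee (- r) (1/2) - ee (- r) 0) / c)) {0..1/2}"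
    by (rule has_integral_spike_finite[of "{1/2}", rotated 2]) (auto simp: sqw_def frac_eq)
  have "((\<lambda>x. - (1 / 2) * ee (- r) x) has_integral - (1 / 2) * ((ee (- r) 1 - ee (- r) (1/2)) / c)) {1/2..1}"
    unfolding c_def by (intro has_integral_mult_right has_integral_ee) (use False in auto)
  then have "((\<lambda>x. of_real (sqw x) * ee (- r) x) has_integral - (1 / 2) * ((ee (- r) 1 - ee (- r) (1/2)) / c)) {1/2..1}"
    by (rule has_integral_spike_finite[of "{1}", rotated 2]) (auto simp: sqw_def frac_eq)
  from integral_unique[OF has_integral_combine[OF _ _ 1 this]]
  have "fc (\<lambda>x. of_real (sqw x)) r = (ee (- r) (1/2) - 1) / c"
    by (simp add: fc_def e1 field_simps diff_divide_distrib)
  then show ?thesis using c False by (auto simp: ee_half c_def field_simps)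
qed

text \<open>If \<open>n\<close> divides \<open>j\<close>, invariance under dilation and shift
  reduces the claim to \<open>fc_sqw\<close>. Otherwise a shift by \<open>1 / n\<close> multiplies
  the integrand by a root of unity other than 1 but preserves its integral, which is therefore
  0.\<close>

lemma fc_sqw_dilate:
  assumes n: "0 < (n::nat)"
  shows "fc (\<lambda>x. of_real (sqw (real n * x - \<theta>))) j =
    (if int n dvd j \<and> odd (j div int n)
     then ee (- (j div int n)) \<theta> / (pi * of_int (j div int n) * \<i>) else 0)"
proof (cases "int n dvd j")
  case True
  then obtain r where r: "j = int n * r" by auto
  define g where "g w = of_real (sqw (w - \<theta>)) * ee (- r) w" for w
  have gp: "g (w + 1) = g w" for w
    using sqw_periodic(1)[of "w - \<theta>"] ee_of_int[of "- r" 1] by (simp add: g_def ee_add_arg algebra_simps)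
  have bg: "bbm g" using bbm_sqw_affine(2)[of 1 \<theta>] unfolding g_def[abs_def] by (intro bbm_intros) simp
  have "fc (\<lambda>x. of_real (sqw (real n * x - \<theta>))) j = integral {0..1} (\<lambda>x. g (real n * x))"
    by (simp add: fc_def g_def r ee_def mult_ac)
  also have "\<dots> = integral {0..1} g" by (rule integral_periodic_dilate[OF gp bg n])
  also have "\<dots> = integral {0..1} (\<lambda>x. g (x + \<theta>))" by (rule integral_periodic_shift[OF gp bg, symmetric])
  also have "\<dots> = fc (\<lambda>x. ee (- r) \<theta> * of_real (sqw x)) r"
    by (simp add: g_def fc_def ee_add_arg mult_ac)
  also have "\<dots> = ee (- r) \<theta> * (if even r then 0 else 1 / (pi * of_int r * \<i>))"
    by (simp only: fc_cmult fc_sqw)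
  finally show ?thesis using n r by simp
next
  case False
  define f where "f x = of_real (sqw (real n * x - \<theta>)) * ee (- j) x" for x
  have fp: "f (x + 1) = f x" for x
    using sqw_periodic(2)[of "real n * x - \<theta>" "int n"] ee_of_int[of "- j" 1]
    by (simp add: f_def ee_add_arg algebra_simps)
  have bf: "bbm f" unfolding f_def[abs_def] by (intro bbm_intros)
  have s: "f (x + 1 / real n) = ee (- j) (1 / real n) * f x" for x
    using sqw_periodic(1)[of "real n * x - \<theta>"] n by (simp add: f_def ee_add_arg algebra_simps)
  have "integral {0..1} f = integral {0..1} (\<lambda>x. f (x + 1 / real n))"
    by (rule integral_periodic_shift[OF fp bf, symmetric])
  then have "integral {0..1} f = ee (- j) (1 / real n) * integral {0..1} f" by (simp add: s)
  moreover have "ee (- j) (1 / real n) \<noteq> 1"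
  proof
    assume "ee (- j) (1 / real n) = 1"
    then have "cos (2 * pi * of_int (- j) * (1 / real n)) = 1" by (simp add: ee_def complex_eq_iff)
    then obtain k :: int where "2 * pi * of_int (- j) * (1 / real n) = of_int k * 2 * pi"
      unfolding cos_one_2pi_int by blast
    then have "pi * real_of_int (- j) = pi * of_int (k * int n)" using n by (simp add: field_simps)
    then have "real_of_int (- j) = of_int (k * int n)" using pi_neq_zero unfolding mult_cancel_left by blast
    then have "- j = k * int n" by linarith
    then have "j = int n * (- k)" by (simp add: mult.commute)
    then show False using False by (metis dvd_triv_left)
  qed
  ultimately have "integral {0..1} f = 0" by simp
  then show ?thesis using False by (simp add: fc_def f_def[abs_def])
qed

section \<open>A lower bound for the \<open>L\<^sup>1\<close> norm\<close>

text \<open>Consecutive runs of \<open>4 ^ k\<close> elements in increasing order. The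
  \<open>J\<close> runs need \<open>(4 ^ J - 1) / 3\<close> elements, which is the hypothesis on
  \<open>J\<close>; elements of \<open>A\<close> beyond them lie above every
  \<open>X k\<close>.\<close>

lemma blocks:
  fixes A :: "nat set"
  assumes A: "finite A" and J: "4 ^ J \<le> 3 * card A + 1"
  obtains blk :: "nat \<Rightarrow> nat set" and X :: "nat \<Rightarrow> nat" where
    "\<And>k. k < J \<Longrightarrow> finite (blk k)" "\<And>k. k < J \<Longrightarrow> card (blk k) = 4 ^ k"
    "\<And>k n. k < J \<Longrightarrow> n \<in> blk k \<Longrightarrow> n \<in> A \<and> n \<le> X k"
    "\<And>k n. Suc k < J \<Longrightarrow> n \<in> blk (Suc k) \<Longrightarrow> X k < n"
    "\<And>k n. k < J \<Longrightarrow> n \<in> A \<Longrightarrow> n \<le> X k \<Longrightarrow> n \<in> (\<Union>l\<le>k. blk l)"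
    "\<And>k l. k < J \<Longrightarrow> l < J \<Longrightarrow> k \<noteq> l \<Longrightarrow> blk k \<inter> blk l = {}"
    "\<And>k. k < J \<Longrightarrow> X k \<in> A"
proof -
  define xs where "xs = sorted_list_of_set A"
  have xs: "set xs = A" "distinct xs" "sorted xs" "length xs = card A"
    using A by (simp_all add: xs_def)
  have ss: "sorted_wrt (<) xs" using xs strict_sorted_iff by blast
  have lt: "xs ! i < xs ! j" if "i < j" "j < card A" for i j
    using sorted_wrt_nth_less[OF ss that(1)] that(2) xs(4) by simp
  have le: "xs ! i \<le> xs ! j" if "i \<le> j" "j < card A" for i j
    using sorted_nth_mono[OF xs(3) that(1)] that(2) xs(4) by simp
  define s :: "nat \<Rightarrow> nat" where "s k = (\<Sum>l<k. 4 ^ l)" for k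
  have s3: "3 * s k + 1 = 4 ^ k" for k by (induction k) (auto simp: s_def)
  have sS: "s (Suc k) = s k + 4 ^ k" for k by (simp add: s_def)
  have smono: "s i \<le> s j" if "i \<le> j" for i j
    unfolding s_def using that by (intro sum_mono2) auto
  have sJ: "s (Suc k) \<le> card A" if "k < J" for k
  proof -
    have "3 * s J + 1 \<le> 3 * card A + 1" using J s3[of J] by simp
    then show ?thesis using smono[of "Suc k" J] that by simp
  qed
  define blk where "blk k = (\<lambda>i. xs ! i) ` {s k..<s (Suc k)}" for k
  define X where "X k = xs ! (s (Suc k) - 1)" for k
  have s0: "s k < s (Suc k)" for k by (simp add: sS)
  have inj: "inj_on (\<lambda>i. xs ! i) {..<card A}"
    using xs(2,4) by (auto simp: inj_on_def nth_eq_iff_index_eq)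
  show ?thesis
  proof
    fix k assume k: "k < J"
    show "finite (blk k)" by (simp add: blk_def)
    have "inj_on (\<lambda>i. xs ! i) {s k..<s (Suc k)}"
      using sJ[OF k] by (intro inj_on_subset[OF inj]) auto
    then show "card (blk k) = 4 ^ k" by (simp add: blk_def card_image sS)
    show "X k \<in> A" using sJ[OF k] s0[of k] xs(1,4) by (auto simp: X_def intro!: nth_mem)
  next
    fix k n assume k: "k < J" and "n \<in> blk k"
    then obtain i where i: "n = xs ! i" "s k \<le> i" "i < s (Suc k)" by (auto simp: blk_def)
    then show "n \<in> A \<and> n \<le> X k" unfolding X_def i(1)
      using sJ[OF k] xs(1,4) by (auto intro!: le nth_mem)
  next
    fix k n assume k: "Suc k < J" and "n \<in> blk (Suc k)"
    then obtain i where i: "n = xs ! i" "s (Suc k) \<le> i" "i < s (Suc (Suc k))" by (auto simp: blk_def)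
    then show "X k < n" unfolding X_def i(1)
      using sJ[OF k] s0[of k] by (intro lt) auto
  next
    fix k n assume k: "k < J" and n: "n \<in> A" "n \<le> X k"
    from n(1) obtain i where i: "n = xs ! i" "i < card A" using xs(1,4) by (metis in_set_conv_nth)
    have "i < s (Suc k)"
    proof (rule ccontr)
      assume "\<not> i < s (Suc k)"
      then have "X k < n" unfolding X_def i(1) using s0[of k] i(2) by (intro lt) auto
      then show False using n(2) by simp
    qed
    have "\<exists>l\<le>k. s l \<le> i \<and> i < s (Suc l)"
      using \<open>i < s (Suc k)\<close>
    proof (induction k)
      case 0
      then show ?case by (auto simp: s_def)
    next
      case (Suc k)
      show ?case
      proof (cases "i < s (Suc k)")
        case True
        then show ?thesis using Suc.IH by (meson le_SucI)
      next
        case False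
        then show ?thesis using Suc.prems by (intro exI[of _ "Suc k"]) auto
      qed
    qed
    then show "n \<in> (\<Union>l\<le>k. blk l)" unfolding blk_def i(1) by fastforce
  next
    have disj: "blk k \<inter> blk l = {}" if "k < l" "l < J" for k l
    proof -
      have "s (Suc k) \<le> s l" using that by (intro smono) auto
      then have "xs ! i < xs ! j" if "i < s (Suc k)" "s l \<le> j" "j < s (Suc l)" for i j
        using that sJ[OF \<open>l < J\<close>] by (intro lt) auto
      then show ?thesis unfolding blk_def by fastforce
    qed
    fix k l assume "k < J" "l < J" "k \<noteq> l"
    then show "blk k \<inter> blk l = {}" using disj[of k l] disj[of l k] by (cases "k < l") auto
  qed
qed

lemma rough_bound: "rough y n \<Longrightarrow> n \<noteq> 1 \<Longrightarrow> y \<le> n"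
proof -
  assume r: "rough y n" and n: "n \<noteq> 1"
  obtain p where p: "prime p" "p dvd n" using prime_factor_nat[OF n] by blast
  then have "y \<le> p" "p \<le> n" using r by (auto simp: rough_def intro: dvd_imp_le)
  then show ?thesis by simp
qed

lemma integral_times_cnj_trig:
  assumes S: "bbm S" and D: "trig a b D"
  shows "integral {0..1} (\<lambda>x. S x * cnj (D x)) = (\<Sum>j\<in>{a..b}. cnj (fc D j) * fc S j)"
proof -
  have "integral {0..1} (\<lambda>x. S x * cnj (D x)) = integral {0..1} (\<lambda>x. \<Sum>j\<in>{a..b}. cnj (fc D j) * (S x * ee (- j) x))"
    by (subst trig_expand[OF D]) (simp add: sum_distrib_left cnj_ee mult_ac)
  also have "\<dots> = (\<Sum>j\<in>{a..b}. integral {0..1} (\<lambda>x. cnj (fc D j) * (S x * ee (- j) x)))"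
    by (intro Henstock_Kurzweil_Integration.integral_sum bbm_integrable bbm_intros S) auto
  finally show ?thesis by (simp add: fc_def)
qed

text \<open>\<open>S\<close> is paired with the test function, whose modulus is at most 3. The
  quotient 1 yields the main term; the quotient -1 must be absent, since nothing is known about the
  test function at \<open>- n\<close>; all other quotients are at least \<open>q ^ 4\<close> in
  modulus and form the clutter \<open>C\<close>.\<close>

lemma l1_lower_bound:
  fixes A :: "nat set" and S :: "real \<Rightarrow> complex" and \<gamma> :: "int \<Rightarrow> complex"
  assumes A: "finite A" "\<And>n. n \<in> A \<Longrightarrow> 0 < n" and J: "1 \<le> J" "4 ^ J \<le> 3 * card A + 1"
    and q: "2 \<le> q" "card A \<le> 2 ^ q" "84 * pi * K \<le> real q" "2 * J \<le> q ^ 4"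
    and K: "0 \<le> K" and S: "bbm S"
    and \<gamma>: "\<gamma> 1 = - of_real (2 / pi)" "\<gamma> (- 1) = 0" "\<And>r. norm (\<gamma> r) \<le> K / \<bar>of_int r\<bar>"
      "\<And>r. \<gamma> r \<noteq> 0 \<Longrightarrow> rough (q ^ 4) (nat \<bar>r\<bar>)"
    and fcS: "\<And>j. fc S j = (\<Sum>n | n \<in> A \<and> int n dvd j. \<gamma> (j div int n))"
  shows "real J / (768 * pi) \<le> integral {0..1} (\<lambda>x. norm (S x))"
proof -
  define \<eta> :: real where "\<eta> = 1 / 128"
  obtain blk X where blk: "\<And>k. k < J \<Longrightarrow> finite (blk k)" "\<And>k. k < J \<Longrightarrow> card (blk k) = 4 ^ k"
    and blkX: "\<And>k n. k < J \<Longrightarrow> n \<in> blk k \<Longrightarrow> n \<in> A \<and> n \<le> X k"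
    and ord: "\<And>k n. Suc k < J \<Longrightarrow> n \<in> blk (Suc k) \<Longrightarrow> X k < n"
    and init: "\<And>k n. k < J \<Longrightarrow> n \<in> A \<Longrightarrow> n \<le> X k \<Longrightarrow> n \<in> (\<Union>l\<le>k. blk l)"
    and disj: "\<And>k l. k < J \<Longrightarrow> l < J \<Longrightarrow> k \<noteq> l \<Longrightarrow> blk k \<inter> blk l = {}"
    and XA: "\<And>k. k < J \<Longrightarrow> X k \<in> A"
    by (rule blocks[OF A(1) J(2)]) blast
  have pos: "0 < n \<and> n \<le> X k" if "k < J" "n \<in> blk k" for k n using blkX[OF that] A(2) by auto
  obtain D where D: "\<And>x. norm (\<Sum>i<J. D i x) \<le> 3"
    and tD: "\<And>i. i < J \<Longrightarrow> trig (- (2 * (int i + 1) * int (X i))) (int (X i)) (D i)"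
    and iD: "\<And>i. i < J \<Longrightarrow> integral {0..1} (\<lambda>x. (norm (D i x))\<^sup>2) \<le> 110 * \<eta>\<^sup>2 / 4 ^ i"
    and fD: "\<And>k n. k < J \<Longrightarrow> n \<in> blk k \<Longrightarrow> \<eta> / 2 / 4 ^ k \<le> Re (fc (\<lambda>x. \<Sum>i<J. D i x) (int n))"
    by (rule mps_test_function[OF J(1) blk pos ord \<eta>_def]) blast+
  define I where "I i = {- (2 * (int i + 1) * int (X i))..int (X i)}" for i
  define B where "B i = (\<Union>l\<le>i. blk l)" for i
  define main :: "int \<Rightarrow> complex" where "main j = (if j \<in> int ` A then - of_real (2 / pi) else 0)" for j
  define cl where "cl i j = {n. n \<in> B i \<and> int n dvd j \<and> rough (q ^ 4) (nat \<bar>j\<bar> div n) \<and> nat \<bar>j\<bar> div n \<noteq> 1}" for i j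
  define C where "C i j = (\<Sum>n\<in>cl i j. \<gamma> (j div int n))" for i j
  have \<gamma>0: "\<gamma> 0 = 0" using \<gamma>(3)[of 0] by simp
  have BA: "B i \<subseteq> A" if "i < J" for i
    using that blkX unfolding B_def by (meson UN_least atMost_iff le_less_trans subsetI)
  have finB: "finite (B i)" if "i < J" for i using BA[OF that] A(1) by (rule finite_subset)
  have X0: "0 < X i" if "i < J" for i using XA[OF that] A(2) by auto
  have quot: "nat \<bar>j div int n\<bar> = nat \<bar>j\<bar> div n" if "int n dvd j" "0 < n" for j n
  proof -
    obtain r where r: "j = int n * r" using \<open>int n dvd j\<close> by auto
    have "nat \<bar>j\<bar> = n * nat \<bar>r\<bar>" by (simp add: r abs_mult nat_mult_distrib)
    then show ?thesis using that(2) by (simp add: r)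
  qed
  \<comment> \<open>Within the band of stage \<open>i\<close> only the blocks up to \<open>i\<close>
    produce clutter: a quotient \<open>j div n\<close> of modulus above 1 is at least
    \<open>q ^ 4 \<ge> 2 * J\<close> in modulus, while \<open>|j| \<le> 2 * J * X i\<close>, so
    \<open>n \<le> X i\<close>.\<close>
  have split: "fc S j = main j + C i j" if i: "i < J" and j: "j \<in> I i" for i j
  proof -
    define T where "T = {n. n \<in> A \<and> int n dvd j}"
    define T1 where "T1 = {n. n \<in> A \<and> int n = j}"
    have finT: "finite T" using A(1) by (simp add: T_def)
    have T1: "T1 = (if j \<in> int ` A then {nat j} else {})" by (auto simp: T1_def)
    have d: "T1 \<inter> cl i j = {}" using A(2) by (auto simp: T1_def cl_def)
    have sub: "T1 \<union> cl i j \<subseteq> T" using BA[OF i] by (auto simp: T1_def cl_def T_def)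
    have "fc S j = (\<Sum>n\<in>T. \<gamma> (j div int n))" by (simp add: fcS T_def)
    also have "\<dots> = (\<Sum>n\<in>T1 \<union> cl i j. \<gamma> (j div int n))"
    proof (rule sum.mono_neutral_right[OF finT sub], rule ballI, rule ccontr)
      fix n assume n: "n \<in> T - (T1 \<union> cl i j)" and nz: "\<gamma> (j div int n) \<noteq> 0"
      have n': "n \<in> A" "int n dvd j" "0 < n" using n A(2) by (auto simp: T_def)
      have rg: "rough (q ^ 4) (nat \<bar>j\<bar> div n)" using \<gamma>(4)[OF nz] quot[OF n'(2,3)] by simp
      show False
      proof (cases "nat \<bar>j\<bar> div n = 1")
        case True
        then have "\<bar>j div int n\<bar> = 1" using quot[OF n'(2,3)] by simp
        then have "j div int n = 1" using nz \<gamma>(2) by (metis abs_eq_iff abs_of_nonneg zero_le_one)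
        then have "int n = j" using n'(2) by (metis dvd_mult_div_cancel mult.right_neutral)
        then show False using n n'(1) by (simp add: T1_def)
      next
        case False
        have "2 * J \<le> nat \<bar>j\<bar> div n" using rough_bound[OF rg False] q(4) by simp
        then have "2 * J * n \<le> nat \<bar>j\<bar>" using n'(3) by (simp add: less_eq_div_iff_mult_less_eq)
        also have "nat \<bar>j\<bar> \<le> 2 * J * X i"
        proof -
          have "2 * (int i + 1) * int (X i) \<le> 2 * int J * int (X i)" using i by (intro mult_right_mono) auto
          moreover have "1 * int (X i) \<le> 2 * int J * int (X i)" using i by (intro mult_right_mono) auto
          ultimately have "\<bar>j\<bar> \<le> 2 * int J * int (X i)" using j unfolding I_def by auto
          also have "\<dots> = int (2 * J * X i)" by simp
          finally show ?thesis by (simp only: nat_le_iff)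
        qed
        finally have "n \<le> X i" using i by simp
        then have "n \<in> cl i j" using init[OF i n'(1)] rg False n'(2) by (auto simp: cl_def B_def)
        then show False using n by simp
      qed
    qed
    also have "\<dots> = (\<Sum>n\<in>T1. \<gamma> (j div int n)) + C i j"
      unfolding C_def using finT sub d by (intro sum.union_disjoint) (auto intro: finite_subset)
    also have "(\<Sum>n\<in>T1. \<gamma> (j div int n)) = main j" using A(2) by (auto simp: T1 main_def \<gamma>(1))
    finally show ?thesis .
  qed
  have P: "integral {0..1} (\<lambda>x. S x * cnj (\<Sum>i<J. D i x))
    = (\<Sum>i<J. \<Sum>j\<in>I i. cnj (fc (D i) j) * main j) + (\<Sum>i<J. \<Sum>j\<in>I i. cnj (fc (D i) j) * C i j)"
  proof -
    have "integral {0..1} (\<lambda>x. S x * cnj (\<Sum>i<J. D i x)) = integral {0..1} (\<lambda>x. \<Sum>i<J. S x * cnj (D i x))"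
      by (simp add: sum_distrib_left)
    also have "\<dots> = (\<Sum>i<J. integral {0..1} (\<lambda>x. S x * cnj (D i x)))"
      by (intro Henstock_Kurzweil_Integration.integral_sum bbm_integrable bbm_mult S bbm_trig[OF trig_cnj[OF tD]]) auto
    also have "\<dots> = (\<Sum>i<J. \<Sum>j\<in>I i. cnj (fc (D i) j) * fc S j)"
      by (rule sum.cong[OF refl]) (simp add: integral_times_cnj_trig[OF S tD] I_def)
    also have "\<dots> = (\<Sum>i<J. \<Sum>j\<in>I i. cnj (fc (D i) j) * main j + cnj (fc (D i) j) * C i j)"
    proof (rule sum.cong[OF refl], rule sum.cong[OF refl])
      fix i j assume "i \<in> {..<J}" "j \<in> I i"
      then show "cnj (fc (D i) j) * fc S j = cnj (fc (D i) j) * main j + cnj (fc (D i) j) * C i j"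
        using split[of i j] by (simp add: distrib_left)
    qed
    finally show ?thesis by (simp add: sum.distrib)
  qed
  have mainP: "real J * \<eta> / pi \<le> norm (\<Sum>i<J. \<Sum>j\<in>I i. cnj (fc (D i) j) * main j)"
  proof -
    have 1: "(\<Sum>j\<in>I i. cnj (fc (D i) j) * main j) = - of_real (2 / pi) * (\<Sum>n\<in>A. cnj (fc (D i) (int n)))" if i: "i < J" for i
    proof -
      have "(\<Sum>j\<in>I i. cnj (fc (D i) j) * main j) = (\<Sum>j\<in>int ` A. cnj (fc (D i) j) * main j)"
        using A(1) trig_fc_0[OF tD[OF i]] by (intro sum.mono_neutral_cong) (auto simp: I_def main_def)
      also have "\<dots> = (\<Sum>n\<in>A. - of_real (2 / pi) * cnj (fc (D i) (int n)))"
        by (subst sum.reindex) (auto simp: main_def intro!: sum.cong)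
      finally show ?thesis by (simp only: sum_distrib_left)
    qed
    let ?F = "\<lambda>x. \<Sum>i<J. D i x"
    have fF: "fc ?F m = (\<Sum>i<J. fc (D i) m)" for m
      by (intro fc_sum trig_continuous[OF tD]) auto
    have "(\<Sum>i<J. \<Sum>j\<in>I i. cnj (fc (D i) j) * main j) = (\<Sum>i<J. - of_real (2 / pi) * (\<Sum>n\<in>A. cnj (fc (D i) (int n))))"
      by (rule sum.cong[OF refl]) (simp add: 1)
    also have "\<dots> = - of_real (2 / pi) * (\<Sum>n\<in>A. cnj (fc ?F (int n)))"
      unfolding fF cnj_sum by (subst sum_distrib_left[symmetric], subst sum.swap) (rule refl)
    \<comment> \<open>Elements of \<open>A\<close> outside the blocks exceed every
      \<open>X i\<close>, hence every frequency of the test function.\<close>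
    also have "(\<Sum>n\<in>A. cnj (fc ?F (int n))) = (\<Sum>n\<in>(\<Union>k<J. blk k). cnj (fc ?F (int n)))"
    proof (rule sum.mono_neutral_right[OF A(1)])
      show "(\<Union>k<J. blk k) \<subseteq> A" using blkX by auto
      show "\<forall>n\<in>A - (\<Union>k<J. blk k). cnj (fc ?F (int n)) = 0"
      proof
        fix n assume n: "n \<in> A - (\<Union>k<J. blk k)"
        have "fc (D i) (int n) = 0" if i: "i < J" for i
        proof (rule trig_fc_0[OF tD[OF i]])
          have "\<not> n \<le> X i" using init[OF i, of n] n i by auto
          then show "int n \<notin> {- (2 * (int i + 1) * int (X i))..int (X i)}" by simp
        qed
        then show "cnj (fc ?F (int n)) = 0" by (simp add: fF)
      qed
    qed
    also have "\<dots> = (\<Sum>k<J. \<Sum>n\<in>blk k. cnj (fc ?F (int n)))"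
      using blk(1) disj by (intro sum.UNION_disjoint) auto
    finally have "norm (\<Sum>i<J. \<Sum>j\<in>I i. cnj (fc (D i) j) * main j)
      = 2 / pi * norm (\<Sum>k<J. \<Sum>n\<in>blk k. cnj (fc ?F (int n)))" by (simp add: norm_mult norm_divide)
    moreover have "real J * \<eta> / 2 \<le> norm (\<Sum>k<J. \<Sum>n\<in>blk k. cnj (fc ?F (int n)))"
    proof -
      have "real J * \<eta> / 2 = (\<Sum>k<J. \<Sum>n\<in>blk k. \<eta> / 2 / 4 ^ k)" using blk(2) by simp
      also have "\<dots> \<le> (\<Sum>k<J. \<Sum>n\<in>blk k. Re (fc ?F (int n)))"
        by (rule sum_mono, rule sum_mono, rule fD) auto
      also have "\<dots> = Re (\<Sum>k<J. \<Sum>n\<in>blk k. cnj (fc ?F (int n)))" by simp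
      also have "\<dots> \<le> norm (\<Sum>k<J. \<Sum>n\<in>blk k. cnj (fc ?F (int n)))" by (rule complex_Re_le_cmod)
      finally show ?thesis .
    qed
    ultimately show ?thesis by (simp add: field_simps)
  qed
  have clutter: "norm (\<Sum>j\<in>I i. cnj (fc (D i) j) * C i j) \<le> 42 * K * \<eta> / real q" if i: "i < J" for i
  proof -
    define g :: "nat \<Rightarrow> real" where "g m = (\<Sum>n | n \<in> B i \<and> n dvd m \<and> rough (q ^ 4) (m div n) \<and> m div n \<noteq> 1. real n / real m)" for m
    have nC: "(norm (C i j))\<^sup>2 \<le> K\<^sup>2 * (g (nat \<bar>j\<bar>))\<^sup>2" for j
    proof -
      have "norm (C i j) \<le> (\<Sum>n\<in>cl i j. norm (\<gamma> (j div int n)))" unfolding C_def by (rule norm_sum)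
      also have "\<dots> \<le> (\<Sum>n\<in>cl i j. K * (real n / real (nat \<bar>j\<bar>)))"
      proof (rule sum_mono)
        fix n assume "n \<in> cl i j"
        then have n: "int n dvd j" "0 < n" using BA[OF i] A(2) by (auto simp: cl_def)
        have "real (nat \<bar>j\<bar>) = real n * \<bar>of_int (j div int n)\<bar>"
          using n by (auto simp: abs_mult)
        then show "norm (\<gamma> (j div int n)) \<le> K * (real n / real (nat \<bar>j\<bar>))"
          using \<gamma>(3)[of "j div int n"] n(2) by simp
      qed
      also have "\<dots> = K * g (nat \<bar>j\<bar>)"
        unfolding g_def sum_distrib_left by (rule sum.cong) (auto simp: cl_def dvd_nat_abs_iff)
      finally have "(norm (C i j))\<^sup>2 \<le> (K * g (nat \<bar>j\<bar>))\<^sup>2" by (intro power_mono) auto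
      then show ?thesis by (simp add: power_mult_distrib)
    qed
    have g0: "g 0 = 0" by (simp add: g_def)
    define M where "M = 2 * (i + 1) * X i"
    have IM: "I i \<subseteq> {- int M..int M}" unfolding I_def M_def by (auto simp: algebra_simps)
    have cB: "real (card (B i)) \<le> 4 / 3 * 4 ^ i"
    proof -
      have "card (B i) \<le> (\<Sum>l\<le>i. card (blk l))" unfolding B_def by (rule card_UN_le) simp
      also have "\<dots> = (\<Sum>l\<le>i. 4 ^ l)" using blk(2) i by (intro sum.cong) auto
      finally have "real (card (B i)) \<le> real (\<Sum>l\<le>i. 4 ^ l)" by (rule of_nat_mono)
      also have "\<dots> = (\<Sum>l\<le>i. 4 ^ l)" by simp
      also have "\<dots> \<le> 4 / 3 * 4 ^ i" by (induction i) auto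
      finally show ?thesis .
    qed
    have "(\<Sum>m\<in>{1..M}. (g m)\<^sup>2) \<le> 6 * real (card (B i)) / (real q)\<^sup>2"
      unfolding g_def using BA[OF i] A q card_mono[OF A(1) BA[OF i]]
      by (intro rough_multiples_l2 finB i) auto
    also have "\<dots> \<le> 6 * (4 / 3 * 4 ^ i) / (real q)\<^sup>2" using cB by (intro divide_right_mono) auto
    finally have gM: "(\<Sum>m\<in>{1..M}. (g m)\<^sup>2) \<le> 8 * 4 ^ i / (real q)\<^sup>2" by simp
    have "(\<Sum>j\<in>I i. (norm (C i j))\<^sup>2) \<le> (\<Sum>j\<in>I i. K\<^sup>2 * (g (nat \<bar>j\<bar>))\<^sup>2)" by (rule sum_mono[OF nC])
    also have "\<dots> \<le> (\<Sum>j\<in>{- int M..int M}. K\<^sup>2 * (g (nat \<bar>j\<bar>))\<^sup>2)" by (rule sum_mono2[OF _ IM]) auto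
    also have "\<dots> = K\<^sup>2 * (2 * (\<Sum>j\<in>{- int M..-1}. (g (nat \<bar>j\<bar>))\<^sup>2))"
      by (subst sum_symmetric_interval) (simp_all add: g0 sum_distrib_left mult_ac)
    also have "(\<Sum>j\<in>{- int M..-1}. (g (nat \<bar>j\<bar>))\<^sup>2) = (\<Sum>m\<in>{1..M}. (g m)\<^sup>2)"
      by (rule sum.reindex_bij_witness[of _ "\<lambda>m. - int m" "\<lambda>j. nat \<bar>j\<bar>"]) auto
    also have "K\<^sup>2 * (2 * (\<Sum>m\<in>{1..M}. (g m)\<^sup>2)) \<le> K\<^sup>2 * (2 * (8 * 4 ^ i / (real q)\<^sup>2))"
      using gM by (intro mult_left_mono) auto
    finally have CC: "(\<Sum>j\<in>I i. (norm (C i j))\<^sup>2) \<le> 16 * K\<^sup>2 * 4 ^ i / (real q)\<^sup>2" by (simp add: mult_ac)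
    have "norm (\<Sum>j\<in>I i. cnj (fc (D i) j) * C i j) \<le> (\<Sum>j\<in>I i. norm (fc (D i) j) * norm (C i j))"
      by (rule order_trans[OF norm_sum]) (simp add: norm_mult)
    then have "(norm (\<Sum>j\<in>I i. cnj (fc (D i) j) * C i j))\<^sup>2 \<le> (\<Sum>j\<in>I i. norm (fc (D i) j) * norm (C i j))\<^sup>2"
      by (intro power_mono) auto
    also have "\<dots> \<le> (\<Sum>j\<in>I i. (norm (fc (D i) j))\<^sup>2) * (\<Sum>j\<in>I i. (norm (C i j))\<^sup>2)"
      by (rule Cauchy_Schwarz_ineq_sum)
    \<comment> \<open>The decay of the stage cancels the number of elements that reach its band, so
      the bound is the same at every stage; its constant comes from
      \<open>110 * 16 = 1760 \<le> 42 ^ 2\<close>.\<close>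
    also have "\<dots> \<le> (110 * \<eta>\<^sup>2 / 4 ^ i) * (16 * K\<^sup>2 * 4 ^ i / (real q)\<^sup>2)"
      using iD[OF i] parseval[OF tD[OF i]] by (intro mult_mono CC) (auto simp: I_def intro!: sum_nonneg)
    also have "\<dots> = 1760 * (K * \<eta> / real q)\<^sup>2" by (simp add: power_mult_distrib power_divide)
    also have "\<dots> \<le> 1764 * (K * \<eta> / real q)\<^sup>2" by (intro mult_right_mono) auto
    also have "\<dots> = (42 * K * \<eta> / real q)\<^sup>2" by (simp add: power_mult_distrib power_divide)
    finally show ?thesis by (rule power2_le_imp_le) (use K \<eta>_def in simp)
  qed
  have "norm (\<Sum>i<J. \<Sum>j\<in>I i. cnj (fc (D i) j) * C i j) \<le> (\<Sum>i<J. 42 * K * \<eta> / real q)"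
    by (rule sum_norm_le[OF clutter]) auto
  also have "\<dots> \<le> real J * \<eta> / (2 * pi)"
  proof -
    \<comment> \<open>By \<open>84 * pi * K \<le> q\<close> the clutter is at most half of the main
      term.\<close>
    have "42 * K / real q \<le> 1 / (2 * pi)" using q(1,3) by (simp add: field_simps)
    then have "real J * \<eta> * (42 * K / real q) \<le> real J * \<eta> * (1 / (2 * pi))"
      by (rule mult_left_mono) (simp add: \<eta>_def)
    then show ?thesis by (simp add: field_simps)
  qed
  finally have clutterP: "norm (\<Sum>i<J. \<Sum>j\<in>I i. cnj (fc (D i) j) * C i j) \<le> real J * \<eta> / (2 * pi)" .
  have "real J * \<eta> / pi - real J * \<eta> / (2 * pi) \<le> norm (integral {0..1} (\<lambda>x. S x * cnj (\<Sum>i<J. D i x)))"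
    unfolding P by (rule order_trans[OF diff_mono[OF mainP clutterP] norm_diff_ineq])
  also have "\<dots> \<le> integral {0..1} (\<lambda>x. 3 * norm (S x))"
  proof (rule Henstock_Kurzweil_Integration.integral_norm_bound_integral)
    show "(\<lambda>x. S x * cnj (\<Sum>i<J. D i x)) integrable_on {0..1}"
      unfolding cnj_sum by (intro bbm_integrable bbm_mult bbm_sum S bbm_trig[OF trig_cnj[OF tD]]) auto
    show "(\<lambda>x. 3 * norm (S x)) integrable_on {0..1}" by (intro bbm_integrable bbm_intros S)
    show "norm (S x * cnj (\<Sum>i<J. D i x)) \<le> 3 * norm (S x)" for x
      using mult_right_mono[OF D[of x] norm_ge_zero[of "S x"]] by (simp add: norm_mult mult.commute del: cnj_sum)
  qed
  \<comment> \<open>\<open>768 = 2 * 3 * 128\<close>: half of the main term is left, the test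
    function has modulus at most 3, and \<open>\<eta> = 1 / 128\<close>.\<close>
  finally show ?thesis by (simp add: \<eta>_def field_simps)
qed

section \<open>Arcs and square waves\<close>

text \<open>Half-open like the two halves of \<open>sqw\<close>, so that the identities between arcs
  and square waves hold at every point and not just almost everywhere.\<close>

definition circ_arc :: "real \<Rightarrow> real \<Rightarrow> real \<Rightarrow> real" where
  "circ_arc a b t = (if a \<le> frac t \<and> frac t < b then 1 else 0)"

lemma arc_periodic: "circ_arc a b (t + of_int k) = circ_arc a b t"
  by (simp add: circ_arc_def frac_def)

lemma bbm_arc [bbm_intros]:
  assumes "g \<in> borel_measurable borel"
  shows "bbm (\<lambda>x. circ_arc a b (g x))"
proof (rule bbm_comp[of "circ_arc a b", OF _ assms])
  have "norm (circ_arc a b x) \<le> 1" for x by (simp add: circ_arc_def)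
  moreover have "circ_arc a b \<in> borel_measurable borel"
    unfolding circ_arc_def frac_def by measurable
  ultimately show "bbm (circ_arc a b)" unfolding bbm_def by blast
qed

lemma integral_arc:
  assumes "0 \<le> a" "a \<le> b" "b \<le> 1"
  shows "integral {0..1} (circ_arc a b) = b - a"
proof -
  have "((\<lambda>x::real. 1::real) has_integral (b - a)) {a..b}"
    using has_integral_const_real[of "1::real" a b] assms by simp
  then have "((\<lambda>x. if x \<in> {a..b} then 1::real else 0) has_integral (b - a)) {0..1}"
    using assms by (intro has_integral_restrict[THEN iffD2]) auto
  then have "(circ_arc a b has_integral (b - a)) {0..1}"
    by (rule has_integral_spike_finite[of "{b, 1}", rotated 2]) (auto simp: circ_arc_def frac_eq)
  then show ?thesis by (rule integral_unique)
qed

text \<open>A one-sided bound is enough, because \<open>|f| \<le> 2 * \<tau> - f\<close> pointwise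
  and \<open>f\<close> integrates to 0.\<close>

lemma integral_abs_le:
  assumes f: "bbm f" and le: "\<And>x. f x \<le> (\<tau>::real)" and 0: "integral {0..1} f = 0"
  shows "integral {0..1} (\<lambda>x. \<bar>f x\<bar>) \<le> 2 * \<tau>"
proof -
  have "0 \<le> \<tau>"
  proof -
    have "integral {0..1} f \<le> integral {0..1} (\<lambda>x::real. \<tau>)"
      using le by (intro Henstock_Kurzweil_Integration.integral_le bbm_integrable f bbm_const) auto
    then show ?thesis using 0 by simp
  qed
  have "integral {0..1} (\<lambda>x. \<bar>f x\<bar>) \<le> integral {0..1} (\<lambda>x. 2 * \<tau> - f x)"
  proof (rule Henstock_Kurzweil_Integration.integral_le)
    show "\<bar>f x\<bar> \<le> 2 * \<tau> - f x" for x using le[of x] \<open>0 \<le> \<tau>\<close> by linarith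
  qed (intro bbm_integrable bbm_intros f)+
  also have "\<dots> = integral {0..1} (\<lambda>x::real. 2 * \<tau>) - integral {0..1} f"
    by (intro Henstock_Kurzweil_Integration.integral_diff bbm_integrable bbm_intros f)
  finally show ?thesis using 0 by simp
qed

definition cosw :: "real \<Rightarrow> real" where
  "cosw t = sqw (t - 1 / 4)"

text \<open>Its \<open>r\<close>-th Fourier coefficient is that of \<open>cosw\<close> times
  \<open>2 * \<i> * sin (pi * r * d / (2 * u))\<close>. The factor depends on the product
  \<open>r * d\<close> only, which lets the sieve regroup dilates by \<open>d\<close>.\<close>

definition sinw :: "nat \<Rightarrow> nat \<Rightarrow> real \<Rightarrow> real" where
  "sinw u d t = sqw (t - (1 / 4 - real d / (4 * real u))) - sqw (t - (1 / 4 + real d / (4 * real u)))"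

lemma sqw_eq: "- (1 / 2) \<le> z \<Longrightarrow> z < 1 \<Longrightarrow> sqw z = (if 0 \<le> z \<and> z < 1 / 2 then 1 / 2 else - (1 / 2))"
proof -
  assume z: "- (1 / 2) \<le> z" "z < 1"
  have "frac z = (if 0 \<le> z then z else z + 1)"
  proof (cases "0 \<le> z")
    case True
    then show ?thesis using z by (simp add: frac_eq)
  next
    case False
    have "frac z = z + 1" using False z by (subst frac_unique_iff) auto
    then show ?thesis using False by simp
  qed
  then show ?thesis using z by (auto simp: sqw_def)
qed

lemma sqw_frac: "sqw (t + a) = sqw (frac t + a)"
  using sqw_periodic(2)[of "frac t + a" "\<lfloor>t\<rfloor>"] by (simp add: frac_def algebra_simps)

lemma sinw_eq_arc:
  assumes "0 < d" "d < u"
  shows "sinw u d t = circ_arc (1/4 - real d / (4 * real u)) (1/4 + real d / (4 * real u)) t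
    - circ_arc (3/4 - real d / (4 * real u)) (3/4 + real d / (4 * real u)) t"
proof -
  define \<theta> where "\<theta> = real d / (4 * real u)"
  have \<theta>: "0 < \<theta>" "\<theta> < 1 / 4" using assms by (auto simp: \<theta>_def field_simps)
  define y where "y = frac t"
  have y: "0 \<le> y" "y < 1" by (auto simp: y_def frac_lt_1)
  have 1: "sqw (t - (1/4 - \<theta>)) = (if 0 \<le> y - (1/4 - \<theta>) \<and> y - (1/4 - \<theta>) < 1 / 2 then 1 / 2 else - (1 / 2))"
    using \<theta> y by (subst diff_conv_add_uminus, subst sqw_frac, subst sqw_eq) (auto simp flip: y_def)
  have 2: "sqw (t - (1/4 + \<theta>)) = (if 0 \<le> y - (1/4 + \<theta>) \<and> y - (1/4 + \<theta>) < 1 / 2 then 1 / 2 else - (1 / 2))"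
    using \<theta> y by (subst diff_conv_add_uminus, subst sqw_frac, subst sqw_eq) (auto simp flip: y_def)
  show ?thesis
    unfolding sinw_def \<theta>_def[symmetric] 1 2 circ_arc_def y_def[symmetric] using \<theta> by auto
qed

text \<open>The sieve produces odd \<open>d\<close> far above \<open>u\<close>, whereas arcs are
  available for \<open>v < u\<close> only. The antisymmetry of \<open>sqw\<close> under half a
  period reduces \<open>d\<close> by \<open>2 * u\<close> with a change of sign, and reflects
  \<open>d\<close> to \<open>2 * u - d\<close> without one.\<close>

lemma sinw_reduce:
  assumes u: "even u" "0 < u" and d: "odd d"
  shows "\<exists>v \<sigma>. odd v \<and> v < u \<and> \<bar>\<sigma>\<bar> = (1::real) \<and> (\<forall>t. sinw u d t = \<sigma> * sinw u v t)"
  using d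
proof (induction d rule: less_induct)
  case (less d)
  have "d \<noteq> u" using less.prems u by auto
  then consider "d < u" | "u < d" "d < 2 * u" | "2 * u \<le> d" by linarith
  then show ?case
  proof cases
    case 1
    then show ?thesis using less.prems by (intro exI[of _ d] exI[of _ 1]) auto
  next
    case 2
    have eq: "real (2 * u - d) / (4 * real u) = 1 / 2 - real d / (4 * real u)"
      using 2 u by (simp add: of_nat_diff field_simps)
    have "sinw u d t = 1 * sinw u (2 * u - d) t" for t
      using sqw_half[of "t - (1/4 + real d / (4 * real u))"] sqw_half[of "t - (3/4 - real d / (4 * real u))"]
      unfolding sinw_def eq by (simp add: algebra_simps)
    moreover have "odd (2 * u - d)" "2 * u - d < u" using 2 less.prems by auto
    ultimately show ?thesis by (metis abs_one)
  next
    case 3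
    have eq: "real (d - 2 * u) / (4 * real u) = real d / (4 * real u) - 1 / 2"
      using 3 u by (simp add: of_nat_diff field_simps)
    have m: "sinw u d t = - sinw u (d - 2 * u) t" for t
      using sqw_half[of "t - (1/4 - real d / (4 * real u)) - 1 / 2"] sqw_half[of "t - (1/4 + real d / (4 * real u))"]
      unfolding sinw_def eq by (simp add: algebra_simps)
    have "odd (d - 2 * u)" "d - 2 * u < d" using 3 less.prems u by auto
    then obtain v \<sigma> where v: "odd v" "v < u" "\<bar>\<sigma>\<bar> = (1::real)" "\<And>t. sinw u (d - 2 * u) t = \<sigma> * sinw u v t"
      using less.IH by blast
    then show ?thesis by (intro exI[of _ v] exI[of _ "- \<sigma>"]) (auto simp: m)
  qed
qed

lemma alternating_sum: "(\<Sum>w<h. (-1) ^ w * (2 * real w + 1)) = - ((-1) ^ h * real h)"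
  by (induction h) (auto simp: algebra_simps)

lemma alternating_tail: "d \<le> h \<Longrightarrow> (\<Sum>w<h. (-1) ^ w * (if d \<le> w then 1 else 0)) = ((-1) ^ d - (-1) ^ h) / (2::real)"
proof (induction h rule: dec_induct)
  case base
  then show ?case by (simp add: sum.neutral)
next
  case (step n)
  then show ?case by simp
qed

text \<open>Both sides depend only on \<open>s = \<lfloor>u x + 1/2\<rfloor>\<close> for \<open>x = frac (2 t)\<close>: the arcs indexed by \<open>w\<close> contain
  \<open>t\<close> iff \<open>\<bar>s - h\<bar> \<le> w\<close>.\<close>

lemma cosw_eq_arcs:
  assumes u: "u = 2 * h" "0 < h"
  shows "cosw (real u * t) = - ((-1) ^ h) * (\<Sum>w<h. (-1) ^ w *
    (circ_arc (1/4 - real (2 * w + 1) / (4 * real u)) (1/4 + real (2 * w + 1) / (4 * real u)) t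
   + circ_arc (3/4 - real (2 * w + 1) / (4 * real u)) (3/4 + real (2 * w + 1) / (4 * real u)) t
   - real (2 * w + 1) / real u))"
proof -
  define y where "y = frac t"
  define x where "x = frac (2 * t)"
  have y: "0 \<le> y" "y < 1" by (auto simp: y_def frac_lt_1)
  have x: "0 \<le> x" "x < 1" by (auto simp: x_def frac_lt_1)
  have xy: "x = (if y < 1 / 2 then 2 * y else 2 * y - 1)"
  proof -
    have "2 * t - 2 * y = of_int (2 * \<lfloor>t\<rfloor>)" "2 * t - (2 * y - 1) = of_int (2 * \<lfloor>t\<rfloor> + 1)"
      by (simp_all add: y_def frac_def)
    then have "2 * t - 2 * y \<in> \<int>" "2 * t - (2 * y - 1) \<in> \<int>" by (metis Ints_of_int)+
    then show ?thesis unfolding x_def using y by (subst frac_unique_iff) auto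
  qed
  define s where "s = \<lfloor>real u * x + 1 / 2\<rfloor>"
  define d where "d = nat \<bar>s - int h\<bar>"
  have s: "of_int s \<le> real u * x + 1 / 2" "real u * x + 1 / 2 < of_int s + 1" unfolding s_def by linarith+
  have s0: "0 \<le> s" using x by (simp add: s_def)
  have su: "s \<le> int u"
  proof -
    have "real u * x \<le> real u" using x by (intro mult_left_le) auto
    then have "real_of_int s < real u + 1" using s(1) by linarith
    then show ?thesis by linarith
  qed
  have dh: "d \<le> h" using s0 su u by (auto simp: d_def)
  have arcs: "circ_arc (1/4 - real (2 * w + 1) / (4 * real u)) (1/4 + real (2 * w + 1) / (4 * real u)) t
   + circ_arc (3/4 - real (2 * w + 1) / (4 * real u)) (3/4 + real (2 * w + 1) / (4 * real u)) t
   = (if d \<le> w then 1 else 0)" if w: "w < h" for w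
  proof -
    define \<theta> where "\<theta> = real (2 * w + 1) / (4 * real u)"
    have \<theta>: "0 < \<theta>" "\<theta> < 1 / 4" using w u by (auto simp: \<theta>_def field_simps)
    have "circ_arc (1/4 - \<theta>) (1/4 + \<theta>) t + circ_arc (3/4 - \<theta>) (3/4 + \<theta>) t
      = (if 1/2 - 2 * \<theta> \<le> x \<and> x < 1/2 + 2 * \<theta> then 1 else 0)"
      unfolding circ_arc_def y_def[symmetric] xy using \<theta> y by auto
    also have "1/2 - 2 * \<theta> \<le> x \<and> x < 1/2 + 2 * \<theta> \<longleftrightarrow> of_int (int h - int w) \<le> real u * x + 1 / 2 \<and> real u * x + 1 / 2 < of_int (int h + int w + 1)"
      using u by (auto simp: \<theta>_def field_simps)
    also have "\<dots> \<longleftrightarrow> int h - int w \<le> s \<and> s < int h + int w + 1"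
      unfolding s_def by (simp only: le_floor_iff floor_less_iff)
    also have "\<dots> \<longleftrightarrow> d \<le> w" by (auto simp: d_def)
    finally show ?thesis by (simp add: \<theta>_def)
  qed
  have "(\<Sum>w<h. (-1) ^ w *
    (circ_arc (1/4 - real (2 * w + 1) / (4 * real u)) (1/4 + real (2 * w + 1) / (4 * real u)) t
   + circ_arc (3/4 - real (2 * w + 1) / (4 * real u)) (3/4 + real (2 * w + 1) / (4 * real u)) t
   - real (2 * w + 1) / real u)) = (\<Sum>w<h. (-1) ^ w * (if d \<le> w then 1 else 0) - (-1) ^ w * (2 * real w + 1) / real u)"
    by (rule sum.cong[OF refl]) (simp only: arcs lessThan_iff, simp add: algebra_simps)
  also have "\<dots> = ((-1) ^ d - (-1) ^ h) / 2 + (-1) ^ h * real h / real u"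
    unfolding sum_subtractf alternating_tail[OF dh] sum_divide_distrib[symmetric] alternating_sum by simp
  also have "\<dots> = (-1) ^ d / 2" using u by (simp add: field_simps)
  finally have R: "(\<Sum>w<h. (-1) ^ w *
    (circ_arc (1/4 - real (2 * w + 1) / (4 * real u)) (1/4 + real (2 * w + 1) / (4 * real u)) t
   + circ_arc (3/4 - real (2 * w + 1) / (4 * real u)) (3/4 + real (2 * w + 1) / (4 * real u)) t
   - real (2 * w + 1) / real u)) = (-1) ^ d / 2" .
  have "real u * t = real h * x + of_int (int h * \<lfloor>2 * t\<rfloor>)" using u by (simp add: x_def frac_def algebra_simps)
  then have "cosw (real u * t) = sqw (real h * x - 1 / 4)"
    using sqw_periodic(2)[of "real h * x - 1/4" "int h * \<lfloor>2 * t\<rfloor>"] by (simp add: cosw_def algebra_simps)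
  also have "\<dots> = (if even s then - (1 / 2) else 1 / 2)"
  proof -
    define f where "f = real u * x + 1 / 2 - of_int s"
    have f: "0 \<le> f" "f < 1" using s by (auto simp: f_def)
    have e: "real h * x - 1 / 4 = of_int s / 2 + f / 2 - 1 / 2" using u by (simp add: f_def field_simps)
    show ?thesis
    proof (cases "even s")
      case True
      then obtain k where "s = 2 * k" by auto
      then have "real h * x - 1 / 4 = f / 2 - 1 / 2 + of_int k" using e by simp
      then have "sqw (real h * x - 1 / 4) = sqw (f / 2 - 1 / 2)" by (simp only: sqw_periodic)
      then show ?thesis using f True by (simp add: sqw_eq)
    next
      case False
      then obtain k where "s = 2 * k + 1" by (auto elim: oddE)
      then have "real h * x - 1 / 4 = f / 2 + of_int k" using e by (simp add: add_divide_distrib)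
      then have "sqw (real h * x - 1 / 4) = sqw (f / 2)" by (simp only: sqw_periodic)
      then show ?thesis using f False by (simp add: sqw_eq)
    qed
  qed
  also have "\<dots> = - ((-1) ^ h) * ((-1) ^ d / 2)"
  proof -
    have "even (h + d) \<longleftrightarrow> even s" by (auto simp: d_def even_nat_iff)
    then have "(-1::real) ^ (h + d) = (if even s then 1 else - 1)" by simp
    then show ?thesis by (simp add: power_add)
  qed
  finally show ?thesis unfolding R .
qed

section \<open>Discrepancy of dilates\<close>

definition disc :: "nat set \<Rightarrow> nat \<Rightarrow> nat \<Rightarrow> real \<Rightarrow> real \<Rightarrow> real" where
  "disc A u v c y = (\<Sum>n\<in>A. circ_arc (c - real v / (4 * real u)) (c + real v / (4 * real u)) (real n * y) - real v / (2 * real u))"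

lemma bbm_disc: "g \<in> borel_measurable borel \<Longrightarrow> bbm (\<lambda>x. disc A u v c (g x))"
  unfolding disc_def by (intro bbm_intros) measurable

lemma disc_periodic: "disc A u v c (y + 1) = disc A u v c y"
proof -
  have "circ_arc a b (real n * (y + 1)) = circ_arc a b (real n * y)" for a b n
    using arc_periodic[of a b "real n * y" "int n"] by (simp add: algebra_simps)
  then show ?thesis by (simp add: disc_def)
qed

lemma integral_disc:
  assumes A: "\<And>n. n \<in> A \<Longrightarrow> 0 < n" and v: "v < u" and c: "c = 1 / 4 \<or> c = 3 / 4"
  shows "integral {0..1} (disc A u v c) = 0"
proof -
  let ?a = "c - real v / (4 * real u)" and ?b = "c + real v / (4 * real u)"
  have \<theta>: "0 \<le> real v / (4 * real u)" "real v / (4 * real u) \<le> 1 / 4" using v by (auto simp: field_simps)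
  have b: "bbm (\<lambda>y. circ_arc ?a ?b (real n * y) - real v / (2 * real u))" for n
    by (intro bbm_intros) measurable
  have "integral {0..1} (disc A u v c) = (\<Sum>n\<in>A. integral {0..1} (\<lambda>y. circ_arc ?a ?b (real n * y) - real v / (2 * real u)))"
    unfolding disc_def[abs_def]
    by (cases "finite A") (simp_all add: Henstock_Kurzweil_Integration.integral_sum bbm_integrable b)
  also have "\<dots> = 0"
  proof (rule sum.neutral, rule ballI)
    fix n assume "n \<in> A"
    then have n: "0 < n" by (rule A)
    have ba: "bbm (circ_arc ?a ?b)" using bbm_arc[of "\<lambda>x. x"] by simp
    have "integral {0..1} (\<lambda>y. circ_arc ?a ?b (real n * y)) = integral {0..1} (circ_arc ?a ?b)"
      using n arc_periodic[of ?a ?b _ 1] by (intro integral_periodic_dilate ba) auto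
    also have "\<dots> = ?b - ?a" using c \<theta> by (intro integral_arc) auto
    finally have "integral {0..1} (\<lambda>y. circ_arc ?a ?b (real n * y)) = real v / (2 * real u)" by simp
    moreover have "integral {0..1} (\<lambda>y. circ_arc ?a ?b (real n * y) - real v / (2 * real u))
      = integral {0..1} (\<lambda>y. circ_arc ?a ?b (real n * y)) - integral {0..1} (\<lambda>y::real. real v / (2 * real u))"
      by (intro Henstock_Kurzweil_Integration.integral_diff bbm_integrable bbm_intros) measurable
    ultimately show "integral {0..1} (\<lambda>y. circ_arc ?a ?b (real n * y) - real v / (2 * real u)) = 0" by simp
  qed
  finally show ?thesis .
qed

text \<open>The situation to be refuted in \<open>large_discrepancy\<close>, with
  \<open>\<tau>\<close> a small multiple of \<open>ln N / ln (ln N)\<close>.\<close>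

locale small_disc =
  fixes A :: "nat set" and u h :: nat and \<tau> :: real
  assumes A: "\<And>n. n \<in> A \<Longrightarrow> 0 < n" and u: "u = 2 * h" "0 < h"
    and small: "\<And>v c y. odd v \<Longrightarrow> v < u \<Longrightarrow> c = 1 / 4 \<or> c = 3 / 4 \<Longrightarrow> disc A u v c y \<le> \<tau>"
begin

lemma integral_abs_disc:
  assumes v: "odd v" "v < u" "c = 1 / 4 \<or> c = 3 / 4" and m: "0 < (m::nat)"
  shows "integral {0..1} (\<lambda>y. \<bar>disc A u v c (real m * y)\<bar>) \<le> 2 * \<tau>"
proof -
  have b: "bbm (disc A u v c)" using bbm_disc[of "\<lambda>x. x"] by simp
  have "integral {0..1} (\<lambda>y. \<bar>disc A u v c (real m * y)\<bar>) = integral {0..1} (\<lambda>y. \<bar>disc A u v c y\<bar>)"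
    using disc_periodic[of A u v c] by (intro integral_periodic_dilate[of "\<lambda>y. \<bar>disc A u v c y\<bar>"] bbm_intros b m) auto
  also have "\<dots> \<le> 2 * \<tau>" using small[OF v] integral_disc[OF A v(2,3)] by (intro integral_abs_le b)
  finally show ?thesis .
qed

text \<open>Up to sign the sum is the difference of the discrepancies for the two arcs, whose means
  cancel; each contributes \<open>2 * \<tau>\<close>.\<close>

lemma integral_abs_sinw:
  assumes d: "odd d" and m: "0 < (m::nat)"
  shows "integral {0..1} (\<lambda>y. \<bar>\<Sum>n\<in>A. sinw u d (real (m * n) * y)\<bar>) \<le> 4 * \<tau>"
proof -
  obtain v \<sigma> where v: "odd v" "v < u" and \<sigma>: "\<bar>\<sigma>\<bar> = (1::real)" "\<And>t. sinw u d t = \<sigma> * sinw u v t"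
    using sinw_reduce[of u d] u d by auto
  have v0: "0 < v" using v by (auto intro: odd_pos)
  have "\<bar>\<Sum>n\<in>A. sinw u d (real (m * n) * y)\<bar> = \<bar>disc A u v (1/4) (real m * y) - disc A u v (3/4) (real m * y)\<bar>" for y
  proof -
    have "(\<Sum>n\<in>A. sinw u d (real (m * n) * y)) = \<sigma> * (\<Sum>n\<in>A. sinw u v (real n * (real m * y)))"
      by (simp add: \<sigma>(2) sum_distrib_left mult_ac)
    also have "(\<Sum>n\<in>A. sinw u v (real n * (real m * y))) = disc A u v (1/4) (real m * y) - disc A u v (3/4) (real m * y)"
      unfolding disc_def sum_subtractf[symmetric] by (simp add: sinw_eq_arc[OF v0 v(2)])
    finally show ?thesis by (simp add: abs_mult \<sigma>(1))
  qed
  then have "integral {0..1} (\<lambda>y. \<bar>\<Sum>n\<in>A. sinw u d (real (m * n) * y)\<bar>)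
    = integral {0..1} (\<lambda>y. \<bar>disc A u v (1/4) (real m * y) - disc A u v (3/4) (real m * y)\<bar>)" by simp
  also have "\<dots> \<le> integral {0..1} (\<lambda>y. \<bar>disc A u v (1/4) (real m * y)\<bar> + \<bar>disc A u v (3/4) (real m * y)\<bar>)"
    by (intro Henstock_Kurzweil_Integration.integral_le bbm_integrable bbm_intros bbm_disc; (measurable | simp))
  also have "\<dots> = integral {0..1} (\<lambda>y. \<bar>disc A u v (1/4) (real m * y)\<bar>) + integral {0..1} (\<lambda>y. \<bar>disc A u v (3/4) (real m * y)\<bar>)"
    by (intro Henstock_Kurzweil_Integration.integral_add bbm_integrable bbm_intros bbm_disc) measurable
  also have "\<dots> \<le> 4 * \<tau>" using integral_abs_disc[OF v _ m, of "1/4"] integral_abs_disc[OF v _ m, of "3/4"] by simp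
  finally show ?thesis .
qed

lemma integral_abs_cosw:
  assumes m: "0 < (m::nat)"
  shows "integral {0..1} (\<lambda>y. \<bar>\<Sum>n\<in>A. cosw (real (m * n) * y)\<bar>) \<le> 2 * real u * \<tau>"
proof -
  define f where "f y = \<bar>\<Sum>n\<in>A. cosw (real n * y)\<bar>" for y
  have cp: "cosw (real n * (y + 1)) = cosw (real n * y)" for n y
    using sqw_periodic(2)[of "real n * y - 1/4" "int n"] by (simp add: cosw_def algebra_simps)
  have fp: "f (y + 1) = f y" for y by (simp only: f_def cp)
  have bf: "bbm f" unfolding f_def[abs_def] cosw_def by (intro bbm_intros)
  have "integral {0..1} (\<lambda>y. \<bar>\<Sum>n\<in>A. cosw (real (m * n) * y)\<bar>) = integral {0..1} (\<lambda>y. f (real m * y))"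
    by (simp add: f_def mult_ac)
  also have "\<dots> = integral {0..1} f" by (rule integral_periodic_dilate[OF fp bf m])
  \<comment> \<open>Dilation by \<open>u\<close> does not change the integral and brings the
    argument of \<open>cosw\<close> to the form treated by \<open>cosw_eq_arcs\<close>. The
    \<open>2 * h = u\<close> discrepancies then contribute \<open>2 * \<tau>\<close> each.\<close>
  also have "\<dots> = integral {0..1} (\<lambda>y. f (real u * y))"
    using u by (intro integral_periodic_dilate[OF fp bf, symmetric]) auto
  also have "\<dots> \<le> integral {0..1} (\<lambda>y. \<Sum>w<h. \<bar>disc A u (2 * w + 1) (1/4) (real 1 * y)\<bar> + \<bar>disc A u (2 * w + 1) (3/4) (real 1 * y)\<bar>)"
  proof (rule Henstock_Kurzweil_Integration.integral_le)
    fix y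
    have "(\<Sum>n\<in>A. cosw (real n * (real u * y))) = (\<Sum>n\<in>A. cosw (real u * (real n * y)))" by (simp add: mult_ac)
    also have "\<dots> = (\<Sum>w<h. - ((-1) ^ h) * (-1) ^ w * (disc A u (2 * w + 1) (1/4) y + disc A u (2 * w + 1) (3/4) y))"
    proof -
      have dd: "disc A u v (1/4) y + disc A u v (3/4) y = (\<Sum>n\<in>A.
          circ_arc (1/4 - real v / (4 * real u)) (1/4 + real v / (4 * real u)) (real n * y)
        + circ_arc (3/4 - real v / (4 * real u)) (3/4 + real v / (4 * real u)) (real n * y) - real v / real u)" for v
        unfolding disc_def sum.distrib[symmetric] by (rule sum.cong[OF refl]) (simp add: field_simps)
      show ?thesis
        unfolding cosw_eq_arcs[OF u] dd sum_distrib_left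
        by (subst sum.swap) (simp only: mult.assoc)
    qed
    finally have "f (real u * y) \<le> (\<Sum>w<h. \<bar>- ((-1) ^ h) * (-1) ^ w * (disc A u (2 * w + 1) (1/4) y + disc A u (2 * w + 1) (3/4) y)\<bar>)"
      by (simp only: f_def sum_abs)
    also have "\<dots> = (\<Sum>w<h. \<bar>disc A u (2 * w + 1) (1/4) y + disc A u (2 * w + 1) (3/4) y\<bar>)"
      by (simp add: abs_mult power_abs)
    also have "\<dots> \<le> (\<Sum>w<h. \<bar>disc A u (2 * w + 1) (1/4) (real 1 * y)\<bar> + \<bar>disc A u (2 * w + 1) (3/4) (real 1 * y)\<bar>)"
      by (rule sum_mono) simp
    finally show "f (real u * y) \<le> (\<Sum>w<h. \<bar>disc A u (2 * w + 1) (1/4) (real 1 * y)\<bar> + \<bar>disc A u (2 * w + 1) (3/4) (real 1 * y)\<bar>)" .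
  next
    show "(\<lambda>y. f (real u * y)) integrable_on {0..1}"
      by (intro bbm_integrable bbm_comp[OF bf]) measurable
    show "(\<lambda>y. \<Sum>w<h. \<bar>disc A u (2 * w + 1) (1/4) (real 1 * y)\<bar> + \<bar>disc A u (2 * w + 1) (3/4) (real 1 * y)\<bar>) integrable_on {0..1}"
      by (intro bbm_integrable bbm_intros bbm_disc) measurable
  qed
  also have "\<dots> = (\<Sum>w<h. integral {0..1} (\<lambda>y. \<bar>disc A u (2 * w + 1) (1/4) (real 1 * y)\<bar> + \<bar>disc A u (2 * w + 1) (3/4) (real 1 * y)\<bar>))"
    by (intro Henstock_Kurzweil_Integration.integral_sum bbm_integrable bbm_intros bbm_disc) auto
  also have "\<dots> = (\<Sum>w<h. integral {0..1} (\<lambda>y. \<bar>disc A u (2 * w + 1) (1/4) (real 1 * y)\<bar>) + integral {0..1} (\<lambda>y. \<bar>disc A u (2 * w + 1) (3/4) (real 1 * y)\<bar>))"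
    by (rule sum.cong[OF refl], intro Henstock_Kurzweil_Integration.integral_add bbm_integrable bbm_intros bbm_disc) auto
  also have "\<dots> \<le> (\<Sum>w<h. 2 * \<tau> + 2 * \<tau>)"
    using u by (intro sum_mono add_mono integral_abs_disc) auto
  also have "\<dots> = 2 * real u * \<tau>" using u by simp
  finally show ?thesis .
qed

end

text \<open>For odd \<open>d\<close> the sign is the nontrivial character modulo 4. It appears
  because \<open>cosw\<close> is shifted by a quarter period, and the weights of the sieve have to
  compensate for it.\<close>

lemma ee_quarter_mult:
  assumes d: "odd d" and r: "odd r"
  shows "ee (- (r * int d)) (1 / 4) = (-1) ^ (d div 2) * ee (- r) (1 / 4)"
proof -
  obtain k where k: "d = 2 * k + 1" using d by (auto elim: oddE)
  have "ee (- (r * int d)) (1 / 4) = ee (- r) (1 / 4) * ee (- (2 * (r * int k))) (1 / 4)"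
    by (simp add: k algebra_simps flip: ee_add)
  also have "ee (- (2 * (r * int k))) (1 / 4) = ee (- (r * int k)) (1 / 2)" by (simp add: ee_def)
  also have "\<dots> = (-1) ^ k" using r by (simp add: ee_half)
  finally show ?thesis by (simp add: k)
qed

lemma rough_coprime_odd_primes:
  assumes r: "odd r" "\<not> (\<exists>p\<in>{p. prime p \<and> odd p \<and> p < y}. p dvd nat \<bar>r\<bar>)"
  shows "rough y (nat \<bar>r\<bar>)"
  unfolding rough_def
proof (intro conjI allI impI)
  show "0 < nat \<bar>r\<bar>" using r(1) by auto
  fix p :: nat assume p: "prime p" "p dvd nat \<bar>r\<bar>"
  have "int p dvd r" using p(2) by (simp add: dvd_nat_abs_iff)
  then have "odd p" using r(1) by (metis dvd_trans even_of_nat)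
  then show "y \<le> p" using p r(2) by (auto simp: not_less[symmetric])
qed

context small_disc
begin

text \<open>For \<open>d = \<Prod>X\<close> the weight \<open>c X\<close> consists of a Moebius
  sign, the sign of \<open>ee_quarter_mult\<close> and \<open>1 / d\<close>. The last two turn the
  coefficient of \<open>b d n\<close> at \<open>n * r\<close>, for odd \<open>r\<close> divisible by
  \<open>d\<close>, into \<open>\<gamma>0 r\<close>, whatever \<open>d\<close> is. Summing the
  Moebius signs then leaves precisely the odd \<open>r\<close> without a prime factor in
  \<open>P\<close>.\<close>

lemma discrepancy_bound:
  assumes fin: "finite A" and J: "1 \<le> J" "4 ^ J \<le> 3 * card A + 1"
    and s: "s = sin (pi / (2 * real u))"
    and q: "2 \<le> q" "card A \<le> 2 ^ q" "84 * (1 + 1 / s) \<le> real q" "2 * J \<le> q ^ 4"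
  shows "real J / (768 * pi) \<le> (2 + 8 * ln (real (q ^ 4))) * ((2 * real u + 2 / s) * \<tau>)"
proof -
  have u2: "2 \<le> u" using u by simp
  have s0: "0 < s" unfolding s using u2 by (intro sin_gt_zero) (auto simp: field_simps)
  define P where "P = {p. prime p \<and> odd p \<and> p < q ^ 4}"
  have P: "finite P" "\<And>p. p \<in> P \<Longrightarrow> prime p" by (auto simp: P_def)
  have odd_prod: "odd (\<Prod>X)" if "X \<in> Pow P" for X
  proof -
    have "finite X" "X \<subseteq> P" using that P(1) by (auto intro: finite_subset)
    then show ?thesis by (induction X rule: finite_induct) (auto simp: P_def)
  qed
  define c where "c X = complex_of_real ((-1) ^ card X * (-1) ^ (\<Prod>X div 2) / real (\<Prod>X))" for X :: "nat set"
  \<comment> \<open>The imaginary multiple of the odd wave adds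
    \<open>sin (pi * r / (2 * u)) / s\<close> to the factor 1 of the even one: the sum is 2 at
    \<open>r = 1\<close> and 0 at \<open>r = - 1\<close>.\<close>
  define b where "b d n x = complex_of_real (cosw (real (d * n) * x))
    - \<i> / complex_of_real (2 * s) * complex_of_real (sinw u d (real (d * n) * x))" for d n :: nat and x
  define S where "S x = (\<Sum>X\<in>Pow P. c X * (\<Sum>n\<in>A. b (\<Prod>X) n x))" for x
  have bcos: "bbm (\<lambda>x. cosw (real k * x))" for k unfolding cosw_def by (intro bbm_intros)
  have bsin: "bbm (\<lambda>x. sinw u d (real k * x))" for d k unfolding sinw_def by (intro bbm_intros)
  have bb: "bbm (\<lambda>x. b d n x)" for d n unfolding b_def by (intro bbm_intros bcos bsin)
  have bS: "bbm S" unfolding S_def[abs_def] by (intro bbm_intros bb)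
  define \<gamma>0 where "\<gamma>0 r = ee (- r) (1 / 4) / (pi * of_int r * \<i>) * complex_of_real (1 + sin (pi * of_int r / (2 * real u)) / s)" for r
  define \<gamma> where "\<gamma> r = (if odd r \<and> \<not> (\<exists>p\<in>P. p dvd nat \<bar>r\<bar>) then \<gamma>0 r else 0)" for r
  have e1: "ee (- 1) (1 / 4) = - \<i>" "ee 1 (1 / 4) = \<i>"
  proof -
    have "ee (- 1) (1 / 4) = cis (- (pi / 2))" "ee 1 (1 / 4) = cis (pi / 2)" by (simp_all add: ee_def)
    then show "ee (- 1) (1 / 4) = - \<i>" "ee 1 (1 / 4) = \<i>" by (simp_all add: complex_eq_iff)
  qed
  have noP1: "\<not> (\<exists>p\<in>P. p dvd 1)" using P(2) not_prime_1 by (metis nat_dvd_1_iff_1)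
  have \<gamma>1: "\<gamma> 1 = - of_real (2 / pi)"
    using noP1 s0 by (simp add: \<gamma>_def \<gamma>0_def e1 s field_simps)
  have \<gamma>m1: "\<gamma> (- 1) = 0"
    using noP1 s0 by (simp add: \<gamma>_def \<gamma>0_def e1 s)
  have \<gamma>K: "norm (\<gamma> r) \<le> ((1 + 1 / s) / pi) / \<bar>of_int r\<bar>" for r
  proof -
    have "\<bar>1 + sin (pi * of_int r / (2 * real u)) / s\<bar> \<le> 1 + 1 / s"
    proof -
      have "\<bar>sin (pi * of_int r / (2 * real u)) / s\<bar> \<le> 1 / s"
        using s0 by (simp add: divide_right_mono)
      then show ?thesis by linarith
    qed
    then have "norm (\<gamma>0 r) \<le> 1 / (pi * \<bar>of_int r\<bar>) * (1 + 1 / s)"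
      unfolding \<gamma>0_def norm_mult norm_divide norm_of_real
      by (intro mult_mono) (simp_all add: norm_mult abs_mult)
    then show ?thesis using s0 by (auto simp: \<gamma>_def field_simps)
  qed
  have \<gamma>r: "rough (q ^ 4) (nat \<bar>r\<bar>)" if "\<gamma> r \<noteq> 0" for r
    using that unfolding \<gamma>_def P_def by (intro rough_coprime_odd_primes) (auto split: if_splits)
  have fcb: "fc (b d n) j = (if int (d * n) dvd j \<and> odd (j div int (d * n))
     then ee (- (j div int (d * n))) (1 / 4) / (pi * of_int (j div int (d * n)) * \<i>)
       * complex_of_real (1 + sin (pi * of_int (j div int (d * n) * int d) / (2 * real u)) / s) else 0)"
    if dn: "0 < d" "0 < n" for d n j
  proof -
    define \<theta> where "\<theta> = real d / (4 * real u)"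
    have "fc (b d n) j = fc (\<lambda>x. complex_of_real (sqw (real (d * n) * x - 1 / 4))) j
      - \<i> / complex_of_real (2 * s) * (fc (\<lambda>x. complex_of_real (sqw (real (d * n) * x - (1 / 4 - \<theta>)))) j
        - fc (\<lambda>x. complex_of_real (sqw (real (d * n) * x - (1 / 4 + \<theta>)))) j)"
      unfolding b_def[abs_def] cosw_def sinw_def \<theta>_def[symmetric] of_real_diff
      by (subst fc_diff_bbm, (intro bbm_intros)+, subst fc_cmult, subst fc_diff_bbm, (intro bbm_intros)+, rule refl)
    also have "\<dots> = (if int (d * n) dvd j \<and> odd (j div int (d * n))
     then ee (- (j div int (d * n))) (1 / 4) / (pi * of_int (j div int (d * n)) * \<i>)
       * complex_of_real (1 + sin (pi * of_int (j div int (d * n) * int d) / (2 * real u)) / s) else 0)"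
    proof (cases "int (d * n) dvd j \<and> odd (j div int (d * n))")
      case True
      define r where "r = j div int (d * n)"
      define E where "E = ee (- r) (1 / 4) / (pi * of_int r * \<i>)"
      have d1: "ee (- r) (1 / 4 - \<theta>) / (pi * of_int r * \<i>) = E * ee r \<theta>"
        "ee (- r) (1 / 4 + \<theta>) / (pi * of_int r * \<i>) = E * ee (- r) \<theta>"
        by (simp_all add: E_def ee_diff_arg ee_add_arg)
      have d2: "ee r \<theta> - ee (- r) \<theta> = 2 * \<i> * complex_of_real (sin (pi * of_int (r * int d) / (2 * real u)))"
        by (simp add: ee_def complex_eq_iff \<theta>_def mult_ac)
      have "\<i> / complex_of_real (2 * s) * (E * ee r \<theta> - E * ee (- r) \<theta>)
        = - (E * complex_of_real (sin (pi * of_int (r * int d) / (2 * real u)) / s))"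
        unfolding right_diff_distrib[symmetric] d2 using s0 by (simp add: field_simps)
      then have step: "E - \<i> / complex_of_real (2 * s) * (E * ee r \<theta> - E * ee (- r) \<theta>)
        = E * complex_of_real (1 + sin (pi * of_int (r * int d) / (2 * real u)) / s)"
        by (simp only: of_real_add of_real_1 distrib_left mult_1_right diff_minus_eq_add)
      have cond: "int (d * n) dvd j" "odd r" using True by (auto simp: r_def)
      have f: "fc (\<lambda>x. complex_of_real (sqw (real (d * n) * x - \<phi>))) j = ee (- r) \<phi> / (pi * of_int r * \<i>)" for \<phi>
        using fc_sqw_dilate[of "d * n" \<phi> j] cond dn by (simp add: r_def del: of_nat_mult)
      show ?thesis
        unfolding f r_def[symmetric] d1 unfolding E_def[symmetric] step using cond by simp
    next
      case False
      have "fc (\<lambda>x. complex_of_real (sqw (real (d * n) * x - \<phi>))) j = 0" for \<phi>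
        using fc_sqw_dilate[of "d * n" \<phi> j] False dn by (auto simp del: of_nat_mult)
      then show ?thesis unfolding if_not_P[OF False] by simp
    qed
    finally show ?thesis .
  qed
  have fcS: "fc S j = (\<Sum>n | n \<in> A \<and> int n dvd j. \<gamma> (j div int n))" for j
  proof -
    have "fc S j = (\<Sum>X\<in>Pow P. c X * (\<Sum>n\<in>A. fc (b (\<Prod>X) n) j))"
      unfolding S_def[abs_def] using P(1) fin
      by (subst fc_sum_bbm) (auto intro!: bbm_intros bb sum.cong simp: fc_cmult fc_sum_bbm bb)
    also have "\<dots> = (\<Sum>n\<in>A. \<Sum>X\<in>Pow P. c X * fc (b (\<Prod>X) n) j)"
      unfolding sum_distrib_left by (rule sum.swap)
    also have "\<dots> = (\<Sum>n\<in>A. if int n dvd j then \<gamma> (j div int n) else 0)"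
    proof (rule sum.cong[OF refl])
      fix n assume "n \<in> A"
      then have n: "0 < n" by (rule A)
      show "(\<Sum>X\<in>Pow P. c X * fc (b (\<Prod>X) n) j) = (if int n dvd j then \<gamma> (j div int n) else 0)"
      proof (cases "int n dvd j")
        case False
        have "\<not> int (\<Prod>X * n) dvd j" for X using False by (metis dvd_mult_right of_nat_mult)
        then have "fc (b (\<Prod>X) n) j = 0" if "X \<in> Pow P" for X
          using fcb[of "\<Prod>X" n j] odd_prod[OF that] n by (auto simp: odd_pos)
        then show ?thesis using False by simp
      next
        case True
        then obtain r where r: "j = int n * r" by auto
        have summand: "c X * fc (b (\<Prod>X) n) j = (if \<Prod>X dvd nat \<bar>r\<bar> then complex_of_real ((-1) ^ card X) * (if odd r then \<gamma>0 r else 0) else 0)"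
          if X: "X \<in> Pow P" for X
        proof -
          define d where "d = \<Prod>X"
          have d: "odd d" "0 < d" using odd_prod[OF X] by (auto simp: d_def odd_pos)
          have dv: "int (d * n) dvd j \<longleftrightarrow> d dvd nat \<bar>r\<bar>"
            using n by (simp add: r dvd_nat_abs_iff mult.commute[of "int d"])
          show ?thesis
          proof (cases "d dvd nat \<bar>r\<bar>")
            case False
            then show ?thesis using fcb[OF d(2) n, of j] dv by (simp add: d_def)
          next
            case dr: True
            then obtain t where t: "r = int d * t" by (auto simp: dvd_nat_abs_iff)
            have jt: "j div int (d * n) = t" using n d by (simp add: r t)
            show ?thesis
            proof (cases "odd t")
              case False
              then show ?thesis using fcb[OF d(2) n, of j] dv dr jt by (simp add: d_def[symmetric] t)
            next
              case ot: True
              have e: "ee (- r) (1 / 4) = (-1) ^ (d div 2) * ee (- t) (1 / 4)"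
                using ee_quarter_mult[OF d(1) ot] by (simp add: t mult.commute)
              have sq: "(-1) ^ (d div 2) * (-1) ^ (d div 2) = (1::complex)"
                by (simp flip: power_mult_distrib)
              have t0: "t \<noteq> 0" using ot by auto
              have f1: "fc (b d n) j = ee (- t) (1 / 4) / (pi * of_int t * \<i>)
                * complex_of_real (1 + sin (pi * of_int r / (2 * real u)) / s)"
                using fcb[OF d(2) n, of j] dv dr jt ot by (simp add: t mult.commute)
              have f2: "(-1) ^ (d div 2) / of_nat d * (ee (- t) (1 / 4) / (pi * of_int t * \<i>))
                = ee (- r) (1 / 4) / (pi * of_int r * \<i>)"
                using d t0 unfolding e by (simp add: t field_simps)
              have "c X = complex_of_real ((-1) ^ card X) * ((-1) ^ (d div 2) / of_nat d)"
                unfolding c_def d_def[symmetric] by simp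
              then have "c X * fc (b d n) j = complex_of_real ((-1) ^ card X)
                * ((-1) ^ (d div 2) / of_nat d * (ee (- t) (1 / 4) / (pi * of_int t * \<i>))
                  * complex_of_real (1 + sin (pi * of_int r / (2 * real u)) / s))"
                by (simp only: f1 mult.assoc)
              then have "c X * fc (b d n) j = complex_of_real ((-1) ^ card X) * \<gamma>0 r"
                unfolding f2 \<gamma>0_def .
              then show ?thesis using dr ot d by (simp add: d_def[symmetric] t)
            qed
          qed
        qed
        have "(\<Sum>X\<in>Pow P. c X * fc (b (\<Prod>X) n) j)
          = (\<Sum>X\<in>Pow P. if \<Prod>X dvd nat \<bar>r\<bar> then complex_of_real ((-1) ^ card X) * (if odd r then \<gamma>0 r else 0) else 0)"
          by (rule sum.cong[OF refl summand])
        also have "\<dots> = (\<Sum>X | X \<in> Pow P \<and> \<Prod>X dvd nat \<bar>r\<bar>. complex_of_real ((-1) ^ card X) * (if odd r then \<gamma>0 r else 0))"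
          using P(1) by (intro sum.inter_filter[symmetric]) simp
        also have "\<dots> = complex_of_real (\<Sum>X | X \<in> Pow P \<and> \<Prod>X dvd nat \<bar>r\<bar>. (-1) ^ card X) * (if odd r then \<gamma>0 r else 0)"
          unfolding of_real_sum sum_distrib_right ..
        also have "(\<Sum>X | X \<in> Pow P \<and> \<Prod>X dvd nat \<bar>r\<bar>. (-1::real) ^ card X) = (if \<exists>p\<in>P. p dvd nat \<bar>r\<bar> then 0 else 1)"
          by (rule sieve_moebius[OF P])
        also have "complex_of_real (if \<exists>p\<in>P. p dvd nat \<bar>r\<bar> then 0 else 1) * (if odd r then \<gamma>0 r else 0) = \<gamma> r"
          by (simp add: \<gamma>_def)
        finally show ?thesis using True n by (simp add: r)
      qed
    qed
    also have "\<dots> = (\<Sum>n | n \<in> A \<and> int n dvd j. \<gamma> (j div int n))"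
      by (rule sum.inter_filter[OF fin, symmetric])
    finally show ?thesis .
  qed
  have L: "real J / (768 * pi) \<le> integral {0..1} (\<lambda>x. norm (S x))"
  proof (rule l1_lower_bound[OF fin A J q(1,2) _ q(4) _ bS \<gamma>1 \<gamma>m1 \<gamma>K \<gamma>r fcS])
    show "84 * pi * ((1 + 1 / s) / pi) \<le> real q" using q(3) by simp
    show "0 \<le> (1 + 1 / s) / pi" using s0 by simp
  qed
  \<comment> \<open>The bound does not depend on \<open>d\<close>, so the weights
    \<open>1 / d\<close> can afterwards be summed by \<open>sieve_weight\<close>.\<close>
  have brk: "integral {0..1} (\<lambda>x. norm (\<Sum>n\<in>A. b d n x)) \<le> (2 * real u + 2 / s) * \<tau>" if d: "odd d" for d
  proof -
    have d0: "0 < d" using d by (rule odd_pos)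
    have "integral {0..1} (\<lambda>x. norm (\<Sum>n\<in>A. b d n x))
      \<le> integral {0..1} (\<lambda>x. \<bar>\<Sum>n\<in>A. cosw (real (d * n) * x)\<bar> + 1 / (2 * s) * \<bar>\<Sum>n\<in>A. sinw u d (real (d * n) * x)\<bar>)"
    proof (rule Henstock_Kurzweil_Integration.integral_le)
      fix x
      have "(\<Sum>n\<in>A. b d n x) = complex_of_real (\<Sum>n\<in>A. cosw (real (d * n) * x))
        - \<i> / complex_of_real (2 * s) * complex_of_real (\<Sum>n\<in>A. sinw u d (real (d * n) * x))"
        by (simp only: b_def sum_subtractf sum_distrib_left of_real_sum)
      also have "norm \<dots> \<le> \<bar>\<Sum>n\<in>A. cosw (real (d * n) * x)\<bar> + 1 / (2 * s) * \<bar>\<Sum>n\<in>A. sinw u d (real (d * n) * x)\<bar>"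
        by (rule order_trans[OF norm_triangle_ineq4]) (use s0 in \<open>simp add: norm_mult norm_divide del: of_real_sum of_real_mult\<close>)
      finally show "norm (\<Sum>n\<in>A. b d n x) \<le> \<dots>" .
    qed (intro bbm_integrable bbm_intros bb bcos bsin)+
    also have "\<dots> = integral {0..1} (\<lambda>x. \<bar>\<Sum>n\<in>A. cosw (real (d * n) * x)\<bar>)
        + integral {0..1} (\<lambda>x. 1 / (2 * s) * \<bar>\<Sum>n\<in>A. sinw u d (real (d * n) * x)\<bar>)"
      by (intro Henstock_Kurzweil_Integration.integral_add bbm_integrable bbm_intros bcos bsin)
    also have "\<dots> = integral {0..1} (\<lambda>x. \<bar>\<Sum>n\<in>A. cosw (real (d * n) * x)\<bar>)
        + 1 / (2 * s) * integral {0..1} (\<lambda>x. \<bar>\<Sum>n\<in>A. sinw u d (real (d * n) * x)\<bar>)" by simp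
    also have "\<dots> \<le> 2 * real u * \<tau> + 1 / (2 * s) * (4 * \<tau>)"
      using s0 by (intro add_mono mult_left_mono integral_abs_cosw integral_abs_sinw d d0) auto
    finally show ?thesis by (simp add: algebra_simps)
  qed
  have "integral {0..1} (\<lambda>x. norm (S x)) \<le> integral {0..1} (\<lambda>x. \<Sum>X\<in>Pow P. 1 / real (\<Prod>X) * norm (\<Sum>n\<in>A. b (\<Prod>X) n x))"
  proof (rule Henstock_Kurzweil_Integration.integral_le)
    fix x
    have "norm (S x) \<le> (\<Sum>X\<in>Pow P. norm (c X * (\<Sum>n\<in>A. b (\<Prod>X) n x)))" unfolding S_def by (rule norm_sum)
    also have "\<dots> = (\<Sum>X\<in>Pow P. 1 / real (\<Prod>X) * norm (\<Sum>n\<in>A. b (\<Prod>X) n x))"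
      by (rule sum.cong[OF refl])
        (simp add: c_def norm_mult norm_divide norm_power abs_mult power_abs del: of_nat_prod)
    finally show "norm (S x) \<le> (\<Sum>X\<in>Pow P. 1 / real (\<Prod>X) * norm (\<Sum>n\<in>A. b (\<Prod>X) n x))" .
  qed (intro bbm_integrable bbm_intros bS bb)+
  also have "\<dots> = (\<Sum>X\<in>Pow P. 1 / real (\<Prod>X) * integral {0..1} (\<lambda>x. norm (\<Sum>n\<in>A. b (\<Prod>X) n x)))"
  proof -
    have "(\<lambda>x. 1 / real (\<Prod>X) * norm (\<Sum>n\<in>A. b (\<Prod>X) n x)) integrable_on {0..1}" for X
      by (intro bbm_integrable bbm_intros bb)
    then show ?thesis
      using P(1) by (subst Henstock_Kurzweil_Integration.integral_sum) (simp_all del: of_nat_prod)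
  qed
  also have "\<dots> \<le> (\<Sum>X\<in>Pow P. 1 / real (\<Prod>X) * ((2 * real u + 2 / s) * \<tau>))"
    by (intro sum_mono mult_left_mono brk odd_prod) (simp_all add: prod_nonneg)
  also have "\<dots> = (\<Sum>X\<in>Pow P. 1 / real (\<Prod>X)) * ((2 * real u + 2 / s) * \<tau>)"
    unfolding sum_distrib_right ..
  also have "\<dots> \<le> (2 + 8 * ln (real (q ^ 4))) * ((2 * real u + 2 / s) * \<tau>)"
  proof (rule mult_right_mono)
    show "(\<Sum>X\<in>Pow P. 1 / real (\<Prod>X)) \<le> 2 + 8 * ln (real (q ^ 4))"
      unfolding P_def using q(1) self_le_power[of q 4] by (intro sieve_weight) simp
    \<comment> \<open>The sign of \<open>\<tau>\<close> is not given in advance; it is read off from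
      \<open>brk\<close>, whose left side is the integral of a norm.\<close>
    show "0 \<le> (2 * real u + 2 / s) * \<tau>"
      by (rule order_trans[OF _ brk[of 1]]) (auto intro!: integral_nonneg bbm_integrable bbm_intros bb)
  qed
  finally show ?thesis using L by linarith
qed

end

section \<open>Sum-free subsets\<close>

theorem large_discrepancy:
  fixes u :: nat
  assumes u: "even u" "0 < u"
  shows "\<exists>\<kappa>>0. \<forall>A. finite A \<and> (\<forall>n\<in>A. 0 < n) \<and> 3 \<le> card A \<longrightarrow>
    (\<exists>v c y. odd v \<and> v < u \<and> (c = 1 / 4 \<or> c = 3 / 4) \<and>
      \<kappa> * (ln (real (card A)) / ln (ln (real (card A)))) \<le> disc A u v c y)"
proof -
  obtain h where h: "u = 2 * h" "0 < h" using u by auto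
  define s where "s = sin (pi / (2 * real u))"
  have s0: "0 < s" unfolding s_def using h by (intro sin_gt_zero) (auto simp: field_simps)
  define Q where "Q = nat \<lceil>84 * (1 + 1 / s)\<rceil>"
  have Q: "84 * (1 + 1 / s) \<le> real Q" unfolding Q_def by linarith
  define W where "W = 2 * real u + 2 / s"
  have W: "0 < W" using s0 u by (simp add: W_def add_pos_pos)
  have ln3: "1 < ln (3::real)"
  proof -
    have "ln (exp 1) < ln (3::real)" using e_less_272 by (subst ln_less_cancel_iff) auto
    then show ?thesis by simp
  qed
  \<comment> \<open>Chosen so that the sieve weight is at most \<open>C * ln (ln N)\<close> for
    every \<open>N \<ge> 3\<close>: additive constants are absorbed because
    \<open>ln (ln N) \<ge> ln (ln 3) > 0\<close>.\<close>
  define C where "C = (2 + 32 * ln (real Q + 4)) / ln (ln 3) + 32"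
  have C: "0 < C" using ln3 by (auto simp: C_def intro!: add_nonneg_pos divide_nonneg_pos)
  \<comment> \<open>\<open>4608 = 6 * 768\<close>, so that small discrepancies would force
    \<open>J \<le> ln N / 6\<close>, against \<open>ln N \<le> 3 * J\<close>.\<close>
  define \<kappa> where "\<kappa> = 1 / (4608 * pi * W * C)"
  have \<kappa>: "0 < \<kappa>" using W C by (simp add: \<kappa>_def)
  have "\<exists>v c y. odd v \<and> v < u \<and> (c = 1 / 4 \<or> c = 3 / 4) \<and>
      \<kappa> * (ln (real (card A)) / ln (ln (real (card A)))) \<le> disc A u v c y"
    if fin: "finite A" and pos: "\<forall>n\<in>A. 0 < n" and card3: "3 \<le> card A" for A
  proof (rule ccontr)
    assume contra: "\<not> ?thesis"
    define N where "N = card A"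
    define \<tau> where "\<tau> = \<kappa> * (ln (real N) / ln (ln (real N)))"
    have N: "3 \<le> N" using card3 by (simp add: N_def)
    have lN: "ln 3 \<le> ln (real N)" "1 \<le> ln (real N)" using N ln3 by (simp_all add: order_trans[of 1 "ln 3"])
    have llN: "ln (ln 3) \<le> ln (ln (real N))" "0 < ln (ln (3::real))" using lN ln3 by simp_all
    interpret small_disc A u h \<tau>
    proof
      show "disc A u v c y \<le> \<tau>" if "odd v" "v < u" "c = 1 / 4 \<or> c = 3 / 4" for v c y
      proof (rule ccontr)
        assume "\<not> disc A u v c y \<le> \<tau>"
        then have "\<kappa> * (ln (real (card A)) / ln (ln (real (card A)))) \<le> disc A u v c y" by (simp add: \<tau>_def N_def)
        then show False using contra that by blast
      qed
    qed (use pos h in auto)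
    \<comment> \<open>The largest number of blocks of sizes \<open>4 ^ k\<close> that fit into
      \<open>A\<close>.\<close>
    obtain J where J: "4 ^ J \<le> 3 * N + 1" "3 * N + 1 < 4 ^ (J + 1)"
      using ex_power_ivl1[of 4 "3 * N + 1"] by auto
    have J1: "1 \<le> J" using J(2) N by (cases J) auto
    obtain r where r: "2 ^ r \<le> N" "N < 2 ^ (r + 1)"
      using ex_power_ivl1[of 2 N] N by auto
    \<comment> \<open>\<open>r\<close> is the integer part of the binary logarithm of
      \<open>N\<close>. Adding \<open>Q\<close> meets the lower bound that the clutter imposes on
      \<open>q\<close> and keeps \<open>ln q\<close> at most a constant above
      \<open>ln (ln N)\<close>.\<close>
    define q where "q = Q + 2 + r"
    have q2: "2 \<le> q" by (simp add: q_def)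
    have Nq: "N \<le> 2 ^ q"
    proof -
      have "(2::nat) ^ (r + 1) \<le> 2 ^ q" by (intro power_increasing) (auto simp: q_def)
      then show ?thesis using r(2) by linarith
    qed
    have Jq: "2 * J \<le> q ^ 4"
    proof -
      have "(2::nat) ^ (2 * J) = 4 ^ J" by (simp add: power_mult)
      also have "\<dots> < 2 ^ (r + 3)" using J(1) r(2) N by (simp add: power_add)
      finally have "2 * J < r + 3" by (rule power_less_imp_less_exp[rotated]) simp
      then have "2 * J \<le> q" by (simp add: q_def)
      also have "q \<le> q ^ 4" using q2 by (intro self_le_power) auto
      finally show ?thesis .
    qed
    have qQ: "84 * (1 + 1 / s) \<le> real q" using Q by (simp add: q_def)
    have "real r \<le> 2 * ln (real N)"
    proof -
      have "ln (real (2 ^ r)) \<le> ln (real N)" using r(1) N by (subst ln_le_cancel_iff) (auto simp del: of_nat_power)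
      then have "real r * ln 2 \<le> ln (real N)" by (simp add: ln_realpow)
      moreover have "real r * (1 / 2) \<le> real r * ln 2" using ln2_ge_two_thirds by (intro mult_left_mono) auto
      ultimately show ?thesis by simp
    qed
    then have "real q \<le> (real Q + 2) * 1 + 2 * ln (real N)" by (simp add: q_def)
    also have "\<dots> \<le> (real Q + 2) * ln (real N) + 2 * ln (real N)" using lN by (intro add_right_mono mult_left_mono) auto
    also have "\<dots> = (real Q + 4) * ln (real N)" by (simp add: algebra_simps)
    finally have "ln (real q) \<le> ln ((real Q + 4) * ln (real N))" using q2 lN by (subst ln_le_cancel_iff) auto
    also have "\<dots> = ln (real Q + 4) + ln (ln (real N))" using lN by (intro ln_mult_pos) auto
    finally have lq: "ln (real q) \<le> ln (real Q + 4) + ln (ln (real N))" .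
    have "2 + 8 * ln (real (q ^ 4)) \<le> (2 + 32 * ln (real Q + 4)) * 1 + 32 * ln (ln (real N))"
      using lq q2 by (simp add: ln_realpow)
    also have "\<dots> \<le> (2 + 32 * ln (real Q + 4)) * (ln (ln (real N)) / ln (ln 3)) + 32 * ln (ln (real N))"
      using llN by (intro add_right_mono mult_left_mono) (auto simp: field_simps)
    also have "\<dots> = C * ln (ln (real N))" by (simp add: C_def algebra_simps add_divide_distrib)
    finally have lnq: "2 + 8 * ln (real (q ^ 4)) \<le> C * ln (ln (real N))" .
    have \<tau>0: "0 \<le> \<tau>" using \<kappa> lN llN by (simp add: \<tau>_def)
    have "real J / (768 * pi) \<le> (2 + 8 * ln (real (q ^ 4))) * (W * \<tau>)"
      unfolding W_def by (rule discrepancy_bound[OF fin J1 _ s_def q2 _ qQ Jq]) (use J(1) Nq in \<open>simp_all add: N_def\<close>)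
    also have "\<dots> \<le> C * ln (ln (real N)) * (W * \<tau>)"
      using W \<tau>0 by (intro mult_right_mono lnq) auto
    also have "\<dots> = ln (real N) / (4608 * pi)"
      using W C less_le_trans[OF llN(2,1)] by (simp add: \<tau>_def \<kappa>_def field_simps)
    finally have "real J \<le> ln (real N) / 6" by (simp add: field_simps)
    moreover have "ln (real N) \<le> 3 * real J"
    proof -
      have "N \<le> 4 ^ (J + 1)" using J(2) by simp
      also have "\<dots> \<le> 4 ^ (2 * J)" using J1 by (intro power_increasing) auto
      also have "\<dots> = (2::nat) ^ (4 * J)" by (simp add: power_mult)
      finally have "ln (real N) \<le> ln (real (2 ^ (4 * J)))" using N by (subst ln_le_cancel_iff) (auto simp del: of_nat_power)
      also have "\<dots> = real J * (4 * ln 2)" by (simp add: ln_realpow)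
      also have "\<dots> \<le> real J * 3" using ln2_le_25_over_36 by (intro mult_left_mono) auto
      finally show ?thesis by simp
    qed
    ultimately show False using lN by simp
  qed
  then show ?thesis using \<kappa> by blast
qed

text \<open>The arc has length \<open>1 / (k + l)\<close> and centre
  \<open>(2 * j + 1) / (2 * (k - l))\<close>. For points in it the sum of \<open>k\<close>
  fractional parts minus the sum of \<open>l\<close> lies strictly between \<open>j\<close> and
  \<open>j + 1\<close>, while equal sums of elements would make this difference an integer.\<close>

lemma sum_free_arc:
  fixes x \<alpha> :: real and j :: int
  assumes kl: "0 < l" "l < k" and \<alpha>: "\<alpha> = (2 * of_int j + 1) / (2 * (real k - real l)) - 1 / (2 * (real k + real l))"
    and S: "\<And>n. n \<in> S \<Longrightarrow> \<alpha> \<le> frac (real n * x) \<and> frac (real n * x) < \<alpha> + 1 / (real k + real l)"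
  shows "sum_free k l S"
  unfolding sum_free_def
proof (intro allI impI notI)
  fix a b :: "nat \<Rightarrow> nat"
  assume a: "\<forall>i<k. a i \<in> S" and b: "\<forall>i<l. b i \<in> S" and eq: "(\<Sum>i<k. a i) = (\<Sum>i<l. b i)"
  define f where "f n = frac (real n * x)" for n :: nat
  define w where "w = 1 / (real k + real l)"
  have w: "w * (real k + real l) = 1" using kl by (simp add: w_def)
  have "(\<Sum>i<k. f (a i)) - (\<Sum>i<l. f (b i)) = of_int ((\<Sum>i<l. \<lfloor>real (b i) * x\<rfloor>) - (\<Sum>i<k. \<lfloor>real (a i) * x\<rfloor>))"
  proof -
    have "(\<Sum>i<k. real (a i) * x) = (\<Sum>i<l. real (b i) * x)"
      unfolding sum_distrib_right[symmetric] of_nat_sum[symmetric] eq ..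
    then show ?thesis by (simp add: f_def frac_def sum_subtractf)
  qed
  then obtain z :: int where z: "(\<Sum>i<k. f (a i)) - (\<Sum>i<l. f (b i)) = of_int z" by blast
  have a1: "real k * \<alpha> \<le> (\<Sum>i<k. f (a i))"
    using sum_bounded_below[of "{..<k}" \<alpha> "\<lambda>i. f (a i)"] a S by (simp add: f_def)
  have a2: "(\<Sum>i<k. f (a i)) < real k * (\<alpha> + w)"
    using sum_bounded_above_strict[of "{..<k}" "\<lambda>i. f (a i)" "\<alpha> + w"] a S kl by (simp add: f_def w_def)
  have b1: "real l * \<alpha> \<le> (\<Sum>i<l. f (b i))"
    using sum_bounded_below[of "{..<l}" \<alpha> "\<lambda>i. f (b i)"] b S by (simp add: f_def)
  have b2: "(\<Sum>i<l. f (b i)) < real l * (\<alpha> + w)"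
    using sum_bounded_above_strict[of "{..<l}" "\<lambda>i. f (b i)" "\<alpha> + w"] b S kl by (simp add: f_def w_def)
  have \<alpha>': "(real k - real l) * \<alpha> = of_int j + 1 / 2 - (real k - real l) * w / 2"
  proof -
    have "p * ((2 * i + 1) / (2 * p)) = i + 1 / 2" if "p \<noteq> 0" for p i :: real using that by (simp add: field_simps)
    from this[of "real k - real l" "of_int j"] show ?thesis using kl by (simp add: \<alpha> w_def right_diff_distrib)
  qed
  have w': "real k * w + real l * w = 1" using w by (simp add: algebra_simps)
  have "of_int z < real k * (\<alpha> + w) - real l * \<alpha>" using z a2 b1 by linarith
  also have "\<dots> = of_int j + 1"
    using \<alpha>' w' unfolding left_diff_distrib distrib_left by (simp add: field_simps)
  finally have "z < j + 1" by linarith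
  moreover have "of_int j < (of_int z :: real)"
  proof -
    have "of_int j = real k * \<alpha> - real l * (\<alpha> + w)"
      using \<alpha>' w' unfolding left_diff_distrib distrib_left by (simp add: field_simps)
    also have "\<dots> < of_int z" using z a1 b2 by linarith
    finally show ?thesis .
  qed
  ultimately show False by simp
qed

text \<open>The preimage of an arc under multiplication by \<open>w\<close> consists of
  \<open>w\<close> arcs; only the index \<open>i0\<close>, the integer part of
  \<open>w * frac t\<close>, can contribute.\<close>

lemma arc_split:
  assumes w: "0 < (w::nat)" and ab: "0 \<le> a" "b \<le> 1"
  shows "circ_arc a b (real w * t) = (\<Sum>i<w. circ_arc ((a + real i) / real w) ((b + real i) / real w) t)"
proof -
  define z where "z = frac t"
  define i0 where "i0 = nat \<lfloor>real w * z\<rfloor>"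
  have z: "0 \<le> z" "z < 1" by (auto simp: z_def frac_lt_1)
  have fl: "real i0 \<le> real w * z" "real w * z < real i0 + 1"
    using z by (auto simp: i0_def)
  have "real w * z < real w * 1" using w z by (intro mult_strict_left_mono) auto
  then have i0: "i0 < w" using fl by linarith
  have f: "frac (real w * t) = real w * z - real i0"
  proof -
    have "real w * t - (real w * z - real i0) = of_int (int w * \<lfloor>t\<rfloor> + int i0)"
      by (simp add: z_def frac_def algebra_simps)
    then have "real w * t - (real w * z - real i0) \<in> \<int>" by (metis Ints_of_int)
    then show ?thesis using fl by (subst frac_unique_iff) auto
  qed
  have "(\<Sum>i<w. circ_arc ((a + real i) / real w) ((b + real i) / real w) t) = (\<Sum>i<w. if i = i0 then circ_arc a b (real w * t) else 0)"
  proof (rule sum.cong[OF refl])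
    fix i
    have e: "(a + real i) / real w \<le> z \<longleftrightarrow> a + real i \<le> real w * z" "z < (b + real i) / real w \<longleftrightarrow> real w * z < b + real i"
      using w by (simp_all add: field_simps)
    have "a + real i \<le> real w * z \<and> real w * z < b + real i \<longleftrightarrow> i = i0 \<and> a \<le> frac (real w * t) \<and> frac (real w * t) < b"
    proof
      assume *: "a + real i \<le> real w * z \<and> real w * z < b + real i"
      then have "real i < real i0 + 1" "real i0 < real i + 1" using fl ab by linarith+
      then have "i = i0" by linarith
      then show "i = i0 \<and> a \<le> frac (real w * t) \<and> frac (real w * t) < b" using * f by simp
    qed (use f in auto)
    then show "circ_arc ((a + real i) / real w) ((b + real i) / real w) t = (if i = i0 then circ_arc a b (real w * t) else 0)"
      unfolding circ_arc_def z_def[symmetric] e by auto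
  qed
  then show ?thesis using i0 by simp
qed

lemma card_le_max_sum_free:
  assumes "finite A" "S \<subseteq> A" "sum_free k l S"
  shows "card S \<le> max_sum_free k l A"
proof -
  have "{card S | S. S \<subseteq> A \<and> sum_free k l S} \<subseteq> {..card A}" using assms(1) by (auto intro: card_mono)
  then have "finite {card S | S. S \<subseteq> A \<and> sum_free k l S}" by (rule finite_subset) simp
  then show ?thesis unfolding max_sum_free_def using assms by (intro Max_ge) auto
qed

text \<open>An average over the \<open>w = (k - l) / 2\<close> sum-free sets \<open>S i\<close>,
  which together collect the \<open>n\<close> with \<open>n * y\<close> in the arc around
  \<open>c\<close>. That \<open>k - l\<close> is even follows from
  \<open>(k - l) * u = (k + l) * v\<close> with \<open>u\<close> even and \<open>v\<close>
  odd.\<close>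

lemma max_sum_free_ge_disc:
  assumes A: "finite A" and u: "even u" "0 < u" and v: "odd v" and kl: "0 < l" "l < k" "(k - l) * u = (k + l) * v"
    and c: "c = 1 / 4 \<or> c = 3 / 4"
  shows "real (max_sum_free k l A) \<ge> real (card A) / (real k + real l) + 2 * disc A u v c y / (real k - real l)"
proof -
  have "even (k + l)"
  proof -
    have "even ((k + l) * v)" using u kl(3) by (metis dvd_mult)
    then show ?thesis using v by simp
  qed
  then have "even (k - l)" using kl by auto
  then obtain w where w: "k - l = 2 * w" by (rule evenE)
  then have w0: "0 < w" "real k - real l = 2 * real w" using kl by (auto simp flip: of_nat_diff)
  have kl': "(real k - real l) * real u = (real k + real l) * real v"
  proof -
    have "real ((k - l) * u) = real ((k + l) * v)" by (simp only: kl(3))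
    then show ?thesis using kl(2) by (simp add: of_nat_diff)
  qed
  define \<theta> where "\<theta> = real v / (4 * real u)"
  have \<theta>: "\<theta> = real w / (2 * (real k + real l))"
    using kl' kl u w0 by (simp add: \<theta>_def field_simps)
  have \<theta>w: "\<theta> / real w = 1 / (2 * (real k + real l))" using w0 by (simp add: \<theta>)
  then have \<theta>w2: "2 * (\<theta> / real w) = 1 / (real k + real l)" using kl by (simp add: field_simps)
  have vu: "v < u"
  proof (rule ccontr)
    assume "\<not> v < u"
    then have "(k - l) * u < (k + l) * v" using kl u by (intro mult_less_le_imp_less) auto
    then show False using kl by simp
  qed
  have \<theta>': "0 \<le> \<theta>" "\<theta> \<le> 1 / 4" using vu by (auto simp: \<theta>_def field_simps)
  define x where "x = y / real w"
  define S where "S i = {n \<in> A. (c - \<theta> + real i) / real w \<le> frac (real n * x) \<and> frac (real n * x) < (c + \<theta> + real i) / real w}" for i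
  have Sle: "real (card (S i)) \<le> real (max_sum_free k l A)" for i
  proof -
    \<comment> \<open>The centre \<open>(c + i) / w\<close> equals
      \<open>(2 * j + 1) / (2 * (k - l))\<close> for \<open>j = 2 * i\<close> or
      \<open>j = 2 * i + 1\<close>, according to whether \<open>c\<close> is \<open>1 / 4\<close> or
      \<open>3 / 4\<close>.\<close>
    obtain j :: int where j: "4 * (c + real i) = 2 * of_int j + 1"
    proof (cases "c = 1 / 4")
      case True
      then show ?thesis by (intro that[of "2 * int i"]) simp
    next
      case False
      then show ?thesis using c by (intro that[of "2 * int i + 1"]) simp
    qed
    have lo: "(c - \<theta> + real i) / real w = (2 * of_int j + 1) / (2 * (real k - real l)) - 1 / (2 * (real k + real l))"
      unfolding \<theta>w[symmetric] w0(2) j[symmetric] using w0(1) by (simp add: field_simps)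
    have hi: "(c + \<theta> + real i) / real w = (c - \<theta> + real i) / real w + 1 / (real k + real l)"
    proof -
      have "(c + \<theta> + real i) / real w = (c - \<theta> + real i) / real w + 2 * (\<theta> / real w)"
        using w0(1) by (simp add: field_simps)
      also note \<theta>w2
      finally show ?thesis .
    qed
    have "sum_free k l (S i)"
      by (rule sum_free_arc[OF kl(1,2) lo]) (auto simp: S_def hi)
    then have "card (S i) \<le> max_sum_free k l A" using A by (intro card_le_max_sum_free) (auto simp: S_def)
    then show ?thesis by simp
  qed
  have cS: "real (card (S i)) = (\<Sum>n\<in>A. circ_arc ((c - \<theta> + real i) / real w) ((c + \<theta> + real i) / real w) (real n * x))" for i
    using A by (simp add: S_def circ_arc_def sum.If_cases Int_def)
  have "(\<Sum>n\<in>A. circ_arc (c - \<theta>) (c + \<theta>) (real n * y)) = (\<Sum>n\<in>A. \<Sum>i<w. circ_arc ((c - \<theta> + real i) / real w) ((c + \<theta> + real i) / real w) (real n * x))"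
  proof (rule sum.cong[OF refl])
    fix n
    have "real n * y = real w * (real n * x)" using w0 by (simp add: x_def)
    then show "circ_arc (c - \<theta>) (c + \<theta>) (real n * y) = (\<Sum>i<w. circ_arc ((c - \<theta> + real i) / real w) ((c + \<theta> + real i) / real w) (real n * x))"
      using c \<theta>' w0 by (simp only:) (intro arc_split; auto)
  qed
  also have "\<dots> = (\<Sum>i<w. real (card (S i)))" unfolding cS by (rule sum.swap)
  also have "\<dots> \<le> real w * real (max_sum_free k l A)"
    using sum_bounded_above[of "{..<w}" "\<lambda>i. real (card (S i))"] Sle by simp
  finally have "real (card A) * (2 * \<theta>) + disc A u v c y \<le> real w * real (max_sum_free k l A)"
    by (simp add: disc_def \<theta>_def sum_subtractf)
  then have "(real (card A) * (2 * \<theta>) + disc A u v c y) / real w \<le> real (max_sum_free k l A)"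
    using w0 by (simp add: field_simps)
  moreover have "(real (card A) * (2 * \<theta>) + disc A u v c y) / real w = real (card A) / (real k + real l) + 2 * disc A u v c y / (real k - real l)"
  proof -
    have "(real (card A) * (2 * \<theta>) + disc A u v c y) / real w = real (card A) * (2 * (\<theta> / real w)) + disc A u v c y / real w"
      by (simp add: add_divide_distrib)
    then show ?thesis unfolding \<theta>w2 w0(2) by simp
  qed
  ultimately show ?thesis by simp
qed

lemma power_2_times_odd: "0 < (n::nat) \<Longrightarrow> \<exists>a m. odd m \<and> n = 2 ^ a * m"
proof (induction n rule: less_induct)
  case (less n)
  show ?case
  proof (cases "even n")
    case True
    then obtain n' where n': "n = 2 * n'" by auto
    then obtain a m where "odd m" "n' = 2 ^ a * m" using less.IH[of n'] less.prems by auto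
    then show ?thesis using n' by (intro exI[of _ "Suc a"] exI[of _ m]) simp
  next
    case False
    then show ?thesis by (intro exI[of _ 0] exI[of _ n]) simp
  qed
qed

theorem theorem1p1:
  "\<exists>c :: nat \<Rightarrow> nat \<Rightarrow> real.
     (\<forall>k l. 0 < l \<and> l < k \<longrightarrow> 0 < c k l) \<and>
     (\<forall>u::nat. 0 < u \<and> even u \<longrightarrow>
       (\<forall>N::nat. 3 \<le> N \<longrightarrow>
         (\<forall>A::nat set. finite A \<and> card A = N \<and> (\<forall>a\<in>A. 0 < a) \<longrightarrow>
           (\<exists>v::nat. odd v \<and> 1 \<le> v \<and> v < u \<and>
             (\<forall>l::nat. \<forall>k::nat. 0 < l \<and> real k = (real u + real v) * real l / (real u - real v) \<longrightarrow>
                real (max_sum_free k l A)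
                  \<ge> real N / (real k + real l) + c k l * (ln (real N) / ln (ln (real N))))))))"
proof -
  have "\<forall>u. \<exists>\<kappa>. even u \<and> 0 < u \<longrightarrow> 0 < \<kappa> \<and> (\<forall>A. finite A \<and> (\<forall>n\<in>A. 0 < n) \<and> 3 \<le> card A \<longrightarrow>
    (\<exists>v c y. odd v \<and> v < u \<and> (c = 1 / 4 \<or> c = 3 / 4) \<and>
      \<kappa> * (ln (real (card A)) / ln (ln (real (card A)))) \<le> disc A u v c y))"
    using large_discrepancy by blast
  then obtain \<kappa> :: "nat \<Rightarrow> real" where \<kappa>: "\<And>u. even u \<Longrightarrow> 0 < u \<Longrightarrow> 0 < \<kappa> u"
    "\<And>u A. even u \<Longrightarrow> 0 < u \<Longrightarrow> finite A \<Longrightarrow> \<forall>n\<in>A. 0 < n \<Longrightarrow> 3 \<le> card A \<Longrightarrow>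
      \<exists>v c y. odd v \<and> v < u \<and> (c = 1 / 4 \<or> c = 3 / 4) \<and>
        \<kappa> u * (ln (real (card A)) / ln (ln (real (card A)))) \<le> disc A u v c y"
    by metis
  define U where "U m = {u. even u \<and> 0 < u \<and> u \<le> m}" for m :: nat
  have finU: "finite (U m)" for m by (rule finite_subset[of _ "{..m}"]) (auto simp: U_def)
  \<comment> \<open>The constant must not depend on \<open>u\<close>. The power of two
    \<open>u'\<close> extracted from \<open>u\<close> below is even and at most
    \<open>k + l\<close>, so the least \<open>\<kappa>\<close> over all even numbers up to
    \<open>k + l\<close> serves for every \<open>u\<close>.\<close>
  define c where "c k l = Min (\<kappa> ` U (k + l)) / (real k - real l)" for k l
  show ?thesis
  proof (intro exI[of _ c] conjI allI impI; (elim conjE)?)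
    fix k l :: nat assume kl: "0 < l" "l < k"
    then have "2 \<in> U (k + l)" by (auto simp: U_def)
    then have "U (k + l) \<noteq> {}" by blast
    then have "0 < Min (\<kappa> ` U (k + l))" using finU by (subst Min_gr_iff) (auto simp: U_def \<kappa>(1))
    then show "0 < c k l" using kl by (simp add: c_def)
  next
    fix u N :: nat and A :: "nat set"
    assume u: "0 < u" "even u" and N: "3 \<le> N" and A: "finite A" "card A = N" "\<forall>a\<in>A. 0 < a"
    obtain a m where am: "odd m" "u = 2 ^ a * m" using power_2_times_odd[OF u(1)] by blast
    define u' :: nat where "u' = 2 ^ a"
    have u': "even u'" "0 < u'" using am u by (auto simp: u'_def)
    have m0: "0 < m" using am(1) by (rule odd_pos)
    define L where "L = ln (real N) / ln (ln (real N))"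
    have L: "0 \<le> L"
    proof -
      have "exp 1 \<le> real N" using e_less_272 N by linarith
      then have "1 \<le> ln (real N)" using N by (subst ln_ge_iff) auto
      then show ?thesis by (simp add: L_def)
    qed
    \<comment> \<open>\<open>v'\<close> is fixed by \<open>A\<close> and \<open>u'\<close> before
      \<open>k\<close> and \<open>l\<close> are given. The witness \<open>m * v'\<close> has the
      same ratio to \<open>u\<close> as \<open>v'\<close> to \<open>u'\<close>, so it leads to the
      same pairs \<open>k\<close>, \<open>l\<close>.\<close>
    obtain v' b y where v': "odd v'" "v' < u'" "b = 1 / 4 \<or> b = 3 / 4" "\<kappa> u' * L \<le> disc A u' v' b y"
      using \<kappa>(2)[OF u' A(1,3)] A(2) N unfolding L_def by auto
    have v0: "0 < v'" using v'(1) by (rule odd_pos)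
    show "\<exists>v. odd v \<and> 1 \<le> v \<and> v < u \<and> (\<forall>l k. 0 < l \<and> real k = (real u + real v) * real l / (real u - real v) \<longrightarrow>
      real N / (real k + real l) + c k l * (ln (real N) / ln (ln (real N))) \<le> real (max_sum_free k l A))"
    proof (intro exI[of _ "m * v'"] conjI allI impI; (elim conjE)?)
      show "odd (m * v')" "1 \<le> m * v'" "m * v' < u" using v' v0 am m0 by (simp_all add: u'_def mult.commute)
      fix l k :: nat
      assume l: "0 < l" and k: "real k = (real u + real (m * v')) * real l / (real u - real (m * v'))"
      have "real k = (real m * (real u' + real v') * real l) / (real m * (real u' - real v'))"
        unfolding k by (simp add: am(2) u'_def algebra_simps)
      also have "\<dots> = (real u' + real v') * real l / (real u' - real v')" using m0 by simp
      finally have "real k * (real u' - real v') = (real u' + real v') * real l" using v'(2) by (simp add: field_simps)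
      then have kr: "(real k - real l) * real u' = (real k + real l) * real v'" by (simp add: algebra_simps)
      have "0 < (real k - real l) * real u'" unfolding kr using l v0 by simp
      then have lk: "l < k" by (simp add: zero_less_mult_iff)
      then have "real ((k - l) * u') = real ((k + l) * v')" using kr by (simp add: of_nat_diff)
      then have kn: "(k - l) * u' = (k + l) * v'" by (simp only: of_nat_eq_iff)
      have "u' dvd (k + l) * v'" unfolding kn[symmetric] by simp
      moreover have "coprime u' v'" using v'(1) by (simp add: u'_def)
      ultimately have "u' dvd k + l" by (simp add: coprime_dvd_mult_left_iff)
      then have "u' \<in> U (k + l)" using u' l by (auto simp: U_def intro: dvd_imp_le)
      then have "Min (\<kappa> ` U (k + l)) \<le> \<kappa> u'" using finU by (intro Min_le) auto
      then have "Min (\<kappa> ` U (k + l)) * L \<le> \<kappa> u' * L" by (rule mult_right_mono[OF _ L])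
      also have "\<dots> \<le> 2 * (\<kappa> u' * L)" using \<kappa>(1)[OF u'] L by simp
      also have "\<dots> \<le> 2 * disc A u' v' b y" using v'(4) by simp
      finally have "c k l * L \<le> 2 * disc A u' v' b y / (real k - real l)"
        using lk by (simp add: c_def divide_right_mono)
      then have "real N / (real k + real l) + c k l * L
        \<le> real N / (real k + real l) + 2 * disc A u' v' b y / (real k - real l)" by (rule add_left_mono)
      also have "\<dots> \<le> real (max_sum_free k l A)"
        using max_sum_free_ge_disc[OF A(1) u' v'(1) l lk kn v'(3), of y] A(2) by simp
      finally show "real N / (real k + real l) + c k l * (ln (real N) / ln (ln (real N))) \<le> real (max_sum_free k l A)"
        unfolding L_def .
    qed
  qed
qed

end
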